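(* Let $\Phi=\mathbf{E}_\varphi+\psi:\mathbb{R}^d\to\mathbb{R}\cup\{+\infty\}$, where: $\psi:\mathbb{R}^d\to\mathbb{R}\cup\{+\infty\}$ is proper, lower semicontinuous and prox-bounded; $\varphi:\Xi\times\mathbb{R}^d\to\mathbb{R}$ is an upper-$C^2$ normal integrand; and $\xi\mapsto\inf_{x\in\mathbb{R}^d}(\varphi(\xi,x)+\psi(x))$ is integrable. Let $\mathcal{S}$ be the set of stationary points of $\Phi$ and suppose that $\varphi$ is $C^{1,1}$ around $\mathcal{S}$. Assume that the sample sizes satisfy $$\sum_{k=1}^\infty\frac{\ln(n_k)}{\sqrt{n_k}}<+\infty.$$ Let $(x^k)_{k\in\mathbb{N}}$ be the sequence generated by the PSS algorithm from $x^0\in\operatorname{dom}\Phi$, under the sampling and filtration assumptions (all described in the context). Then there exists a measurable set $\hat\Omega\subseteq\Omega$ with $\mathbb{P}(\Omega\setminus\hat\Omega)=0$ such that, for every $\omega\in\hat\Omega$: whenever the sequence $(x^k(\omega))_{k\in\mathbb{N}}$ is bounded and has an accumulation point $\bar x$ at which the Kurdyka–Łojasiewicz condition for $\Phi$ holds with a desingularizing function $\theta$ satisfying the quasi-additivity type property and such that, for some $p_0\in\mathbb{N}$, $$\sum_{k=p_0}^\infty\left(\theta'\Big(\sum_{t=k}^\infty\frac{\ln(n_t)}{\sqrt{n_t}}\Big)\right)^{-1}<+\infty,$$ and $\Phi(x^k)>\Phi(\bar x)$ for all $k\ge p_0$, then the whole sequence $(x^k(\omega))_{k\in\mathbb{N}}$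 converges to $\bar x$ as $k\to\infty$.
   Context: $\mathbb{N}=\{0,1,2,\dots\}$. $\mathbb{B}_r(x)$, $\mathbb{B}_r[x]$ are open, closed balls. $(\Xi,\mathcal{A},\mu)$ is a probability space, $L^p_\mu$ is the space of $p$-integrable functions on it, and $\varphi_\xi(x):=\varphi(\xi,x)$. Normal integrand: $\varphi:\Xi\times\mathbb{R}^d\to\mathbb{R}\cup\{+\infty\}$ is a normal integrand if $\xi\mapsto\operatorname{epi}\varphi_\xi$ is a measurable multifunction with closed values (a multifunction $M$ is measurable if $\{t: M(t)\cap U\ne\emptyset\}\in\mathcal{A}$ for all open $U$). It is locally Lipschitz around $\bar x$ with square integrable modulus if $\varphi(\cdot,\bar x)\in L^2_\mu$ and there are $\kappa\in L^2_\mu$ and a neighborhood $V$ of $\bar x$ with $|\varphi_\xi(y)-\varphi_\xi(z)|\le\kappa(\xi)\|y-z\|$ for all $y,z\in V$, $\xi\in\Xi$. It is upper-$C^2$ around $\bar x$ if it is locally Lipschitz around $\bar x$ with square integrable modulus and there exist a neighborhood $V$ of $\bar x$ and a nonnegative $\ell\in L^1_\mu$ such that for all $\xi\in\Xi$, $x\in V$, $v\in\partial\varphi_\xi(x)$: $\varphi_\xi(y)\le\varphi_\xi(x)+\langle v,y-x\rangle+\ell(\xi)\|y-x\|^2$ for all $y\in V$. It is an upper-$C^2$ normal integrand if it is upper-$C^2$ around every $\bar x\in\mathbb{R}^d$. $\partial$ denotes the Clarke subdifferential (for a lower semicontinuous extended-valued function such as $\Phi$: $v\in\partial f(x)$ iff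 $f(x)<+\infty$ and $(v,-1)$ lies in the Clarke normal cone of $\operatorname{epi}f$ at $(x,f(x))$). $C^{1,1}$: $\varphi$ is $C^{1,1}$ around $\bar x$ if there are $\kappa\in L^2_\mu$ and $\epsilon>0$ such that, for all $\xi\in\Xi$, $\varphi_\xi$ is differentiable on $\mathbb{B}_\epsilon[\bar x]$ and $\|\nabla_x\varphi(\xi,y)-\nabla_x\varphi(\xi,z)\|\le\kappa(\xi)\|y-z\|$ for all $y,z\in\mathbb{B}_\epsilon[\bar x]$, and $\nabla_x\varphi(\cdot,\bar x)\in L^2_\mu$. It is $C^{1,1}$ around a nonempty set if it is so around each of its points. Prox: $f$ is prox-bounded if $f+\frac{1}{2\gamma}\|\cdot\|^2$ is bounded below for some $\gamma>0$; the supremum of such $\gamma$ is the threshold $\gamma^f\in(0,+\infty]$. $\operatorname{prox}_{\gamma f}(x):=\operatorname{argmin}_{u\in\mathbb{R}^d}\{f(u)+\frac{1}{2\gamma}\|u-x\|^2\}$ (set-valued). Stationary point: $\bar x$ is a stationary point of $\Phi$ if there exist $\bar v\in\partial\mathbf{E}_\varphi(\bar x)$ and $\bar\gamma>0$ with $\bar x\in\operatorname{prox}_{\bar\gamma\psi}(\bar x-\bar\gamma\bar v)$. Kurdyka–Łojasiewicz (KL) condition for $\Phi$ at $\bar x$: there exist $\eta>0$ and a continuous concave function $\theta:[0,\eta]\to[0,+\infty)$ (the desingularizing function) with $\theta(0)=0$, $\theta$ continuously differentiable on $(0,\eta)$ with $\theta'>0$, such that $\theta'(\Phi(x)-\Phi(\bar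 x))\,\operatorname{dist}(0;\partial\Phi(x))\ge1$ for all $x\in\mathbb{B}_\eta(\bar x)$ with $\Phi(\bar x)<\Phi(x)<\Phi(\bar x)+\eta$. Quasi-additivity type property of $\theta$: there is $C\in(0,1]$ such that for all $t_1,t_2\in(0,\eta)$ with $t_1+t_2<\eta$, $C[\theta'(t_1+t_2)]^{-1}\le[\theta'(t_1)]^{-1}+[\theta'(t_2)]^{-1}$. The summability condition involving $\theta'$ implicitly requires that the arguments of $\theta'$ lie in $(0,\eta)$ for $k\ge p_0$. Sampling: $(\Omega,\mathcal{F},\mathbb{P})$ is a probability space, $\xi_i:\Omega\to\Xi$ ($i\ge1$) are i.i.d. random variables with law $\mu$, and $(n_k)_{k\in\mathbb{N}}$ is a nondecreasing sequence of positive integers with $n_k\to+\infty$. Set $\mathbf{E}_\varphi(x):=\int_\Xi\varphi(\xi,x)\,d\mu(\xi)$, $\mathbf{E}^k_\varphi(x):=\frac1{n_k}\sum_{j=1}^{n_k}\varphi(\xi_j,x)$, $\Phi:=\mathbf{E}_\varphi+\psi$, $\Phi_k:=\mathbf{E}^k_\varphi+\psi$. PSS algorithm: parameters $x^0\in\operatorname{dom}\psi$, $\rho\in(0,1)$, $\sigma>0$, $\gamma_{\min}>0$. At iteration $k=0,1,2,\dots$: choose $v_i^k\in\partial\varphi_{\xi_i}(x^k)$, $i=1,\dots,n_k$, and set $v^k:=\frac1{n_k}\sum_{i=1}^{n_k}v_i^k$; take $\overline\gamma_k\in[\gamma_{\min},\gamma^\psi)$ and set $\gamma_k:=\overline\gamma_k$;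 compute $\hat x^k\in\operatorname{prox}_{\gamma_k\psi}(x^k-\gamma_kv^k)$; while $\Phi_k(\hat x^k)>\Phi_k(x^k)-\sigma\|\hat x^k-x^k\|^2$, replace $\gamma_k$ by $\rho\gamma_k$ and recompute $\hat x^k\in\operatorname{prox}_{\gamma_k\psi}(x^k-\gamma_kv^k)$; finally set $x^{k+1}:=\hat x^k$. Filtration: there is a filtration $(\mathcal{F}_k)_{k\in\mathbb{N}}$ of sub-$\sigma$-algebras of $\mathcal{F}$, representing all the information used by the algorithm up to iteration $k$ (in particular $x^{k+1}$, computed in iteration $k$, is $\mathcal{F}_k$-measurable), such that $\xi_j$ is $\mathcal{F}_k$-measurable for $j\le n_k$ and $\xi_j$ is independent of $\mathcal{F}_k$ for $j>n_k$. *)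

theory Defs
  imports "HOL-Probability.Probability" "HOL-Probability.Stopping_Time"
begin

section \<open>Extended-valued functions\<close>

text \<open>Functions with values in R with +infinity adjoined are functions into \<^typ>\<open>ereal\<close> that avoid
  the value -infinity; this is part of \<open>proper\<close> and \<open>normal_integrand\<close>.\<close>

definition epi :: "('a \<Rightarrow> ereal) \<Rightarrow> ('a \<times> real) set"
  where "epi f = {(x, r). f x \<le> ereal r}"

definition edom :: "('a \<Rightarrow> ereal) \<Rightarrow> 'a set"
  where "edom f = {x. f x < \<infinity>}"

definition proper :: "('a \<Rightarrow> ereal) \<Rightarrow> bool"
  where "proper f \<longleftrightarrow> edom f \<noteq> {} \<and> (\<forall>x. f x \<noteq> -\<infinity>)"

definition lsc :: "('a::topological_space \<Rightarrow> ereal) \<Rightarrow> bool"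
  where "lsc f \<longleftrightarrow> (\<forall>x. f x \<le> Liminf (at x) f)"

section \<open>Clarke subdifferential\<close>

text \<open>The tangent cone is given by its usual sequential definition (points of \<open>S\<close> tending to \<open>z\<close>,
  stepsizes decreasing to 0), the normal cone is its polar, and the subdifferential is read off
  the normal cone of the epigraph. For a finite locally Lipschitz function, embedded via
  \<^const>\<open>ereal\<close>, this is the Clarke generalized gradient, so one definition serves
  for the integrands, for their expectation and for the extended-valued objective.\<close>

definition clarke_tangent_cone :: "'b::real_normed_vector set \<Rightarrow> 'b \<Rightarrow> 'b set"
  where "clarke_tangent_cone S z =
    {w. \<forall>Z t. (\<forall>i::nat. Z i \<in> S) \<and> Z \<longlonglongrightarrow> z \<and> (\<forall>i. (0::real) < t i) \<and> t \<longlonglongrightarrow> 0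
          \<longrightarrow> (\<exists>W. W \<longlonglongrightarrow> w \<and> (\<forall>i. Z i + t i *\<^sub>R W i \<in> S))}"

definition clarke_normal_cone :: "'b::real_inner set \<Rightarrow> 'b \<Rightarrow> 'b set"
  where "clarke_normal_cone S z = {p. \<forall>w\<in>clarke_tangent_cone S z. p \<bullet> w \<le> 0}"

definition clarke_subdiff :: "('a::real_inner \<Rightarrow> ereal) \<Rightarrow> 'a \<Rightarrow> 'a set"
  where "clarke_subdiff f x =
    {v. \<bar>f x\<bar> \<noteq> \<infinity> \<and> (v, -1) \<in> clarke_normal_cone (epi f) (x, real_of_ereal (f x))}"

section \<open>Normal integrands\<close>

definition measurable_multifunction :: "'xi measure \<Rightarrow> ('xi \<Rightarrow> 'b::topological_space set) \<Rightarrow> bool"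
  where "measurable_multifunction \<mu> M \<longleftrightarrow>
    (\<forall>U. open U \<longrightarrow> {\<xi> \<in> space \<mu>. M \<xi> \<inter> U \<noteq> {}} \<in> sets \<mu>)"

definition normal_integrand :: "'xi measure \<Rightarrow> ('xi \<Rightarrow> 'a::topological_space \<Rightarrow> ereal) \<Rightarrow> bool"
  where "normal_integrand \<mu> \<phi> \<longleftrightarrow>
    (\<forall>\<xi>\<in>space \<mu>. \<forall>x. \<phi> \<xi> x \<noteq> -\<infinity>) \<and>
    (\<forall>\<xi>\<in>space \<mu>. closed (epi (\<phi> \<xi>))) \<and>
    measurable_multifunction \<mu> (\<lambda>\<xi>. epi (\<phi> \<xi>))"

definition square_integrable ::
    "'xi measure \<Rightarrow> ('xi \<Rightarrow> 'b::{real_normed_vector, second_countable_topology}) \<Rightarrow> bool"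
  where "square_integrable \<mu> f \<longleftrightarrow>
    f \<in> borel_measurable \<mu> \<and> integrable \<mu> (\<lambda>\<xi>. (norm (f \<xi>))\<^sup>2)"

definition ereal_integrable :: "'xi measure \<Rightarrow> ('xi \<Rightarrow> ereal) \<Rightarrow> bool"
  where "ereal_integrable \<mu> g \<longleftrightarrow>
    g \<in> borel_measurable \<mu> \<and> (\<integral>\<^sup>+\<xi>. e2ennreal \<bar>g \<xi>\<bar> \<partial>\<mu>) < \<infinity>"

definition loc_lipschitz_L2 ::
    "'xi measure \<Rightarrow> ('xi \<Rightarrow> 'a::euclidean_space \<Rightarrow> real) \<Rightarrow> 'a \<Rightarrow> bool"
  where "loc_lipschitz_L2 \<mu> \<phi> xbar \<longleftrightarrow>
    square_integrable \<mu> (\<lambda>\<xi>. \<phi> \<xi> xbar) \<and>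
    (\<exists>\<kappa> V. square_integrable \<mu> (\<kappa> :: 'xi \<Rightarrow> real) \<and> open V \<and> xbar \<in> V \<and>
       (\<forall>\<xi>\<in>space \<mu>. \<forall>y\<in>V. \<forall>z\<in>V. \<bar>\<phi> \<xi> y - \<phi> \<xi> z\<bar> \<le> \<kappa> \<xi> * norm (y - z)))"

definition upper_C2_around ::
    "'xi measure \<Rightarrow> ('xi \<Rightarrow> 'a::euclidean_space \<Rightarrow> real) \<Rightarrow> 'a \<Rightarrow> bool"
  where "upper_C2_around \<mu> \<phi> xbar \<longleftrightarrow>
    loc_lipschitz_L2 \<mu> \<phi> xbar \<and>
    (\<exists>V l. open V \<and> xbar \<in> V \<and> integrable \<mu> l \<and> (\<forall>\<xi>\<in>space \<mu>. (0::real) \<le> l \<xi>) \<and>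
       (\<forall>\<xi>\<in>space \<mu>. \<forall>x\<in>V. \<forall>v\<in>clarke_subdiff (\<lambda>y. ereal (\<phi> \<xi> y)) x. \<forall>y\<in>V.
          \<phi> \<xi> y \<le> \<phi> \<xi> x + v \<bullet> (y - x) + l \<xi> * (norm (y - x))\<^sup>2))"

definition upper_C2_normal_integrand ::
    "'xi measure \<Rightarrow> ('xi \<Rightarrow> 'a::euclidean_space \<Rightarrow> real) \<Rightarrow> bool"
  where "upper_C2_normal_integrand \<mu> \<phi> \<longleftrightarrow>
    normal_integrand \<mu> (\<lambda>\<xi> x. ereal (\<phi> \<xi> x)) \<and> (\<forall>xbar. upper_C2_around \<mu> \<phi> xbar)"

definition C11_around ::
    "'xi measure \<Rightarrow> ('xi \<Rightarrow> 'a::euclidean_space \<Rightarrow> real) \<Rightarrow> 'a \<Rightarrow> bool"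
  where "C11_around \<mu> \<phi> xbar \<longleftrightarrow>
    (\<exists>\<kappa> \<epsilon> G. square_integrable \<mu> (\<kappa> :: 'xi \<Rightarrow> real) \<and> \<epsilon> > 0 \<and>
       (\<forall>\<xi>\<in>space \<mu>. \<forall>y\<in>cball xbar \<epsilon>. GDERIV (\<phi> \<xi>) y :> G \<xi> y) \<and>
       (\<forall>\<xi>\<in>space \<mu>. \<forall>y\<in>cball xbar \<epsilon>. \<forall>z\<in>cball xbar \<epsilon>.
          norm (G \<xi> y - G \<xi> z) \<le> \<kappa> \<xi> * norm (y - z)) \<and>
       square_integrable \<mu> (\<lambda>\<xi>. G \<xi> xbar))"

definition C11_around_set ::
    "'xi measure \<Rightarrow> ('xi \<Rightarrow> 'a::euclidean_space \<Rightarrow> real) \<Rightarrow> 'a set \<Rightarrow> bool"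
  where "C11_around_set \<mu> \<phi> S \<longleftrightarrow> S \<noteq> {} \<and> (\<forall>x\<in>S. C11_around \<mu> \<phi> x)"

section \<open>Proximal mapping and stationarity\<close>

definition prox_params :: "('a::real_normed_vector \<Rightarrow> ereal) \<Rightarrow> real set"
  where "prox_params f =
    {\<gamma>. 0 < \<gamma> \<and> (\<exists>c::real. \<forall>x. ereal c \<le> f x + ereal ((norm x)\<^sup>2 / (2 * \<gamma>)))}"

definition prox_bounded :: "('a::real_normed_vector \<Rightarrow> ereal) \<Rightarrow> bool"
  where "prox_bounded f \<longleftrightarrow> prox_params f \<noteq> {}"

definition prox_threshold :: "('a::real_normed_vector \<Rightarrow> ereal) \<Rightarrow> ereal"
  where "prox_threshold f = (SUP \<gamma>\<in>prox_params f. ereal \<gamma>)"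

definition prox :: "real \<Rightarrow> ('a::real_normed_vector \<Rightarrow> ereal) \<Rightarrow> 'a \<Rightarrow> 'a set"
  where "prox \<gamma> f x =
    {u. is_arg_min (\<lambda>u. f u + ereal ((norm (u - x))\<^sup>2 / (2 * \<gamma>))) (\<lambda>_. True) u}"

definition expected :: "'xi measure \<Rightarrow> ('xi \<Rightarrow> 'a \<Rightarrow> real) \<Rightarrow> 'a \<Rightarrow> real"
  where "expected \<mu> \<phi> x = (\<integral>\<xi>. \<phi> \<xi> x \<partial>\<mu>)"

definition objective :: "'xi measure \<Rightarrow> ('xi \<Rightarrow> 'a \<Rightarrow> real) \<Rightarrow> ('a \<Rightarrow> ereal) \<Rightarrow> 'a \<Rightarrow> ereal"
  where "objective \<mu> \<phi> \<psi> x = ereal (expected \<mu> \<phi> x) + \<psi> x"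

definition stationary_points ::
    "'xi measure \<Rightarrow> ('xi \<Rightarrow> 'a::euclidean_space \<Rightarrow> real) \<Rightarrow> ('a \<Rightarrow> ereal) \<Rightarrow> 'a set"
  where "stationary_points \<mu> \<phi> \<psi> =
    {x. \<exists>v\<in>clarke_subdiff (\<lambda>y. ereal (expected \<mu> \<phi> y)) x.
        \<exists>\<gamma>>0. x \<in> prox \<gamma> \<psi> (x - \<gamma> *\<^sub>R v)}"

section \<open>Kurdyka--Lojasiewicz condition\<close>

text \<open>The infimum is taken in the extended reals, so that the distance to the empty set is
  +infinity (\<open>infdist\<close> gives 0).\<close>

definition edist_set :: "'a::metric_space \<Rightarrow> 'a set \<Rightarrow> ereal"
  where "edist_set x S = (INF v\<in>S. ereal (dist x v))"

text \<open>Only the restriction of \<open>\<theta>\<close> to \<open>{0..\<eta>}\<close> is relevant.\<close>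

definition desingularizing :: "real \<Rightarrow> (real \<Rightarrow> real) \<Rightarrow> bool"
  where "desingularizing \<eta> \<theta> \<longleftrightarrow>
    continuous_on {0..\<eta>} \<theta> \<and> concave_on {0..\<eta>} \<theta> \<and> (\<forall>t\<in>{0..\<eta>}. 0 \<le> \<theta> t) \<and> \<theta> 0 = 0 \<and>
    (\<forall>t\<in>{0<..<\<eta>}. \<theta> differentiable (at t)) \<and> continuous_on {0<..<\<eta>} (deriv \<theta>) \<and>
    (\<forall>t\<in>{0<..<\<eta>}. 0 < deriv \<theta> t)"

definition KL_condition ::
    "('a::euclidean_space \<Rightarrow> ereal) \<Rightarrow> 'a \<Rightarrow> real \<Rightarrow> (real \<Rightarrow> real) \<Rightarrow> bool"
  where "KL_condition \<Phi> xbar \<eta> \<theta> \<longleftrightarrow>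
    0 < \<eta> \<and> desingularizing \<eta> \<theta> \<and>
    (\<forall>x\<in>ball xbar \<eta>. \<Phi> xbar < \<Phi> x \<and> \<Phi> x < \<Phi> xbar + ereal \<eta> \<longrightarrow>
       1 \<le> ereal (deriv \<theta> (real_of_ereal (\<Phi> x - \<Phi> xbar))) * edist_set 0 (clarke_subdiff \<Phi> x))"

definition quasi_additive :: "real \<Rightarrow> (real \<Rightarrow> real) \<Rightarrow> bool"
  where "quasi_additive \<eta> \<theta> \<longleftrightarrow>
    (\<exists>C. 0 < C \<and> C \<le> 1 \<and>
       (\<forall>t1\<in>{0<..<\<eta>}. \<forall>t2\<in>{0<..<\<eta>}. t1 + t2 < \<eta> \<longrightarrow>
          C * inverse (deriv \<theta> (t1 + t2)) \<le> inverse (deriv \<theta> t1) + inverse (deriv \<theta> t2)))"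

definition accumulation_point :: "(nat \<Rightarrow> 'a::topological_space) \<Rightarrow> 'a \<Rightarrow> bool"
  where "accumulation_point X xbar \<longleftrightarrow> (\<exists>r. strict_mono r \<and> (X \<circ> r) \<longlonglongrightarrow> xbar)"

section \<open>The PSS algorithm\<close>

text \<open>Samples are numbered from 1: \<open>s 1, s 2, \<dots>\<close> is a realization of the sample sequence.\<close>

definition empirical :: "('xi \<Rightarrow> 'a \<Rightarrow> real) \<Rightarrow> (nat \<Rightarrow> 'xi) \<Rightarrow> nat \<Rightarrow> 'a \<Rightarrow> real"
  where "empirical \<phi> s N x = (\<Sum>j=1..N. \<phi> (s j) x) / real N"

definition empirical_objective ::
    "('xi \<Rightarrow> 'a \<Rightarrow> real) \<Rightarrow> ('a \<Rightarrow> ereal) \<Rightarrow> (nat \<Rightarrow> 'xi) \<Rightarrow> nat \<Rightarrow> 'a \<Rightarrow> ereal"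
  where "empirical_objective \<phi> \<psi> s N x = ereal (empirical \<phi> s N x) + \<psi> x"

text \<open>The backtracking loop, with objective \<open>F\<close>, current iterate \<open>x\<close> and direction \<open>v\<close>:
  \<open>backtracking \<rho> \<sigma> \<psi> F x v \<gamma> u\<close> says that the loop entered with stepsize \<open>\<gamma>\<close> can terminate
  with the trial point \<open>u\<close>. The predicate is a relation because the proximal mapping is
  set-valued.\<close>

inductive backtracking ::
    "real \<Rightarrow> real \<Rightarrow> ('a::euclidean_space \<Rightarrow> ereal) \<Rightarrow> ('a \<Rightarrow> ereal) \<Rightarrow> 'a \<Rightarrow> 'a \<Rightarrow> real \<Rightarrow> 'a \<Rightarrow> bool"
  for \<rho> \<sigma> :: real and \<psi> F :: "'a::euclidean_space \<Rightarrow> ereal" and x v :: 'a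
where
  accept: "u \<in> prox \<gamma> \<psi> (x - \<gamma> *\<^sub>R v) \<Longrightarrow> \<not> F u > F x - ereal (\<sigma> * (norm (u - x))\<^sup>2)
    \<Longrightarrow> backtracking \<rho> \<sigma> \<psi> F x v \<gamma> u"
| reject: "u \<in> prox \<gamma> \<psi> (x - \<gamma> *\<^sub>R v) \<Longrightarrow> F u > F x - ereal (\<sigma> * (norm (u - x))\<^sup>2)
    \<Longrightarrow> backtracking \<rho> \<sigma> \<psi> F x v (\<rho> * \<gamma>) u' \<Longrightarrow> backtracking \<rho> \<sigma> \<psi> F x v \<gamma> u'"

definition pss_iteration ::
    "real \<Rightarrow> real \<Rightarrow> real \<Rightarrow> ('xi \<Rightarrow> 'a::euclidean_space \<Rightarrow> real) \<Rightarrow> ('a \<Rightarrow> ereal)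
      \<Rightarrow> (nat \<Rightarrow> 'xi) \<Rightarrow> nat \<Rightarrow> 'a \<Rightarrow> 'a \<Rightarrow> bool"
  where "pss_iteration \<rho> \<sigma> \<gamma>min \<phi> \<psi> s N x x' \<longleftrightarrow>
    (\<exists>v \<gamma>. (\<forall>i\<in>{1..N}. v i \<in> clarke_subdiff (\<lambda>y. ereal (\<phi> (s i) y)) x) \<and>
       \<gamma>min \<le> \<gamma> \<and> ereal \<gamma> < prox_threshold \<psi> \<and>
       backtracking \<rho> \<sigma> \<psi> (empirical_objective \<phi> \<psi> s N) x
         ((1 / real N) *\<^sub>R (\<Sum>i=1..N. v i)) \<gamma> x')"

definition pss_sequence ::
    "real \<Rightarrow> real \<Rightarrow> real \<Rightarrow> ('xi \<Rightarrow> 'a::euclidean_space \<Rightarrow> real) \<Rightarrow> ('a \<Rightarrow> ereal)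
      \<Rightarrow> (nat \<Rightarrow> nat) \<Rightarrow> 'a \<Rightarrow> (nat \<Rightarrow> 'xi) \<Rightarrow> (nat \<Rightarrow> 'a) \<Rightarrow> bool"
  where "pss_sequence \<rho> \<sigma> \<gamma>min \<phi> \<psi> n x0 s X \<longleftrightarrow>
    X 0 = x0 \<and> (\<forall>k. pss_iteration \<rho> \<sigma> \<gamma>min \<phi> \<psi> s (n k) (X k) (X (Suc k)))"

definition sample_rate :: "(nat \<Rightarrow> nat) \<Rightarrow> nat \<Rightarrow> real"
  where "sample_rate n k = ln (real (n k)) / sqrt (real (n k))"

section \<open>Sampling and filtration\<close>

definition iid_samples :: "'w measure \<Rightarrow> 'xi measure \<Rightarrow> (nat \<Rightarrow> 'w \<Rightarrow> 'xi) \<Rightarrow> bool"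
  where "iid_samples P \<mu> \<xi> \<longleftrightarrow>
    prob_space.indep_vars P (\<lambda>_. \<mu>) \<xi> {1..} \<and> (\<forall>i\<ge>1. distr P \<mu> (\<xi> i) = \<mu>)"

definition sampling_filtration ::
    "'w measure \<Rightarrow> 'xi measure \<Rightarrow> (nat \<Rightarrow> 'w \<Rightarrow> 'xi) \<Rightarrow> (nat \<Rightarrow> nat)
      \<Rightarrow> (nat \<Rightarrow> 'w \<Rightarrow> 'a::euclidean_space) \<Rightarrow> (nat \<Rightarrow> 'w measure) \<Rightarrow> bool"
  where "sampling_filtration P \<mu> \<xi> n x F \<longleftrightarrow>
    filtration (space P) F \<and> (\<forall>k. subalgebra P (F k)) \<and>
    (\<forall>k. x (Suc k) \<in> borel_measurable (F k)) \<and>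
    (\<forall>k. \<forall>j\<in>{1..n k}. \<xi> j \<in> measurable (F k) \<mu>) \<and>
    (\<forall>k. \<forall>j>n k. prob_space.indep_set P
        {\<xi> j -` A \<inter> space P | A. A \<in> sets \<mu>} (sets (F k)))"

end

theory Submission
  imports Defs
begin

text \<open>
  Write \<open>\<Phi>\<close> for the objective, \<open>\<Phi>\<^sub>k\<close> for its sample average version and \<open>a k = ln (n k) / sqrt (n k)\<close>. The proof
  separates chance from optimization: outside a null set finitely many kinds of local estimates hold
  simultaneously, and for each outcome satisfying them the convergence of a bounded trajectory is a deterministic matter.

  \<^emph>\<open>Estimates for the samples.\<close> Near every point, sample averages of the integrand approximate its expectation
  uniformly with error \<open>O(a k)\<close> (\<open>local_value_rate\<close>), and near every stationary point the same
  is true for the gradients (\<open>local_gradient_rate\<close>). Both are instances of \<open>uniform_rate\<close>, a law of large numbers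
  with rate that is uniform over bounded sets: the estimates therefore apply to the random iterates, although these depend on
  the very samples over which one averages. Averages of the Lipschitz moduli and of the moduli of upper
  quadratic growth, which are merely integrable, stay bounded (\<open>bounded_averages\<close>); so sampled
  subgradients are locally bounded and sample averages have local quadratic upper bounds with a fixed constant.
  Lindelof's theorem makes these statements hold at all points with a single null set.

  \<^emph>\<open>Deterministic part.\<close> The descent test for \<open>\<Phi>\<^sub>k\<close> turns into
  \<open>\<Phi>(x\<^sub>k\<^sub>+\<^sub>1) \<le> \<Phi>(x\<^sub>k) - \<sigma> |x\<^sub>k\<^sub>+\<^sub>1 - x\<^sub>k|\<^sup>2 + O(a k)\<close>. As \<open>a\<close> is summable, values converge and steps
  tend to 0. The quadratic upper bounds keep the accepted stepsizes away from 0 (\<open>stepsize_bounded_below\<close>), so that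
  accumulation points are stationary and the values converge to the value there
  (\<open>accumulation_point_properties\<close>). Hence the integrand is smooth near the accumulation point, and the optimality
  condition of the proximal step gives a subgradient of \<open>\<Phi>\<close> at \<open>x\<^sub>k\<^sub>+\<^sub>1\<close> of norm \<open>O(|x\<^sub>k\<^sub>+\<^sub>1 - x\<^sub>k| + a k)\<close>.
  These two inequalities feed the Kurdyka--Lojasiewicz argument \<open>KL_convergence\<close>: quasi-additivity of \<open>\<theta>\<close> separates
  the influence of the values from that of the tails of \<open>a\<close>, whose total contribution is finite by
  assumption, and the trajectory has finite length.
\<close>

section \<open>Averages of independent samples\<close>

text \<open>The two probabilistic facts of the development, \<open>bounded_averages\<close> and \<open>uniform_rate\<close>,
  concern an i.i.d. sequence only and are proved in this locale.\<close>

locale iid_sampling = prob_space P for P :: "'w measure" +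
  fixes \<mu> :: "'xi measure" and \<xi> :: "nat \<Rightarrow> 'w \<Rightarrow> 'xi"
  assumes iid: "iid_samples P \<mu> \<xi>"
begin

lemma sample_measurable [measurable]: "1 \<le> i \<Longrightarrow> \<xi> i \<in> measurable P \<mu>"
  using iid by (auto simp: iid_samples_def indep_vars_def)

lemma sample_in_space: "1 \<le> i \<Longrightarrow> \<omega> \<in> space P \<Longrightarrow> \<xi> i \<omega> \<in> space \<mu>"
  using sample_measurable by (meson measurable_space)

lemma distr_sample: "1 \<le> i \<Longrightarrow> distr P \<mu> (\<xi> i) = \<mu>"
  using iid by (auto simp: iid_samples_def)

lemma integrable_sample:
  fixes g :: "'xi \<Rightarrow> real"
  assumes "integrable \<mu> g" "1 \<le> i"
  shows "integrable P (\<lambda>\<omega>. g (\<xi> i \<omega>))"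
  using assms distr_sample[of i] by (metis integrable_distr sample_measurable)

lemma expectation_sample:
  fixes g :: "'xi \<Rightarrow> real"
  assumes "g \<in> borel_measurable \<mu>" "1 \<le> i"
  shows "expectation (\<lambda>\<omega>. g (\<xi> i \<omega>)) = integral\<^sup>L \<mu> g"
  using integral_distr[OF sample_measurable[OF assms(2)] assms(1)] distr_sample[OF assms(2)] by simp

lemma indep_samples:
  fixes g :: "'xi \<Rightarrow> real"
  assumes "g \<in> borel_measurable \<mu>" "I \<subseteq> {1..}"
  shows "indep_vars (\<lambda>_. borel) (\<lambda>i \<omega>. g (\<xi> i \<omega>)) I"
proof -
  have "indep_vars (\<lambda>_. \<mu>) \<xi> I"
    using iid assms(2) by (auto simp: iid_samples_def intro: indep_vars_subset)
  then show ?thesis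
    by (rule indep_vars_compose2) (use assms in auto)
qed

lemma prob_space_law: "prob_space \<mu>"
  using prob_space_distr[OF sample_measurable[of 1]] distr_sample[of 1] by simp

lemma integrable_of_square:
  fixes g :: "'xi \<Rightarrow> real"
  assumes "g \<in> borel_measurable \<mu>" "integrable \<mu> (\<lambda>z. (g z)\<^sup>2)"
  shows "integrable \<mu> g"
proof -
  interpret law: prob_space \<mu> by (rule prob_space_law)
  show ?thesis using law.square_integrable_imp_integrable assms by blast
qed

lemma second_moment_centered_sum:
  fixes g :: "'xi \<Rightarrow> real"
  assumes g: "g \<in> borel_measurable \<mu>" "integrable \<mu> (\<lambda>z. (g z)\<^sup>2)" and zero: "integral\<^sup>L \<mu> g = 0"
  shows "integrable P (\<lambda>\<omega>. (\<Sum>j=1..N. g (\<xi> j \<omega>))\<^sup>2)"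
    and "expectation (\<lambda>\<omega>. (\<Sum>j=1..N. g (\<xi> j \<omega>))\<^sup>2) = real N * integral\<^sup>L \<mu> (\<lambda>z. (g z)\<^sup>2)"
proof -
  have ig: "integrable \<mu> g" by (rule integrable_of_square) (use g in auto)
  have prod: "integrable P (\<lambda>\<omega>. g (\<xi> i \<omega>) * g (\<xi> j \<omega>)) \<and>
      expectation (\<lambda>\<omega>. g (\<xi> i \<omega>) * g (\<xi> j \<omega>)) = (if i = j then integral\<^sup>L \<mu> (\<lambda>z. (g z)\<^sup>2) else 0)"
    if "1 \<le> i" "1 \<le> j" for i j
  proof (cases "i = j")
    case True
    then show ?thesis
      using integrable_sample[OF g(2) that(1)] expectation_sample[of "\<lambda>z. (g z)\<^sup>2" i] that g(1)
      by (simp add: power2_eq_square)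
  next
    case False
    have ind: "indep_vars (\<lambda>_. borel) (\<lambda>i \<omega>. g (\<xi> i \<omega>)) {i, j}"
      by (rule indep_samples) (use that g in auto)
    have int: "integrable P (\<lambda>\<omega>. g (\<xi> k \<omega>))" if "k \<in> {i, j}" for k
      using integrable_sample[OF ig] \<open>1 \<le> i\<close> \<open>1 \<le> j\<close> that by auto
    from indep_vars_lebesgue_integral[OF _ ind int] indep_vars_integrable[OF _ ind int]
    show ?thesis
      using False expectation_sample[OF g(1), of i] zero that by simp
  qed
  have eq: "(\<Sum>j=1..N. g (\<xi> j \<omega>))\<^sup>2 = (\<Sum>i=1..N. \<Sum>j=1..N. g (\<xi> i \<omega>) * g (\<xi> j \<omega>))" for \<omega>
    by (simp add: power2_eq_square sum_product)
  show "integrable P (\<lambda>\<omega>. (\<Sum>j=1..N. g (\<xi> j \<omega>))\<^sup>2)"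
    unfolding eq by (intro Bochner_Integration.integrable_sum) (use prod in auto)
  have "expectation (\<lambda>\<omega>. (\<Sum>j=1..N. g (\<xi> j \<omega>))\<^sup>2)
     = (\<Sum>i=1..N. \<Sum>j=1..N. (if i = j then integral\<^sup>L \<mu> (\<lambda>z. (g z)\<^sup>2) else 0))"
    unfolding eq using prod by (subst Bochner_Integration.integral_sum) (auto intro!: sum.cong)
  also have "\<dots> = real N * integral\<^sup>L \<mu> (\<lambda>z. (g z)\<^sup>2)"
    by (simp add: sum.delta)
  finally show "expectation (\<lambda>\<omega>. (\<Sum>j=1..N. g (\<xi> j \<omega>))\<^sup>2) = real N * integral\<^sup>L \<mu> (\<lambda>z. (g z)\<^sup>2)" .
qed

end

text \<open>This elementary bound is what lets a second-moment argument work under a first-moment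
  assumption: the terms with \<open>2^m \<le> h\<close> form an increasing geometric sum of size at most \<open>2 * h\<close>, those
  with \<open>2^m > h\<close> a decreasing one of the same size. The right-hand side of the invariant is the
  resulting closed form in the two regimes.\<close>

lemma dyadic_truncation_sum:
  fixes h :: real
  assumes "0 \<le> h"
  shows "(\<Sum>m<K. (min h (2^m))\<^sup>2 / 2^m) \<le> 4 * h"
proof -
  have "(\<Sum>m<K. (min h (2^m))\<^sup>2 / 2^m) \<le> (if 2^K \<le> 2 * h then 2^K else 4 * h - 2 * h\<^sup>2 / 2^K)"
  proof (induction K)
    case 0
    have "2 * h\<^sup>2 \<le> 4 * h" if "h < 1/2"
      using that assms mult_mono[of h "1/2" h h] by (simp add: power2_eq_square)
    then show ?case using assms by auto
  next
    case (Suc K)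
    define z :: real where "z = 2^K"
    have z: "z > 0" "2^Suc K = 2 * z" by (auto simp: z_def)
    consider "2 * z \<le> 2 * h" | "z \<le> 2 * h" "h < z" | "2 * h < z" by linarith
    then have "(if z \<le> 2 * h then z else 4 * h - 2 * h\<^sup>2 / z) + (min h z)\<^sup>2 / z
        \<le> (if 2 * z \<le> 2 * h then 2 * z else 4 * h - 2 * h\<^sup>2 / (2 * z))"
    proof cases
      case 1
      then show ?thesis using z assms by (simp add: power2_eq_square)
    next
      case 2
      have "(2 * h - z) * (z - h) \<ge> 0" using 2 by simp
      then have "z * z + 2 * h\<^sup>2 \<le> 3 * (h * z)" by (simp add: algebra_simps power2_eq_square)
      moreover have "0 \<le> h * z" using z assms by simp
      ultimately have "z * z + 2 * h\<^sup>2 \<le> 4 * h * z" by (simp add: algebra_simps)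
      then have "z + 2 * h\<^sup>2 / z \<le> 4 * h" using z by (simp add: field_simps power2_eq_square)
      then show ?thesis using z 2 by (simp add: min_def)
    next
      case 3
      then show ?thesis using z assms by (simp add: min_def field_simps power2_eq_square)
    qed
    moreover have "(\<Sum>m<Suc K. (min h (2^m))\<^sup>2 / 2^m)
        \<le> (if z \<le> 2 * h then z else 4 * h - 2 * h\<^sup>2 / z) + (min h z)\<^sup>2 / z"
      unfolding sum.lessThan_Suc z_def by (rule add_right_mono[OF Suc])
    ultimately show ?case unfolding z(2) by (rule order_trans[rotated])
  qed
  also have "\<dots> \<le> 4 * h" using assms by auto
  finally show ?thesis .
qed

text \<open>Either some \<open>h (\<xi> j)\<close> exceeds the level \<open>N\<close>, or the sum agrees with the sum of the truncated
  variables \<open>min h N\<close>, whose mean is at most \<open>m\<close> and which must then deviate by at least \<open>N\<close>. Markov's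
  inequality for the squares bounds both probabilities by the truncated second moment over \<open>N\<close>.\<close>

lemma (in iid_sampling) prob_average_large:
  assumes h: "integrable \<mu> h" "\<And>z. z \<in> space \<mu> \<Longrightarrow> (0::real) \<le> h z"
  defines "m \<equiv> integral\<^sup>L \<mu> h"
  assumes N: "0 < N"
  shows "prob {\<omega> \<in> space P. (\<Sum>j=1..N. h (\<xi> j \<omega>)) \<ge> real N * (m + 1)}
    \<le> 2 * (\<integral>z. (min (h z) (real N))\<^sup>2 \<partial>\<mu>) / real N"
proof -
  interpret law: prob_space \<mu> by (rule prob_space_law)
  have [measurable]: "h \<in> borel_measurable \<mu>" using h by auto
  define t where "t = (\<lambda>z. min (h z) (real N))"
  have tb: "0 \<le> t z" "t z \<le> real N" "t z \<le> h z" if "z \<in> space \<mu>" for z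
    using h(2)[OF that] by (auto simp: t_def)
  have [measurable]: "t \<in> borel_measurable \<mu>" by (auto simp: t_def)
  have it: "integrable \<mu> t" 
    by (rule law.integrable_const_bound[where B="real N"]) (use tb in \<open>auto intro!: AE_I2\<close>)
  have it2: "integrable \<mu> (\<lambda>z. (t z)\<^sup>2)" 
    by (rule law.integrable_const_bound[where B="(real N)\<^sup>2"]) 
       (use tb in \<open>auto intro!: AE_I2 power_mono\<close>)
  define q where "q = (\<integral>z. (t z)\<^sup>2 \<partial>\<mu>)"
  define mt where "mt = integral\<^sup>L \<mu> t"
  have mt: "mt \<le> m" unfolding mt_def m_def by (rule integral_mono[OF it h(1)]) (use tb in auto)
  define g where "g = (\<lambda>z. t z - mt)"
  have gm [measurable]: "g \<in> borel_measurable \<mu>" by (auto simp: g_def)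
  have g2eq: "(g z)\<^sup>2 = (t z)\<^sup>2 - 2 * mt * t z + mt\<^sup>2" for z
    by (simp add: g_def power2_eq_square algebra_simps)
  have ig2: "integrable \<mu> (\<lambda>z. (g z)\<^sup>2)" unfolding g2eq using it it2 by auto
  have "integral\<^sup>L \<mu> (\<lambda>z. (g z)\<^sup>2) = q - 2 * mt * mt + mt\<^sup>2"
    unfolding g2eq q_def using it it2 by (simp add: mt_def law.prob_space)
  then have g2: "integral\<^sup>L \<mu> (\<lambda>z. (g z)\<^sup>2) \<le> q" by (simp add: power2_eq_square)
  have g0: "integral\<^sup>L \<mu> g = 0" unfolding g_def using it by (simp add: mt_def law.prob_space)
  note mom = second_moment_centered_sum[OF gm ig2 g0, of N]
  define A1 where "A1 = {\<omega> \<in> space P. (\<Sum>j=1..N. g (\<xi> j \<omega>))\<^sup>2 \<ge> (real N)\<^sup>2}"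
  have "prob A1 \<le> expectation (\<lambda>\<omega>. (\<Sum>j=1..N. g (\<xi> j \<omega>))\<^sup>2) / (real N)\<^sup>2"
    unfolding A1_def by (rule integral_Markov_inequality_measure[where A="{}"]) (use mom N in auto)
  also have "\<dots> = integral\<^sup>L \<mu> (\<lambda>z. (g z)\<^sup>2) / real N" using mom(2) N by (simp add: power2_eq_square)
  also have "\<dots> \<le> q / real N" using g2 by (simp add: divide_right_mono)
  finally have p1: "prob A1 \<le> q / real N" .
  define B where "B j = {\<omega> \<in> space P. (t (\<xi> j \<omega>))\<^sup>2 \<ge> (real N)\<^sup>2}" for j
  have Bs: "B j \<in> events" if "j \<in> {1..N}" for j
  proof -
    have [measurable]: "\<xi> j \<in> measurable P \<mu>" using that by auto
    show ?thesis unfolding B_def by measurable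
  qed
  have pB: "prob (B j) \<le> q / (real N)\<^sup>2" if "j \<in> {1..N}" for j
  proof -
    have "prob (B j) \<le> expectation (\<lambda>\<omega>. (t (\<xi> j \<omega>))\<^sup>2) / (real N)\<^sup>2"
      unfolding B_def by (rule integral_Markov_inequality_measure[where A="{}"])
        (use integrable_sample[OF it2, of j] N that in auto)
    then show ?thesis using expectation_sample[of "\<lambda>z. (t z)\<^sup>2" j] that by (simp add: q_def)
  qed
  have "prob (\<Union>j\<in>{1..N}. B j) \<le> (\<Sum>j\<in>{1..N}. prob (B j))"
    by (rule finite_measure_subadditive_finite) (use Bs in auto)
  also have "\<dots> \<le> (\<Sum>j\<in>{1..N}. q / (real N)\<^sup>2)" by (rule sum_mono) (use pB in auto)
  also have "\<dots> = q / real N" using N by (simp add: power2_eq_square)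
  finally have p2: "prob (\<Union>j\<in>{1..N}. B j) \<le> q / real N" .
  have A1s: "A1 \<in> events"
  proof -
    have "(\<lambda>\<omega>. (\<Sum>j=1..N. g (\<xi> j \<omega>))\<^sup>2) \<in> borel_measurable P" using mom(1) by auto
    then show ?thesis unfolding A1_def by measurable
  qed
  have sub: "{\<omega> \<in> space P. (\<Sum>j=1..N. h (\<xi> j \<omega>)) \<ge> real N * (m + 1)} \<subseteq> A1 \<union> (\<Union>j\<in>{1..N}. B j)"
  proof
    fix \<omega> assume \<omega>: "\<omega> \<in> {\<omega> \<in> space P. (\<Sum>j=1..N. h (\<xi> j \<omega>)) \<ge> real N * (m + 1)}"
    show "\<omega> \<in> A1 \<union> (\<Union>j\<in>{1..N}. B j)"
    proof (rule ccontr)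
      assume no: "\<omega> \<notin> A1 \<union> (\<Union>j\<in>{1..N}. B j)"
      have "t (\<xi> j \<omega>) = h (\<xi> j \<omega>)" if j: "j \<in> {1..N}" for j
      proof -
        have "(t (\<xi> j \<omega>))\<^sup>2 < (real N)\<^sup>2" using no j \<omega> by (auto simp: B_def not_le)
        then have "t (\<xi> j \<omega>) < real N" by (rule power2_less_imp_less) simp
        then show ?thesis by (auto simp: t_def min_def split: if_splits)
      qed
      then have "(\<Sum>j=1..N. g (\<xi> j \<omega>)) = (\<Sum>j=1..N. h (\<xi> j \<omega>)) - real N * mt"
        by (simp add: g_def sum_subtractf)
      also have "\<dots> \<ge> real N * (m + 1) - real N * m" 
        using \<omega> mult_left_mono[OF mt, of "real N"] by auto
      finally have "real N \<le> (\<Sum>j=1..N. g (\<xi> j \<omega>))" by (simp add: algebra_simps)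
      then have "(real N)\<^sup>2 \<le> (\<Sum>j=1..N. g (\<xi> j \<omega>))\<^sup>2" by (rule power_mono) simp
      then show False using no \<omega> by (auto simp: A1_def)
    qed
  qed
  have "prob {\<omega> \<in> space P. (\<Sum>j=1..N. h (\<xi> j \<omega>)) \<ge> real N * (m + 1)} \<le> prob (A1 \<union> (\<Union>j\<in>{1..N}. B j))"
    by (rule finite_measure_mono[OF sub]) (use A1s Bs in auto)
  also have "\<dots> \<le> prob A1 + prob (\<Union>j\<in>{1..N}. B j)"
    by (rule measure_subadditive) (use A1s Bs in \<open>auto simp: emeasure_eq_measure\<close>)
  also have "\<dots> \<le> 2 * q / real N" using p1 p2 by simp
  finally show ?thesis by (simp add: q_def t_def)
qed

text \<open>A weak form of the strong law of large numbers: averages of an integrable nonnegative function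
  of the samples stay bounded almost surely. By monotonicity of the partial sums it suffices to
  control the sample sizes \<open>2^k\<close>; there the probabilities of a large average are summable by
  \<open>dyadic_truncation_sum\<close>, so the Borel--Cantelli lemma applies.\<close>

lemma (in iid_sampling) bounded_averages:
  assumes h: "integrable \<mu> h" "\<And>z. z \<in> space \<mu> \<Longrightarrow> (0::real) \<le> h z"
  shows "AE \<omega> in P. \<exists>M. \<forall>N. (\<Sum>j=1..N. h (\<xi> j \<omega>)) \<le> M * real N"
proof -
  interpret law: prob_space \<mu> by (rule prob_space_law)
  define m where "m = integral\<^sup>L \<mu> h"
  have m0: "0 \<le> m" unfolding m_def by (rule Bochner_Integration.integral_nonneg) (use h in auto)
  have [measurable]: "h \<in> borel_measurable \<mu>" using h by auto
  define A where "A k = {\<omega> \<in> space P. (\<Sum>j=1..2^k. h (\<xi> j \<omega>)) \<ge> real (2^k) * (m + 1)}" for k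
  define t where "t k z = (min (h z) (2^k))\<^sup>2 / 2^k" for k z
  have [measurable]: "t k \<in> borel_measurable \<mu>" for k unfolding t_def by measurable
  have it: "integrable \<mu> (t k)" for k
    by (rule law.integrable_const_bound[where B="2^k"])
       (use h in \<open>auto intro!: AE_I2 simp: t_def power2_eq_square divide_simps intro: mult_mono\<close>)
  have pA: "prob (A k) \<le> 2 * integral\<^sup>L \<mu> (t k)" for k
    using prob_average_large[OF h, of "2^k"] unfolding A_def m_def t_def by simp
  have sum: "summable (\<lambda>k. prob (A k))"
  proof (rule summableI_nonneg_bounded)
    fix K
    have "(\<Sum>k<K. prob (A k)) \<le> (\<Sum>k<K. 2 * integral\<^sup>L \<mu> (t k))" by (rule sum_mono[OF pA])
    also have "\<dots> = 2 * integral\<^sup>L \<mu> (\<lambda>z. \<Sum>k<K. t k z)"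
      using it by (simp add: Bochner_Integration.integral_sum sum_distrib_left)
    also have "\<dots> \<le> 2 * integral\<^sup>L \<mu> (\<lambda>z. 4 * h z)"
    proof (intro mult_left_mono integral_mono)
      show "(\<Sum>k<K. t k z) \<le> 4 * h z" if "z \<in> space \<mu>" for z
        using dyadic_truncation_sum[OF h(2)[OF that]] by (simp add: t_def)
    qed (use it h in auto)
    finally show "(\<Sum>k<K. prob (A k)) \<le> 2 * integral\<^sup>L \<mu> (\<lambda>z. 4 * h z)" .
  qed auto
  have hm: "(\<lambda>\<omega>. \<Sum>j=1..N. h (\<xi> j \<omega>)) \<in> borel_measurable P" for N
    using sample_measurable by (intro borel_measurable_sum) auto
  have As: "A k \<in> events" for k
    unfolding A_def using hm[of "2^k"] by measurable
  have "AE \<omega> in P. \<forall>\<^sub>F k in sequentially. \<omega> \<in> space P - A k"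
    by (rule borel_cantelli_AE1[OF As _ sum]) (auto simp: emeasure_eq_measure)
  with AE_space show ?thesis
  proof eventually_elim
    case (elim \<omega>)
    then obtain k0 where k0: "\<And>k. k \<ge> k0 \<Longrightarrow> \<omega> \<notin> A k" by (auto simp: eventually_sequentially)
    define S where "S N = (\<Sum>j=1..N. h (\<xi> j \<omega>))" for N
    have h0: "0 \<le> h (\<xi> j \<omega>)" if "j \<ge> 1" for j using h(2) sample_in_space elim that by auto
    have Smono: "S N \<le> S N'" if "N \<le> N'" for N N'
      unfolding S_def by (rule sum_mono2) (use that h0 in auto)
    have S2: "S (2^k) \<le> 2^k * (m + 1)" if "k \<ge> k0" for k
      using k0[OF that] elim by (auto simp: A_def S_def)
    define M where "M = max (2 * (m + 1)) (S (2^k0))"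
    have "S N \<le> M * real N" for N
    proof (cases "N \<le> 2^k0")
      case True
      show ?thesis
      proof (cases "N = 0")
        case False
        have "S N \<le> S (2^k0)" using Smono True by auto
        also have "\<dots> \<le> M" by (simp add: M_def)
        also have "\<dots> \<le> M * real N" using False m0 mult_left_mono[of 1 "real N" M] by (simp add: M_def)
        finally show ?thesis .
      qed (simp add: S_def)
    next
      case False
      define k where "k = (LEAST k. N \<le> 2^k)"
      have kN: "N \<le> 2^k" unfolding k_def by (rule LeastI[of _ N]) (simp add: less_imp_le)
      have kk: "k > k0" 
      proof (rule ccontr)
        assume "\<not> k0 < k"
        then have "(2::nat)^k \<le> 2^k0" by (intro power_increasing) auto
        with kN False show False by linarith
      qed
      have "\<not> N \<le> 2^(k-1)" using not_less_Least[of "k-1" "\<lambda>k. N \<le> 2^k"] kk by (simp add: k_def)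
      then have "2 ^ k \<le> 2 * N" using kk by (cases k) auto
      then have "real (2 ^ k) \<le> real (2 * N)" by (simp only: of_nat_le_iff)
      then have kr: "2 ^ k \<le> 2 * real N" by simp
      have "S N \<le> S (2^k)" using Smono kN by auto
      also have "\<dots> \<le> 2^k * (m + 1)" using S2 kk by auto
      also have "\<dots> \<le> 2 * real N * (m + 1)" using kr m0 by (intro mult_right_mono) auto
      also have "\<dots> = real N * (2 * (m + 1))" by simp
      also have "\<dots> \<le> real N * M" by (intro mult_left_mono) (auto simp: M_def)
      finally show ?thesis by (simp add: mult.commute)
    qed
    then show ?case unfolding S_def by blast
  qed
qed

section \<open>A uniform law of large numbers with rate\<close>

text \<open>Cells of a grid of mesh \<open>1 / (d * N)\<close> that meet \<open>K\<close> are represented by a point of \<open>K\<close> itself,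
  because the functions to be discretised are controlled only on \<open>K\<close>.\<close>

lemma polynomial_covering:
  fixes K :: "'a::euclidean_space set"
  assumes "bounded K"
  obtains A D :: nat and S :: "nat \<Rightarrow> 'a set" where
    "\<And>N. S N \<subseteq> K" "\<And>N. finite (S N)" "\<And>N. 0 < N \<Longrightarrow> card (S N) \<le> A * N ^ D"
    "\<And>N x. 0 < N \<Longrightarrow> x \<in> K \<Longrightarrow> \<exists>y\<in>S N. norm (x - y) \<le> 1 / real N"
proof -
  obtain R0 where R0: "\<And>x. x \<in> K \<Longrightarrow> norm x \<le> R0" using assms bounded_iff by blast
  define R where "R = nat \<lceil>R0\<rceil>"
  have R: "norm x \<le> real R" if "x \<in> K" for x using R0[OF that] unfolding R_def by linarith
  define d where "d = DIM('a)"
  have d: "d > 0" by (simp add: d_def)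
  define q where "q N x = (\<lambda>i\<in>Basis. \<lfloor>(x \<bullet> i) * real (d * N)\<rfloor>)" for N and x :: 'a
  define cells where "cells N = (Basis :: 'a set) \<rightarrow>\<^sub>E {- int (R * d * N) .. int (R * d * N)}" for N
  have qc: "q N ` K \<subseteq> cells N" for N
  proof -
    have "\<lfloor>(x \<bullet> i) * real (d * N)\<rfloor> \<in> {- int (R * d * N) .. int (R * d * N)}" 
      if "x \<in> K" "i \<in> Basis" for x i
    proof -
      have "\<bar>x \<bullet> i\<bar> \<le> real R" using Basis_le_norm[OF that(2), of x] R[OF that(1)] by linarith
      then have "\<bar>(x \<bullet> i) * real (d * N)\<bar> \<le> real R * real (d * N)" 
        unfolding abs_mult by (intro mult_mono) auto
      also have "\<dots> = real_of_int (int (R * d * N))" by simp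
      finally show ?thesis by (simp add: le_floor_iff floor_le_iff) linarith
    qed
    then show ?thesis by (auto simp: q_def cells_def)
  qed
  have fc: "finite (cells N)" for N unfolding cells_def by (intro finite_PiE) auto
  have cc: "card (cells N) = (2 * (R * d * N) + 1) ^ d" for N
    unfolding cells_def by (subst card_PiE) (simp_all add: d_def nat_add_distrib nat_mult_distrib mult_ac)
  define S where "S N = inv_into K (q N) ` (q N ` K)" for N
  show ?thesis
  proof (rule that[of S "(2 * (R * d) + 1) ^ d" d])
    show "S N \<subseteq> K" for N unfolding S_def by (auto intro: inv_into_into)
    have fq: "finite (q N ` K)" for N using qc fc finite_subset by blast
    show "finite (S N)" for N unfolding S_def using fq by blast
    show "card (S N) \<le> (2 * (R * d) + 1) ^ d * N ^ d" if "0 < N" for N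
    proof -
      have "card (S N) \<le> card (q N ` K)" unfolding S_def by (rule card_image_le[OF fq])
      also have "\<dots> \<le> card (cells N)" by (rule card_mono[OF fc qc])
      also have "\<dots> \<le> ((2 * (R * d) + 1) * N) ^ d" 
        unfolding cc by (rule power_mono) (use that in \<open>auto simp: algebra_simps\<close>)
      finally show ?thesis unfolding power_mult_distrib .
    qed
    show "\<exists>y\<in>S N. norm (x - y) \<le> 1 / real N" if N: "0 < N" and x: "x \<in> K" for N x
    proof (rule bexI)
      let ?y = "inv_into K (q N) (q N x)"
      show "?y \<in> S N" using x by (auto simp: S_def)
      have eq: "q N ?y = q N x" using x by (simp add: f_inv_into_f)
      have "\<bar>(x - ?y) \<bullet> i\<bar> \<le> 1 / (real d * real N)" if i: "i \<in> Basis" for i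
      proof -
        have "\<lfloor>(?y \<bullet> i) * real (d * N)\<rfloor> = \<lfloor>(x \<bullet> i) * real (d * N)\<rfloor>"
          using fun_cong[OF eq, of i] i by (simp add: q_def)
        then have "\<bar>(x \<bullet> i) * real (d * N) - (?y \<bullet> i) * real (d * N)\<bar> \<le> 1" by linarith
        then have "\<bar>(x - ?y) \<bullet> i\<bar> * real (d * N) \<le> 1"
          by (simp add: inner_diff_left abs_mult flip: left_diff_distrib)
        then show ?thesis using d N by (simp add: field_simps)
      qed
      then have "norm (x - ?y) \<le> (\<Sum>i\<in>(Basis::'a set). 1 / (real d * real N))"
        by (intro order_trans[OF norm_le_l1 sum_mono])
      also have "\<dots> = 1 / real N" using d by (simp add: d_def)
      finally show "norm (x - ?y) \<le> 1 / real N" .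
    qed
  qed
qed

lemma exp_le_quadratic:
  fixes x :: real
  assumes "\<bar>x\<bar> \<le> 1"
  shows "exp x \<le> 1 + x + x\<^sup>2"
proof (cases "0 \<le> x")
  case True
  then show ?thesis using exp_bound[of x] assms by simp
next
  case False
  define y where "y = - x"
  have y: "0 < y" "y \<le> 1" using False assms by (auto simp: y_def)
  have "1 + y + y\<^sup>2 / 2 \<le> exp y" using exp_lower_Taylor_quadratic[of y] y by simp
  moreover have "1 \<le> (1 - y + y\<^sup>2) * (1 + y + y\<^sup>2 / 2)"
  proof -
    have "(1 - y + y\<^sup>2) * (1 + y + y\<^sup>2 / 2) = 1 + y\<^sup>2 / 2 + y * y\<^sup>2 / 2 + (y\<^sup>2)\<^sup>2 / 2"
      by (simp add: field_simps power2_eq_square)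
    then show ?thesis using y by simp
  qed
  moreover have "0 \<le> 1 - y + y\<^sup>2" using y by simp
  ultimately have "1 \<le> (1 - y + y\<^sup>2) * exp y" using mult_left_mono order_trans by blast
  then have "exp (-y) \<le> 1 - y + y\<^sup>2" by (simp add: exp_minus field_simps)
  then show ?thesis by (simp add: y_def)
qed

context iid_sampling
begin

text \<open>Chernoff's method with parameter \<open>1 / s\<close>, the largest value for which the exponent stays in the range
  of \<open>exp_le_quadratic\<close> after truncation at \<open>s\<close>. Truncation moves the mean by at most the second
  moment over \<open>s\<close>, which costs no more than the variance term; this explains the factor 2.\<close>

lemma truncated_sum_upper_tail:
  fixes g h :: "'xi \<Rightarrow> real"
  assumes [measurable]: "g \<in> borel_measurable \<mu>" "h \<in> borel_measurable \<mu>"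
    and h2: "integrable \<mu> (\<lambda>z. (h z)\<^sup>2)"
    and gh: "\<And>z. z \<in> space \<mu> \<Longrightarrow> \<bar>g z\<bar> \<le> h z" and s: "0 < s"
  shows "prob {\<omega> \<in> space P. (\<Sum>j=1..N. if h (\<xi> j \<omega>) \<le> s then g (\<xi> j \<omega>) else 0)
            - real N * integral\<^sup>L \<mu> g \<ge> t}
    \<le> exp (2 * real N * (\<integral>z. (h z)\<^sup>2 \<partial>\<mu>) / s\<^sup>2 - t / s)"
proof -
  interpret law: prob_space \<mu> by (rule prob_space_law)
  define q where "q = (\<integral>z. (h z)\<^sup>2 \<partial>\<mu>)"
  define m where "m = integral\<^sup>L \<mu> g"
  define gt where "gt z = (if h z \<le> s then g z else 0)" for z
  have [measurable]: "gt \<in> borel_measurable \<mu>" unfolding gt_def by measurable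
  have gtb: "\<bar>gt z\<bar> \<le> s" "\<bar>gt z\<bar> \<le> h z" "gt z \<le> g z + (h z)\<^sup>2 / s" if "z \<in> space \<mu>" for z
  proof -
    show "\<bar>gt z\<bar> \<le> s" "\<bar>gt z\<bar> \<le> h z" using gh[OF that] s by (auto simp: gt_def)
    show "gt z \<le> g z + (h z)\<^sup>2 / s"
    proof (cases "h z \<le> s")
      case False
      then have "h z * 1 \<le> h z * (h z / s)" using gh[OF that] s by (intro mult_left_mono) auto
      then show ?thesis using gh[OF that] False by (simp add: gt_def power2_eq_square)
    qed (use s in \<open>simp add: gt_def\<close>)
  qed
  have ih: "integrable \<mu> h" by (rule integrable_of_square) (use h2 in auto)
  have ig: "integrable \<mu> g" by (rule Bochner_Integration.integrable_bound[OF ih]) (use gh in \<open>auto intro!: AE_I2 order_trans[OF gh]\<close>)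
  have igt: "integrable \<mu> gt" by (rule Bochner_Integration.integrable_bound[OF ih]) (use gtb(2) in \<open>auto intro!: AE_I2 order_trans[OF gtb(2)]\<close>)
  define e where "e z = exp (gt z / s)" for z
  have [measurable]: "e \<in> borel_measurable \<mu>" unfolding e_def by measurable
  have eb: "0 < e z" "e z \<le> 1 + (g z + (h z)\<^sup>2 / s) / s + (h z)\<^sup>2 / s\<^sup>2" "e z \<le> exp 1" if "z \<in> space \<mu>" for z
  proof -
    have a: "\<bar>gt z / s\<bar> \<le> 1" using gtb(1)[OF that] s by simp
    have "e z \<le> 1 + gt z / s + (gt z / s)\<^sup>2" unfolding e_def by (rule exp_le_quadratic[OF a])
    moreover have "gt z / s \<le> (g z + (h z)\<^sup>2 / s) / s" using gtb(3)[OF that] s by (intro divide_right_mono) auto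
    moreover have "(gt z / s)\<^sup>2 \<le> (h z)\<^sup>2 / s\<^sup>2" unfolding power_divide
      using gtb(2)[OF that] by (intro divide_right_mono) (auto simp: abs_le_square_iff[symmetric])
    ultimately show "e z \<le> 1 + (g z + (h z)\<^sup>2 / s) / s + (h z)\<^sup>2 / s\<^sup>2" by linarith
    show "0 < e z" "e z \<le> exp 1" using abs_le_D1[OF a] by (auto simp: e_def)
  qed
  have ie: "integrable \<mu> e" by (rule law.integrable_const_bound[where B="exp 1"])
      (use eb in \<open>auto intro!: AE_I2 simp: less_imp_le\<close>)
  have "integral\<^sup>L \<mu> e \<le> (\<integral>z. 1 + (g z + (h z)\<^sup>2 / s) / s + (h z)\<^sup>2 / s\<^sup>2 \<partial>\<mu>)"
    by (rule integral_mono[OF ie]) (use ig h2 eb in auto)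
  also have "\<dots> = 1 + (m + q / s) / s + q / s\<^sup>2"
    using ig h2 by (simp add: law.prob_space m_def q_def)
  also have "\<dots> = 1 + (m / s + 2 * q / s\<^sup>2)" using s by (simp add: field_simps power2_eq_square)
  also have "\<dots> \<le> exp (m / s + 2 * q / s\<^sup>2)" by (rule exp_ge_add_one_self)
  finally have Ee: "integral\<^sup>L \<mu> e \<le> exp (m / s + 2 * q / s\<^sup>2)" .
  have Ee0: "0 \<le> integral\<^sup>L \<mu> e" using eb by (intro Bochner_Integration.integral_nonneg) (auto simp: less_imp_le)
  have ind: "indep_vars (\<lambda>_. borel) (\<lambda>i \<omega>. e (\<xi> i \<omega>)) {1..N}" by (rule indep_samples) auto
  have int: "integrable P (\<lambda>\<omega>. e (\<xi> i \<omega>))" if "i \<in> {1..N}" for i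
    using integrable_sample[OF ie] that by auto
  define T where "T \<omega> = (\<Sum>j=1..N. gt (\<xi> j \<omega>))" for \<omega>
  have expT: "exp (T \<omega> / s) = (\<Prod>j=1..N. e (\<xi> j \<omega>))" for \<omega>
    by (simp add: T_def e_def sum_divide_distrib exp_sum)
  have "expectation (\<lambda>\<omega>. exp (T \<omega> / s)) = (\<Prod>j=1..N. expectation (\<lambda>\<omega>. e (\<xi> j \<omega>)))"
    unfolding expT by (rule indep_vars_lebesgue_integral[OF _ ind int]) auto
  also have "\<dots> = (integral\<^sup>L \<mu> e) ^ N"
    using expectation_sample[of e] by simp
  also have "\<dots> \<le> exp (m / s + 2 * q / s\<^sup>2) ^ N" by (rule power_mono[OF Ee Ee0])
  also have "\<dots> = exp (real N * (m / s + 2 * q / s\<^sup>2))" by (simp add: exp_of_nat_mult)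
  finally have EX: "expectation (\<lambda>\<omega>. exp (T \<omega> / s)) \<le> exp (real N * (m / s + 2 * q / s\<^sup>2))" .
  have "prob {\<omega> \<in> space P. T \<omega> - real N * m \<ge> t} = prob {\<omega> \<in> space P. exp (T \<omega> / s) \<ge> exp ((t + real N * m) / s)}"
    using s by (intro arg_cong[where f=prob]) (auto simp: divide_le_cancel algebra_simps)
  also have "\<dots> \<le> expectation (\<lambda>\<omega>. exp (T \<omega> / s)) / exp ((t + real N * m) / s)"
    by (rule integral_Markov_inequality_measure[where A="{}"])
       (use indep_vars_integrable[OF _ ind int] in \<open>auto simp: expT e_def intro!: AE_I2 prod_nonneg\<close>)
  also have "\<dots> \<le> exp (real N * (m / s + 2 * q / s\<^sup>2)) / exp ((t + real N * m) / s)"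
    using EX by (intro divide_right_mono) auto
  also have "\<dots> = exp (2 * real N * q / s\<^sup>2 - t / s)"
    unfolding exp_diff[symmetric] by (rule arg_cong[where f=exp]) (simp add: algebra_simps add_divide_distrib)
  finally show ?thesis by (simp add: T_def gt_def m_def q_def)
qed

lemma truncated_sum_tail:
  fixes g h :: "'xi \<Rightarrow> real"
  assumes [measurable]: "g \<in> borel_measurable \<mu>" "h \<in> borel_measurable \<mu>"
    and h2: "integrable \<mu> (\<lambda>z. (h z)\<^sup>2)"
    and gh: "\<And>z. z \<in> space \<mu> \<Longrightarrow> \<bar>g z\<bar> \<le> h z" and s: "0 < s"
  shows "{\<omega> \<in> space P. \<bar>(\<Sum>j=1..N. if h (\<xi> j \<omega>) \<le> s then g (\<xi> j \<omega>) else 0)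
            - real N * integral\<^sup>L \<mu> g\<bar> \<ge> t} \<in> events" (is "?A \<in> _")
    and "prob {\<omega> \<in> space P. \<bar>(\<Sum>j=1..N. if h (\<xi> j \<omega>) \<le> s then g (\<xi> j \<omega>) else 0)
            - real N * integral\<^sup>L \<mu> g\<bar> \<ge> t}
    \<le> 2 * exp (2 * real N * (\<integral>z. (h z)\<^sup>2 \<partial>\<mu>) / s\<^sup>2 - t / s)"
proof -
  let ?T = "\<lambda>g \<omega>. (\<Sum>j=1..N. if h (\<xi> j \<omega>) \<le> s then g (\<xi> j \<omega>) else 0) - real N * integral\<^sup>L \<mu> g"
  let ?B = "\<lambda>g. {\<omega> \<in> space P. ?T g \<omega> \<ge> t}"
  have meas: "?T g' \<in> borel_measurable P" if [measurable]: "g' \<in> borel_measurable \<mu>" for g'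
  proof -
    have "(\<lambda>\<omega>. if h (\<xi> j \<omega>) \<le> s then g' (\<xi> j \<omega>) else 0) \<in> borel_measurable P" if "j \<in> {1..N}" for j
    proof -
      have [measurable]: "\<xi> j \<in> measurable P \<mu>" using that by auto
      show ?thesis by measurable
    qed
    then show ?thesis by (intro borel_measurable_diff borel_measurable_sum) auto
  qed
  have neg: "?T (\<lambda>z. - g z) \<omega> = - ?T g \<omega>" for \<omega>
  proof -
    have "(\<Sum>j=1..N. if h (\<xi> j \<omega>) \<le> s then - g (\<xi> j \<omega>) else 0) 
        = - (\<Sum>j=1..N. if h (\<xi> j \<omega>) \<le> s then g (\<xi> j \<omega>) else 0)"
      unfolding sum_negf[symmetric] by (intro sum.cong) auto
    then show ?thesis by simp
  qed
  show "?A \<in> events" using meas[of g] by measurable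
  have sub: "?A \<subseteq> ?B g \<union> ?B (\<lambda>z. - g z)" unfolding neg by auto
  have Bm: "?B g \<in> events" "?B (\<lambda>z. - g z) \<in> events"
    using meas[of g] meas[of "\<lambda>z. - g z"] by measurable
  have "prob ?A \<le> prob (?B g \<union> ?B (\<lambda>z. - g z))"
    by (rule finite_measure_mono[OF sub]) (use Bm in auto)
  also have "\<dots> \<le> prob (?B g) + prob (?B (\<lambda>z. - g z))"
    by (rule measure_subadditive) (use Bm in \<open>auto simp: emeasure_eq_measure\<close>)
  also have "\<dots> \<le> 2 * exp (2 * real N * (\<integral>z. (h z)\<^sup>2 \<partial>\<mu>) / s\<^sup>2 - t / s)"
    using truncated_sum_upper_tail[where g = g and h = h and s = s and N = N and t = t, OF _ _ h2 gh s]
      truncated_sum_upper_tail[where g = "\<lambda>z. - g z" and h = h and s = s and N = N and t = t, OF _ _ h2 _ s] gh by simp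
  finally show "prob ?A \<le> 2 * exp (2 * real N * (\<integral>z. (h z)\<^sup>2 \<partial>\<mu>) / s\<^sup>2 - t / s)" .
qed

text \<open>The uniform law of large numbers with rate \<open>ln N / sqrt N\<close>, under second moments only. With the truncation
  level \<open>s = M * sqrt N\<close> the tail bound at deviation \<open>c * s * ln N\<close> is a constant times \<open>1 / N^c\<close>: the spare
  logarithm buys any polynomial decay, which pays both for a union bound over a grid of
  polynomial size and for Borel--Cantelli in \<open>N\<close>. Between grid points the mesh \<open>1 / N\<close> and the Lipschitz
  modulus \<open>h\<close> give an error of order \<open>1 / N\<close>. Finally \<open>bounded_averages\<close> applied to the square of \<open>h\<close> shows that
  almost surely there is one \<open>M\<close> for which no truncation takes place at any \<open>N\<close>.\<close>

lemma uniform_rate: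
  fixes f :: "'xi \<Rightarrow> 'a::euclidean_space \<Rightarrow> real"
  assumes K: "bounded K"
    and hm [measurable]: "h \<in> borel_measurable \<mu>" and h2: "integrable \<mu> (\<lambda>z. (h z)\<^sup>2)"
    and fm [measurable]: "\<And>y. y \<in> K \<Longrightarrow> (\<lambda>z. f z y) \<in> borel_measurable \<mu>"
    and fb: "\<And>z y. z \<in> space \<mu> \<Longrightarrow> y \<in> K \<Longrightarrow> \<bar>f z y\<bar> \<le> h z"
    and fl: "\<And>z y y'. z \<in> space \<mu> \<Longrightarrow> y \<in> K \<Longrightarrow> y' \<in> K \<Longrightarrow> \<bar>f z y - f z y'\<bar> \<le> h z * norm (y - y')"
  shows "AE \<omega> in P. \<exists>C. \<forall>y\<in>K. \<forall>N\<ge>2.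
    \<bar>(\<Sum>j=1..N. f (\<xi> j \<omega>) y) / real N - (\<integral>z. f z y \<partial>\<mu>)\<bar> \<le> C * (ln (real N) / sqrt (real N))"
proof (cases "K = {}")
  case False
  interpret law: prob_space \<mu> by (rule prob_space_law)
  obtain A D S where S: "\<And>N. S N \<subseteq> K" "\<And>N. finite (S N)" "\<And>N. 0 < N \<Longrightarrow> card (S N) \<le> A * N ^ D"
    "\<And>N y. 0 < N \<Longrightarrow> y \<in> K \<Longrightarrow> \<exists>y'\<in>S N. norm (y - y') \<le> 1 / real N"
    by (rule polynomial_covering[OF K]) blast
  have h0: "0 \<le> h z" if "z \<in> space \<mu>" for z using fb[OF that] False by fastforce
  have ih: "integrable \<mu> h" by (rule integrable_of_square) (use h2 in auto)
  have if': "integrable \<mu> (\<lambda>z. f z y)" if "y \<in> K" for y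
    by (rule Bochner_Integration.integrable_bound[OF ih])
       (use fb that fm in \<open>auto intro!: AE_I2 order_trans[OF fb]\<close>)
  define q where "q = (\<integral>z. (h z)\<^sup>2 \<partial>\<mu>)"
  have q0: "0 \<le> q" unfolding q_def by (rule Bochner_Integration.integral_nonneg) auto
  define c where "c = real (D + 2)"
  define T where "T s N y \<omega> = (\<Sum>j=1..N. if h (\<xi> j \<omega>) \<le> s then f (\<xi> j \<omega>) y else 0) 
    - real N * (\<integral>z. f z y \<partial>\<mu>)" for s N y \<omega>
  define s where "s M N = real (Suc M) * sqrt (real N)" for M N
  define Bx where "Bx M N y = {\<omega> \<in> space P. \<bar>T (s M N) N y \<omega>\<bar> \<ge> c * s M N * ln (real N)}" for M N y
  define B where "B M N = (\<Union>y\<in>S N. Bx M N y)" for M N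
  have pBx: "prob (Bx M N y) \<le> 2 * exp (2 * q) / real N ^ (D + 2)" "Bx M N y \<in> events"
    if "0 < N" "y \<in> K" for M N y
  proof -
    have spos: "0 < s M N" using that by (simp add: s_def)
    show "Bx M N y \<in> events" unfolding Bx_def T_def
      by (rule truncated_sum_tail(1)[OF _ _ h2 _ spos]) (use that fb in auto)
    have "prob (Bx M N y) \<le> 2 * exp (2 * real N * q / (s M N)\<^sup>2 - c * s M N * ln (real N) / s M N)"
      unfolding Bx_def T_def q_def
      by (rule truncated_sum_tail(2)[OF _ _ h2 _ spos]) (use that fb in auto)
    also have "\<dots> \<le> 2 * exp (2 * q - c * ln (real N))"
    proof -
      have "2 * real N * q / (s M N)\<^sup>2 = 2 * q * (1 / (real (Suc M))\<^sup>2)"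
        using that by (simp add: s_def power_mult_distrib)
      also have "\<dots> \<le> 2 * q * 1" using q0 by (intro mult_left_mono) (auto simp: divide_le_eq)
      finally show ?thesis using spos by simp
    qed
    also have "\<dots> = 2 * exp (2 * q) / real N ^ (D + 2)"
      unfolding exp_diff c_def using that by (subst exp_of_nat_mult) simp
    finally show "prob (Bx M N y) \<le> 2 * exp (2 * q) / real N ^ (D + 2)" .
  qed
  have Be: "B M N \<in> events" if "0 < N" for M N
    unfolding B_def using S(1)[of N] S(2)[of N] pBx(2)[OF that] by (intro sets.finite_UN) auto
  have pB: "prob (B M N) \<le> 2 * exp (2 * q) * real A * (1 / (real N)\<^sup>2)" if N: "0 < N" for M N
  proof -
    have "prob (B M N) \<le> (\<Sum>y\<in>S N. prob (Bx M N y))"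
      unfolding B_def by (rule finite_measure_subadditive_finite) (use S(1)[of N] S(2)[of N] pBx(2)[OF that] in auto)
    also have "\<dots> \<le> (\<Sum>y\<in>S N. 2 * exp (2 * q) / real N ^ (D + 2))"
      by (rule sum_mono) (use pBx(1)[OF that] S(1) in auto)
    also have "\<dots> = real (card (S N)) * (2 * exp (2 * q) / real N ^ (D + 2))" by simp
    also have "\<dots> \<le> real (A * N ^ D) * (2 * exp (2 * q) / real N ^ (D + 2))"
      using S(3)[OF N] by (intro mult_right_mono) (auto simp del: of_nat_mult of_nat_power)
    also have "\<dots> = 2 * exp (2 * q) * real A * (1 / (real N)\<^sup>2)"
      using N by (simp add: power_add power2_eq_square)
    finally show ?thesis .
  qed
  \<comment> \<open>The truncation constant needed depends on the outcome, so all natural values are treated at once.\<close>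
  have "AE \<omega> in P. \<forall>\<^sub>F N in sequentially. \<omega> \<in> space P - B M (Suc N)" for M
  proof (rule borel_cantelli_AE1)
    show "summable (\<lambda>N. prob (B M (Suc N)))"
    proof (rule summable_comparison_test')
      show "summable (\<lambda>N. 2 * exp (2 * q) * real A * (1 / (real (Suc N))\<^sup>2))"
        using inverse_power_summable[of 2, where 'a=real]
        by (intro summable_mult) (subst summable_Suc_iff, simp add: inverse_eq_divide)
      show "norm (prob (B M (Suc N))) \<le> 2 * exp (2 * q) * real A * (1 / (real (Suc N))\<^sup>2)" for N
        using pB[of "Suc N" M] by simp
    qed
  qed (use Be in \<open>auto simp: emeasure_eq_measure\<close>)
  then have "AE \<omega> in P. \<forall>M. \<forall>\<^sub>F N in sequentially. \<omega> \<in> space P - B M (Suc N)"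
    by (simp add: AE_all_countable)
  moreover have "AE \<omega> in P. \<exists>M. \<forall>N. (\<Sum>j=1..N. h (\<xi> j \<omega>)) \<le> M * real N"
    by (rule bounded_averages[OF ih h0])
  moreover have "AE \<omega> in P. \<exists>M. \<forall>N. (\<Sum>j=1..N. (h (\<xi> j \<omega>))\<^sup>2) \<le> M * real N"
    by (rule bounded_averages[OF h2]) auto
  ultimately show ?thesis using AE_space
  proof eventually_elim
    case (elim \<omega>)
    obtain M1 where M1: "\<And>N. (\<Sum>j=1..N. h (\<xi> j \<omega>)) \<le> M1 * real N" using elim by blast
    obtain M2 where M2: "\<And>N. (\<Sum>j=1..N. (h (\<xi> j \<omega>))\<^sup>2) \<le> M2 * real N" using elim by blast
    define M where "M = nat \<lceil>M2\<rceil>"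
    obtain N0 where N0: "\<And>N. N \<ge> N0 \<Longrightarrow> \<omega> \<notin> B M (Suc N)" using elim(1) by (force simp: eventually_sequentially)
    have sp: "\<xi> j \<omega> \<in> space \<mu>" if "j \<ge> 1" for j using sample_in_space elim that by auto
    \<comment> \<open>A single square is at most the whole sum of squares, hence at most \<open>M2 * N\<close>.\<close>
    have hs: "h (\<xi> j \<omega>) \<le> s M N" if "j \<in> {1..N}" for j N
    proof (rule power2_le_imp_le)
      have "(h (\<xi> j \<omega>))\<^sup>2 \<le> (\<Sum>j=1..N. (h (\<xi> j \<omega>))\<^sup>2)" by (rule member_le_sum) (use that in auto)
      also have "\<dots> \<le> M2 * real N" by (rule M2)
      also have "\<dots> \<le> (real (Suc M))\<^sup>2 * real N"
      proof (rule mult_right_mono)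
        have "M2 \<le> real (Suc M)" unfolding M_def by linarith
        also have "\<dots> \<le> (real (Suc M))\<^sup>2" by (rule self_le_power) auto
        finally show "M2 \<le> (real (Suc M))\<^sup>2" .
      qed simp
      also have "\<dots> = (s M N)\<^sup>2" by (simp add: s_def power_mult_distrib)
      finally show "(h (\<xi> j \<omega>))\<^sup>2 \<le> (s M N)\<^sup>2" .
      show "0 \<le> s M N" by (simp add: s_def)
    qed
    have Teq: "T (s M N) N y \<omega> = (\<Sum>j=1..N. f (\<xi> j \<omega>) y) - real N * (\<integral>z. f z y \<partial>\<mu>)" for N y
      unfolding T_def using hs by (intro arg_cong2[where f="(-)"] sum.cong) auto
    define e where "e = integral\<^sup>L \<mu> h"
    have e0: "0 \<le> e" unfolding e_def by (rule Bochner_Integration.integral_nonneg) (use h0 in auto)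
    have M10: "0 \<le> M1" using M1[of 1] h0[OF sp[of 1]] by simp
    define dev where "dev N y = (\<Sum>j=1..N. f (\<xi> j \<omega>) y) / real N - (\<integral>z. f z y \<partial>\<mu>)" for N y
    have dev_bound: "\<bar>dev N y\<bar> \<le> M1 + e" if N: "0 < N" and y: "y \<in> K" for N y
    proof -
      have "\<bar>\<Sum>j=1..N. f (\<xi> j \<omega>) y\<bar> \<le> (\<Sum>j=1..N. h (\<xi> j \<omega>))"
        by (rule order_trans[OF sum_abs sum_mono]) (use fb sp y in auto)
      then have "\<bar>(\<Sum>j=1..N. f (\<xi> j \<omega>) y) / real N\<bar> \<le> M1" 
        using M1[of N] N by (simp add: divide_le_eq)
      moreover have "\<bar>\<integral>z. f z y \<partial>\<mu>\<bar> \<le> e" unfolding e_def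
        by (rule order_trans[OF integral_abs_bound integral_mono]) (use if' ih fb y in auto)
      ultimately show ?thesis unfolding dev_def by linarith
    qed
    have dev_lip: "\<bar>dev N y - dev N y'\<bar> \<le> (M1 + e) * norm (y - y')" if N: "0 < N" and y: "y \<in> K" "y' \<in> K" for N y y'
    proof -
      have "\<bar>(\<Sum>j=1..N. f (\<xi> j \<omega>) y) - (\<Sum>j=1..N. f (\<xi> j \<omega>) y')\<bar> \<le> (\<Sum>j=1..N. h (\<xi> j \<omega>) * norm (y - y'))"
        unfolding sum_subtractf[symmetric]
        by (rule order_trans[OF sum_abs sum_mono]) (use fl sp y in auto)
      also have "\<dots> \<le> M1 * real N * norm (y - y')"
        unfolding sum_distrib_right[symmetric] by (rule mult_right_mono[OF M1]) simp
      finally have "\<bar>(\<Sum>j=1..N. f (\<xi> j \<omega>) y) / real N - (\<Sum>j=1..N. f (\<xi> j \<omega>) y') / real N\<bar> \<le> M1 * norm (y - y')"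
        using N by (simp add: divide_le_eq mult.commute mult.left_commute flip: diff_divide_distrib)
      moreover have "\<bar>(\<integral>z. f z y \<partial>\<mu>) - (\<integral>z. f z y' \<partial>\<mu>)\<bar> \<le> e * norm (y - y')"
      proof -
        have "\<bar>\<integral>z. f z y - f z y' \<partial>\<mu>\<bar> \<le> (\<integral>z. h z * norm (y - y') \<partial>\<mu>)"
          by (rule order_trans[OF integral_abs_bound integral_mono]) (use if' ih fl y in auto)
        then show ?thesis using if' y by (simp add: e_def)
      qed
      ultimately show ?thesis unfolding dev_def distrib_right by linarith
    qed
    define r where "r N = ln (real N) / sqrt (real N)" for N
    \<comment> \<open>The first summand covers the grid points, the second the mesh error and the sample sizes up to \<open>N0\<close>.\<close>
    define C where "C = c * real (Suc M) + (M1 + e) * (real N0 + 1) / ln 2"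
    have c0: "0 \<le> c" by (simp add: c_def)
    have main: "\<bar>dev N y\<bar> \<le> C * r N" if N: "N \<ge> 2" and y: "y \<in> K" for N y
    proof (cases "N > N0")
      case True
      obtain y' where y': "y' \<in> S N" "norm (y - y') \<le> 1 / real N" using S(4)[of N y] N y by auto
      have y'K: "y' \<in> K" using S(1) y' by auto
      have "\<omega> \<notin> B M N" using N0[of "N - 1"] True by simp
      then have "\<bar>T (s M N) N y' \<omega>\<bar> < c * s M N * ln (real N)" using y' elim by (auto simp: B_def Bx_def not_le)
      then have "\<bar>dev N y' * real N\<bar> \<le> c * real (Suc M) * (sqrt (real N) * ln (real N))"
        unfolding Teq dev_def using N by (simp add: s_def algebra_simps)
      also have "sqrt (real N) * ln (real N) = r N * real N" 
        using N by (simp add: r_def field_simps flip: power2_eq_square)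
      finally have "\<bar>dev N y'\<bar> * real N \<le> c * real (Suc M) * r N * real N" by (simp add: abs_mult mult.assoc)
      then have 1: "\<bar>dev N y'\<bar> \<le> c * real (Suc M) * r N" using N by simp
      have "\<bar>dev N y - dev N y'\<bar> \<le> (M1 + e) * (1 / real N)"
        by (rule order_trans[OF dev_lip mult_left_mono]) (use N y y'K y' M10 e0 in auto)
      also have "\<dots> \<le> (M1 + e) * ((real N0 + 1) / ln 2 * r N)"
      proof (rule mult_left_mono)
        have "1 / real N \<le> 1 / sqrt (real N)" using N by (intro divide_left_mono) (auto intro!: real_le_lsqrt simp: power2_eq_square)
        also have "\<dots> \<le> r N / ln 2" unfolding r_def using N by (simp add: divide_simps)
        also have "\<dots> \<le> (real N0 + 1) * (r N / ln 2)" 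
          using N mult_right_mono[of 1 "real N0 + 1" "r N / ln 2"] by (simp add: r_def)
        finally show "1 / real N \<le> (real N0 + 1) / ln 2 * r N" by simp
      qed (use M10 e0 in auto)
      finally have "\<bar>dev N y - dev N y'\<bar> \<le> (M1 + e) * ((real N0 + 1) / ln 2 * r N)" .
      with 1 have "\<bar>dev N y\<bar> \<le> c * real (Suc M) * r N + (M1 + e) * ((real N0 + 1) / ln 2 * r N)" by linarith
      then show ?thesis by (simp add: C_def algebra_simps)
    next
      case False
      have "1 \<le> (real N0 + 1) / ln 2 * r N"
      proof -
        have "sqrt (real N) \<le> real N" using N by (auto intro!: real_le_lsqrt simp: power2_eq_square)
        then have "sqrt (real N) \<le> real N0 + 1" using False by linarith
        then have "ln 2 * sqrt (real N) \<le> ln (real N) * (real N0 + 1)" using N by (intro mult_mono) auto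
        then show ?thesis using N by (simp add: r_def field_simps)
      qed
      then have "(M1 + e) * 1 \<le> (M1 + e) * ((real N0 + 1) / ln 2 * r N)" using M10 e0 by (intro mult_left_mono) auto
      moreover have "0 \<le> c * real (Suc M) * r N" using c0 N by (simp add: r_def)
      moreover have "\<bar>dev N y\<bar> \<le> M1 + e" using dev_bound[OF _ y] N by simp
      ultimately have "\<bar>dev N y\<bar> \<le> c * real (Suc M) * r N + (M1 + e) * ((real N0 + 1) / ln 2 * r N)"
        unfolding mult_1_right by (meson add_increasing order_trans)
      then show ?thesis by (simp add: C_def algebra_simps)
    qed
    then show ?case unfolding dev_def r_def by blast
  qed
qed auto

end

section \<open>Clarke subgradients\<close>

lemma clarke_tangent_coneD:
  assumes "w \<in> clarke_tangent_cone S z" "\<And>i::nat. Z i \<in> S" "Z \<longlonglongrightarrow> z" "\<And>i. 0 < t i" "t \<longlonglongrightarrow> 0"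
  obtains W where "W \<longlonglongrightarrow> w" "\<And>i. Z i + t i *\<^sub>R W i \<in> S"
  using assms unfolding clarke_tangent_cone_def by blast

text \<open>To bound the Clarke subdifferential from above one exhibits a tangent vector of the epigraph:
  if moving from \<open>y\<close> in direction \<open>w\<close> raises \<open>f\<close> at a rate at most \<open>c y t\<close>, with limit \<open>c0\<close>, then \<open>(w, c0)\<close> is tangent
  at \<open>(x, f x)\<close>, and polarity gives the inequality.\<close>

lemma clarke_subdiff_le_upper_model:
  fixes f :: "'a::euclidean_space \<Rightarrow> real"
  assumes V: "open V" "x \<in> V" and v: "v \<in> clarke_subdiff (\<lambda>y. ereal (f y)) x"
    and model: "\<And>y t. y \<in> V \<Longrightarrow> 0 < t \<Longrightarrow> y + t *\<^sub>R w \<in> V \<Longrightarrow> f (y + t *\<^sub>R w) \<le> f y + t * c y t"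
    and lim: "\<And>Y t. Y \<longlonglongrightarrow> x \<Longrightarrow> t \<longlonglongrightarrow> 0 \<Longrightarrow> (\<lambda>i::nat. c (Y i) (t i)) \<longlonglongrightarrow> c0"
  shows "v \<bullet> w \<le> c0"
proof -
  have "(w, c0) \<in> clarke_tangent_cone (epi (\<lambda>y. ereal (f y))) (x, f x)"
    unfolding clarke_tangent_cone_def
  proof (intro CollectI allI impI, elim conjE)
    fix Z :: "nat \<Rightarrow> 'a \<times> real" and t :: "nat \<Rightarrow> real"
    assume Z: "\<forall>i. Z i \<in> epi (\<lambda>y. ereal (f y))" "Z \<longlonglongrightarrow> (x, f x)" and t: "\<forall>i. 0 < t i" "t \<longlonglongrightarrow> 0"
    define Y where "Y i = fst (Z i)" for i
    have Y: "Y \<longlonglongrightarrow> x" using tendsto_fst[OF Z(2)] by (simp add: Y_def[abs_def])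
    have "(\<lambda>i. Y i + t i *\<^sub>R w) \<longlonglongrightarrow> x + 0 *\<^sub>R w" by (intro tendsto_intros Y t)
    then have ev: "\<forall>\<^sub>F i in sequentially. Y i \<in> V \<and> Y i + t i *\<^sub>R w \<in> V"
      using topological_tendstoD[OF Y V] V by (auto intro!: eventually_conj topological_tendstoD)
    \<comment> \<open>The zero vector keeps the finitely many exceptional indices inside the epigraph.\<close>
    define W where "W i = (if Y i \<in> V \<and> Y i + t i *\<^sub>R w \<in> V then (w, c (Y i) (t i)) else 0)" for i
    have "W \<longlonglongrightarrow> (w, c0)"
    proof (rule Lim_transform_eventually)
      show "(\<lambda>i. (w, c (Y i) (t i))) \<longlonglongrightarrow> (w, c0)" by (intro tendsto_Pair tendsto_const lim Y t)
      show "\<forall>\<^sub>F i in sequentially. (w, c (Y i) (t i)) = W i"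
        using ev by eventually_elim (simp add: W_def)
    qed
    moreover have "Z i + t i *\<^sub>R W i \<in> epi (\<lambda>y. ereal (f y))" for i
    proof (cases "Y i \<in> V \<and> Y i + t i *\<^sub>R w \<in> V")
      case True
      then have "f (Y i + t i *\<^sub>R w) \<le> f (Y i) + t i * c (Y i) (t i)" using model t by auto
      moreover have "f (Y i) \<le> snd (Z i)" using Z(1) by (auto simp: epi_def Y_def case_prod_beta)
      ultimately show ?thesis using True by (auto simp: W_def epi_def Y_def case_prod_beta)
    next
      case False
      then show ?thesis using Z(1) by (auto simp: W_def)
    qed
    ultimately show "\<exists>W. W \<longlonglongrightarrow> (w, c0) \<and> (\<forall>i. Z i + t i *\<^sub>R W i \<in> epi (\<lambda>y. ereal (f y)))" by blast
  qed
  then show ?thesis using v by (auto simp: clarke_subdiff_def clarke_normal_cone_def)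
qed

lemma clarke_subdiff_lipschitz_bound:
  fixes f :: "'a::euclidean_space \<Rightarrow> real"
  assumes V: "open V" "x \<in> V" and v: "v \<in> clarke_subdiff (\<lambda>y. ereal (f y)) x"
    and lip: "\<And>y z. y \<in> V \<Longrightarrow> z \<in> V \<Longrightarrow> \<bar>f y - f z\<bar> \<le> k * norm (y - z)"
  shows "norm v \<le> \<bar>k\<bar>"
proof -
  have "v \<bullet> v \<le> k * norm v"
  proof (rule clarke_subdiff_le_upper_model[OF V v, where c = "\<lambda>_ _. k * norm v"])
    show "f (y + t *\<^sub>R v) \<le> f y + t * (k * norm v)" if "y \<in> V" "0 < t" "y + t *\<^sub>R v \<in> V" for y t
      using lip[of "y + t *\<^sub>R v" y] that by (simp add: mult_ac)
  qed auto
  also have "\<dots> \<le> \<bar>k\<bar> * norm v" by (intro mult_right_mono) auto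
  finally have "norm v * norm v \<le> \<bar>k\<bar> * norm v" by (simp add: dot_square_norm power2_eq_square)
  then show ?thesis by (cases "v = 0") auto
qed

text \<open>The model inequality and continuity of \<open>g\<close> at \<open>x\<close> give \<open>v \<bullet> w \<le> g x \<bullet> w\<close> for every direction; the direction \<open>v - g x\<close> forces
  equality.\<close>

lemma clarke_subdiff_smooth:
  fixes f :: "'a::euclidean_space \<Rightarrow> real"
  assumes V: "open V" "x \<in> V" and v: "v \<in> clarke_subdiff (\<lambda>y. ereal (f y)) x"
    and model: "\<And>y z. y \<in> V \<Longrightarrow> z \<in> V \<Longrightarrow> f z \<le> f y + g y \<bullet> (z - y) + k * (norm (z - y))\<^sup>2"
    and cont: "isCont g x"
  shows "v = g x"
proof -
  define w where "w = v - g x"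
  have "v \<bullet> w \<le> g x \<bullet> w"
  proof (rule clarke_subdiff_le_upper_model[OF V v, where c = "\<lambda>y t. g y \<bullet> w + k * t * (norm w)\<^sup>2"])
    show "f (y + t *\<^sub>R w) \<le> f y + t * (g y \<bullet> w + k * t * (norm w)\<^sup>2)"
      if "y \<in> V" "0 < t" "y + t *\<^sub>R w \<in> V" for y t
      using model[OF that(1,3)] by (simp add: algebra_simps power2_eq_square)
    show "(\<lambda>i. g (Y i) \<bullet> w + k * t i * (norm w)\<^sup>2) \<longlonglongrightarrow> g x \<bullet> w" if "Y \<longlonglongrightarrow> x" "t \<longlonglongrightarrow> 0" for Y t
    proof -
      have "(\<lambda>i. g (Y i) \<bullet> w + k * t i * (norm w)\<^sup>2) \<longlonglongrightarrow> g x \<bullet> w + k * 0 * (norm w)\<^sup>2"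
        by (intro tendsto_intros that isCont_tendsto_compose[OF cont])
      then show ?thesis by simp
    qed
  qed
  then have "w \<bullet> w \<le> 0" by (simp add: w_def inner_diff_left)
  then have "w = 0" by (simp add: dot_square_norm)
  then show ?thesis by (simp add: w_def)
qed

text \<open>This replaces a subdifferential calculus for the expectation: limits of averaged subgradients
  satisfy such an upper quadratic bound. A tangent vector \<open>(w, s)\<close> has to satisfy \<open>v \<bullet> w \<le> s\<close>; testing it along
  base points \<open>x - t w\<close>, which lie behind \<open>x\<close>, makes the step land near \<open>x\<close>, where the upper
  bound for \<open>f (x - t w)\<close> turns into the required lower bound for the increment.\<close>

lemma quadratic_supergradient_in_clarke_subdiff:
  fixes f :: "'a::euclidean_space \<Rightarrow> real"
  assumes V: "open V" "x \<in> V"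
    and lip: "\<And>y z. y \<in> V \<Longrightarrow> z \<in> V \<Longrightarrow> \<bar>f y - f z\<bar> \<le> k * norm (y - z)"
    and upper: "\<And>y. y \<in> V \<Longrightarrow> f y \<le> f x + v \<bullet> (y - x) + L * (norm (y - x))\<^sup>2"
  shows "v \<in> clarke_subdiff (\<lambda>y. ereal (f y)) x"
proof -
  have "v \<bullet> w - s \<le> 0" if T: "(w, s) \<in> clarke_tangent_cone (epi (\<lambda>y. ereal (f y))) (x, f x)" for w s
  proof -
    define t where "t i = 1 / real (Suc i)" for i
    define Y where "Y i = x - t i *\<^sub>R w" for i
    have t: "t i > 0" "t \<longlonglongrightarrow> 0" for i
      unfolding t_def using LIMSEQ_inverse_real_of_nat by (auto simp: inverse_eq_divide)
    have "Y \<longlonglongrightarrow> x - 0 *\<^sub>R w" unfolding Y_def by (intro tendsto_intros t)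
    then have Y: "Y \<longlonglongrightarrow> x" by simp
    have evY: "\<forall>\<^sub>F i in sequentially. Y i \<in> V" using topological_tendstoD[OF Y V] .
    have cont: "isCont f x"
      unfolding isCont_def LIM_eq
    proof (intro allI impI)
      fix r :: real assume r: "0 < r"
      obtain e where e: "e > 0" "ball x e \<subseteq> V" using V openE by blast
      show "\<exists>s>0. \<forall>y. y \<noteq> x \<and> norm (y - x) < s \<longrightarrow> norm (f y - f x) < r"
      proof (intro exI[of _ "min e (r / (\<bar>k\<bar> + 1))"] conjI allI impI)
        show "0 < min e (r / (\<bar>k\<bar> + 1))" using e r by simp
        fix y assume y: "y \<noteq> x \<and> norm (y - x) < min e (r / (\<bar>k\<bar> + 1))"
        then have "y \<in> V" using e by (auto simp: dist_norm norm_minus_commute)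
        then have "\<bar>f y - f x\<bar> \<le> k * norm (y - x)" using lip V by blast
        also have "\<dots> \<le> (\<bar>k\<bar> + 1) * norm (y - x)" by (intro mult_right_mono) auto
        also have "\<dots> < (\<bar>k\<bar> + 1) * (r / (\<bar>k\<bar> + 1))" using y by (intro mult_strict_left_mono) auto
        finally show "norm (f y - f x) < r" by simp
      qed
    qed
    have "(\<lambda>i. (Y i, f (Y i))) \<longlonglongrightarrow> (x, f x)"
      by (intro tendsto_Pair Y isCont_tendsto_compose[OF cont])
    moreover have "(Y i, f (Y i)) \<in> epi (\<lambda>y. ereal (f y))" for i by (simp add: epi_def)
    ultimately obtain W where W: "W \<longlonglongrightarrow> (w, s)"
        "\<And>i. (Y i, f (Y i)) + t i *\<^sub>R W i \<in> epi (\<lambda>y. ereal (f y))"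
      using clarke_tangent_coneD[OF T _ _ t, of "\<lambda>i. (Y i, f (Y i))"] by blast
    define wi si where "wi i = fst (W i)" "si i = snd (W i)" for i
    have lims: "wi \<longlonglongrightarrow> w" "si \<longlonglongrightarrow> s"
      using tendsto_fst[OF W(1)] tendsto_snd[OF W(1)] by (simp_all add: wi_si_def[abs_def])
    have le: "f (Y i + t i *\<^sub>R wi i) \<le> f (Y i) + t i * si i" for i
      using W(2)[of i] by (auto simp: epi_def wi_si_def case_prod_beta)
    have "(\<lambda>i. Y i + t i *\<^sub>R wi i) \<longlonglongrightarrow> x + 0 *\<^sub>R w" by (intro tendsto_intros Y t lims)
    then have evZ: "\<forall>\<^sub>F i in sequentially. Y i + t i *\<^sub>R wi i \<in> V"
      using V by (auto intro!: topological_tendstoD)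
    have "\<forall>\<^sub>F i in sequentially. v \<bullet> w - L * t i * (norm w)\<^sup>2 - k * norm (wi i - w) \<le> si i"
      using evY evZ
    proof eventually_elim
      case (elim i)
      have "f x - f (Y i + t i *\<^sub>R wi i) \<le> k * norm (x - (Y i + t i *\<^sub>R wi i))"
        using lip[OF V(2) elim(2)] by linarith
      also have "x - (Y i + t i *\<^sub>R wi i) = t i *\<^sub>R (w - wi i)" by (simp add: Y_def algebra_simps)
      also have "k * norm \<dots> = t i * (k * norm (wi i - w))" using t(1)[of i] by (simp add: norm_minus_commute)
      finally have 1: "f x - t i * (k * norm (wi i - w)) \<le> f (Y i) + t i * si i" using le[of i] by linarith
      have 2: "f (Y i) \<le> f x - t i * (v \<bullet> w) + t i * (L * t i * (norm w)\<^sup>2)"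
        using upper[OF elim(1)] t(1)[of i] by (simp add: Y_def power_mult_distrib power2_eq_square mult_ac)
      have "t i * (v \<bullet> w - L * t i * (norm w)\<^sup>2 - k * norm (wi i - w)) \<le> t i * si i"
        using 1 2 by (simp add: right_diff_distrib)
      then show ?case using t(1)[of i] by simp
    qed
    moreover have "(\<lambda>i. v \<bullet> w - L * t i * (norm w)\<^sup>2 - k * norm (wi i - w)) \<longlonglongrightarrow> v \<bullet> w - L * 0 * (norm w)\<^sup>2 - k * norm (w - w)"
      by (intro tendsto_intros t lims)
    ultimately have "v \<bullet> w \<le> s" using tendsto_le[OF _ lims(2)] by fastforce
    then show ?thesis by simp
  qed
  then show ?thesis by (auto simp: clarke_subdiff_def clarke_normal_cone_def)
qed

text \<open>Here the constant sequence of base points \<open>(x, f x)\<close> already excludes tangent vectors below the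
  graph of the quadratic minorant.\<close>

lemma proximal_subgradient_in_clarke_subdiff:
  fixes f :: "'a::euclidean_space \<Rightarrow> ereal"
  assumes fin: "\<bar>f x\<bar> \<noteq> \<infinity>" and V: "open V" "x \<in> V"
    and lower: "\<And>y. y \<in> V \<Longrightarrow> ereal (real_of_ereal (f x) + p \<bullet> (y - x) - L * (norm (y - x))\<^sup>2) \<le> f y"
  shows "p \<in> clarke_subdiff f x"
proof -
  define fx where "fx = real_of_ereal (f x)"
  have fx: "f x = ereal fx" using fin by (auto simp: fx_def ereal_real)
  have "p \<bullet> w - s \<le> 0" if T: "(w, s) \<in> clarke_tangent_cone (epi f) (x, fx)" for w s
  proof -
    define t where "t i = 1 / real (Suc i)" for i
    have t: "t i > 0" "t \<longlonglongrightarrow> 0" for i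
      unfolding t_def using LIMSEQ_inverse_real_of_nat by (auto simp: inverse_eq_divide)
    have "(x, fx) \<in> epi f" by (simp add: epi_def fx)
    then obtain W where W: "W \<longlonglongrightarrow> (w, s)" "\<And>i. (x, fx) + t i *\<^sub>R W i \<in> epi f"
      using clarke_tangent_coneD[OF T _ tendsto_const t] by blast
    define wi si where "wi i = fst (W i)" "si i = snd (W i)" for i
    have lims: "wi \<longlonglongrightarrow> w" "si \<longlonglongrightarrow> s"
      using tendsto_fst[OF W(1)] tendsto_snd[OF W(1)] by (simp_all add: wi_si_def[abs_def])
    have le: "f (x + t i *\<^sub>R wi i) \<le> ereal (fx + t i * si i)" for i
      using W(2)[of i] by (auto simp: epi_def wi_si_def case_prod_beta)
    have "(\<lambda>i. x + t i *\<^sub>R wi i) \<longlonglongrightarrow> x + 0 *\<^sub>R w" by (intro tendsto_intros t lims)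
    then have evZ: "\<forall>\<^sub>F i in sequentially. x + t i *\<^sub>R wi i \<in> V"
      using V by (auto intro!: topological_tendstoD)
    then have "\<forall>\<^sub>F i in sequentially. p \<bullet> wi i - L * t i * (norm (wi i))\<^sup>2 \<le> si i"
    proof eventually_elim
      case (elim i)
      have "fx + p \<bullet> (t i *\<^sub>R wi i) - L * (norm (t i *\<^sub>R wi i))\<^sup>2 \<le> fx + t i * si i"
        using order_trans[OF lower[OF elim] le[of i]] by (simp add: fx_def)
      then have "t i * (p \<bullet> wi i - L * t i * (norm (wi i))\<^sup>2) \<le> t i * si i"
        using t(1)[of i] by (simp add: right_diff_distrib power_mult_distrib power2_eq_square mult_ac)
      then show ?case using t(1)[of i] by simp
    qed
    moreover have "(\<lambda>i. p \<bullet> wi i - L * t i * (norm (wi i))\<^sup>2) \<longlonglongrightarrow> p \<bullet> w - L * 0 * (norm w)\<^sup>2"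
      by (intro tendsto_intros t lims)
    ultimately have "p \<bullet> w \<le> s" using tendsto_le[OF _ lims(2)] by fastforce
    then show ?thesis by simp
  qed
  then show ?thesis using fin by (auto simp: clarke_subdiff_def clarke_normal_cone_def fx_def)
qed

lemma quadratic_expansion:
  fixes f :: "'a::euclidean_space \<Rightarrow> real"
  assumes S: "convex S" and der: "\<And>y. y \<in> S \<Longrightarrow> GDERIV f y :> g y"
    and lip: "\<And>y z. y \<in> S \<Longrightarrow> z \<in> S \<Longrightarrow> norm (g y - g z) \<le> k * norm (y - z)" and k: "0 \<le> k"
    and yz: "y \<in> S" "z \<in> S"
  shows "\<bar>f z - f y - g y \<bullet> (z - y)\<bar> \<le> k * (norm (z - y))\<^sup>2"
proof -
  have sub: "closed_segment y z \<subseteq> S" using S yz by (rule convex_contains_segment[THEN iffD1, rule_format])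
  have "norm (f z - f y - (\<lambda>x h. h \<bullet> g x) y (z - y)) \<le> norm (z - y) * (k * norm (z - y))"
  proof (rule differentiable_bound_linearization[where S = "closed_segment y z" and f' = "\<lambda>x h. h \<bullet> g x"])
    show "y + t *\<^sub>R (z - y) \<in> closed_segment y z" if "t \<in> {0..1}" for t
      using that by (auto simp: in_segment algebra_simps intro!: exI[of _ t])
    show "(f has_derivative (\<lambda>h. h \<bullet> g x)) (at x within closed_segment y z)" if "x \<in> closed_segment y z" for x
      using der[of x] sub that by (auto simp: gderiv_def intro: has_derivative_at_withinI)
    show "onorm ((\<lambda>h. h \<bullet> g x) - (\<lambda>h. h \<bullet> g y)) \<le> k * norm (z - y)" if x: "x \<in> closed_segment y z" for x
    proof (rule onorm_le)
      fix h :: 'a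
      have "norm (x - y) \<le> norm (z - y)" using segment_bound(1)[OF x] by simp
      then have "norm (g x - g y) \<le> k * norm (z - y)"
        using lip[of x y] sub x yz k by (meson mult_left_mono order_trans subsetD)
      then have "norm h * norm (g x - g y) \<le> norm h * (k * norm (z - y))" by (intro mult_left_mono) auto
      then show "norm (((\<lambda>h::'a. h \<bullet> g x) - (\<lambda>h. h \<bullet> g y)) h) \<le> k * norm (z - y) * norm h"
        using Cauchy_Schwarz_ineq2[of h "g x - g y"] by (simp add: inner_diff_right mult.commute)
    qed
  qed auto
  then show ?thesis by (simp add: inner_commute power2_eq_square mult_ac)
qed

section \<open>From local to global statements\<close>

text \<open>The exceptional null set may depend on the neighbourhood, but by Lindelof's theorem countably many
  neighbourhoods suffice.\<close>

lemma AE_local_property: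
  fixes S :: "'a::second_countable_topology set"
  assumes "\<And>x. x \<in> S \<Longrightarrow> \<exists>U. open U \<and> x \<in> U \<and> (AE \<omega> in M. Q U \<omega>)"
  shows "AE \<omega> in M. \<forall>x\<in>S. \<exists>U. open U \<and> x \<in> U \<and> Q U \<omega>"
proof -
  define \<F> where "\<F> = {U. open U \<and> (AE \<omega> in M. Q U \<omega>)}"
  obtain \<G> where G: "\<G> \<subseteq> \<F>" "countable \<G>" "\<Union>\<G> = \<Union>\<F>"
    by (rule Lindelof[of \<F>]) (auto simp: \<F>_def)
  have "AE \<omega> in M. \<forall>U\<in>\<G>. Q U \<omega>"
    using G(1,2) by (subst AE_ball_countable) (auto simp: \<F>_def)
  then show ?thesis
  proof eventually_elim
    case (elim \<omega>)
    show ?case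
    proof
      fix x assume "x \<in> S"
      then have "x \<in> \<Union>\<G>" unfolding G(3) \<F>_def using assms by blast
      then obtain U where "U \<in> \<G>" "x \<in> U" by blast
      then show "\<exists>U. open U \<and> x \<in> U \<and> Q U \<omega>" using elim G(1) by (auto simp: \<F>_def)
    qed
  qed
qed

corollary AE_local_constant:
  fixes S :: "'a::second_countable_topology set"
  assumes "\<And>x. x \<in> S \<Longrightarrow> \<exists>U. open U \<and> x \<in> U \<and> (AE \<omega> in M. \<exists>C. Q U C \<omega>)"
  shows "AE \<omega> in M. \<forall>x\<in>S. \<exists>U C. open U \<and> x \<in> U \<and> Q U C \<omega>"
  using AE_local_property[where Q = "\<lambda>U \<omega>. \<exists>C. Q U C \<omega>", OF assms] by simp

lemma uniform_constant_on_compact: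
  fixes K :: "'a::topological_space set" and P :: "real \<Rightarrow> 'a \<Rightarrow> bool"
  assumes K: "compact K"
    and loc: "\<And>x. x \<in> K \<Longrightarrow> \<exists>U C. open U \<and> x \<in> U \<and> (\<forall>y\<in>U. P C y)"
    and mono: "\<And>C C' y. P C y \<Longrightarrow> C \<le> C' \<Longrightarrow> P C' y"
  obtains C where "\<And>y. y \<in> K \<Longrightarrow> P C y"
proof -
  obtain U C where UC: "\<And>x. x \<in> K \<Longrightarrow> open (U x) \<and> x \<in> U x \<and> (\<forall>y\<in>U x. P (C x) y)"
    using loc by metis
  obtain F where F: "F \<subseteq> K" "finite F" "K \<subseteq> (\<Union>x\<in>F. U x)"
    by (rule compactE_image[OF K, of K U]) (use UC in auto)
  show ?thesis
  proof (rule that)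
    fix y assume "y \<in> K"
    then obtain x where x: "x \<in> F" "y \<in> U x" using F by blast
    then have "P (C x) y" using UC F by blast
    then show "P (Max (C ` F)) y" by (rule mono) (use x F in auto)
  qed
qed

section \<open>Convergence from the Kurdyka--Lojasiewicz inequality\<close>

lemma desingularizing_gradient_ineq:
  assumes d: "desingularizing \<eta> \<theta>" and s: "s \<in> {0<..<\<eta>}" "s' \<in> {0..\<eta>}"
  shows "\<theta> s' - \<theta> s \<le> deriv \<theta> s * (s' - s)"
proof -
  have "convex_on {0..\<eta>} (\<lambda>t. - \<theta> t)" using d by (simp add: desingularizing_def concave_on_def)
  moreover have "s \<in> interior {0..\<eta>}" using s by simp
  moreover have "((\<lambda>t. - \<theta> t) has_real_derivative - deriv \<theta> s) (at s within {0..\<eta>})"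
  proof (rule DERIV_minus[OF has_field_derivative_at_within])
    have "\<theta> differentiable (at s)" using d s(1) by (simp add: desingularizing_def)
    then show "(\<theta> has_real_derivative deriv \<theta> s) (at s)" by (simp only: DERIV_deriv_iff_real_differentiable)
  qed
  ultimately have "- \<theta> s' - - \<theta> s \<ge> - deriv \<theta> s * (s' - s)"
    by (intro convex_on_imp_above_tangent[where A = "{0..\<eta>}"]) (use s(2) in simp_all)
  then show ?thesis by simp
qed

lemma desingularizing_inverse_deriv:
  assumes d: "desingularizing \<eta> \<theta>" and s: "s \<in> {0<..<\<eta>}"
  shows "0 < inverse (deriv \<theta> s)"
    and "s' \<in> {0<..<\<eta>} \<Longrightarrow> s \<le> s' \<Longrightarrow> inverse (deriv \<theta> s) \<le> inverse (deriv \<theta> s')"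
proof -
  have pos: "0 < deriv \<theta> t" if "t \<in> {0<..<\<eta>}" for t using d that by (auto simp: desingularizing_def)
  show "0 < inverse (deriv \<theta> s)" using pos[OF s] by simp
  assume s': "s' \<in> {0<..<\<eta>}" "s \<le> s'"
  have "0 \<le> (deriv \<theta> s - deriv \<theta> s') * (s' - s)"
    using desingularizing_gradient_ineq[OF d s, of s'] desingularizing_gradient_ineq[OF d s'(1), of s] s s'
    by (simp add: algebra_simps)
  then have "deriv \<theta> s' \<le> deriv \<theta> s" using s'(2) by (cases "s = s'") (auto simp: zero_le_mult_iff)
  then show "inverse (deriv \<theta> s) \<le> inverse (deriv \<theta> s')" using pos[OF s'(1)] by (intro le_imp_inverse_le) auto
qed

text \<open>Iterating quasi-additivity with equal arguments shows that multiplying the argument by a constant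
  costs only a constant factor in the reciprocal of the derivative.\<close>

lemma quasi_additive_power_of_two:
  assumes d: "desingularizing \<eta> \<theta>" and C: "0 < C"
    and qa: "\<And>t1 t2. t1 \<in> {0<..<\<eta>} \<Longrightarrow> t2 \<in> {0<..<\<eta>} \<Longrightarrow> t1 + t2 < \<eta> \<Longrightarrow>
        C * inverse (deriv \<theta> (t1 + t2)) \<le> inverse (deriv \<theta> t1) + inverse (deriv \<theta> t2)"
    and t: "0 < t" "2 ^ j * t < \<eta>"
  shows "inverse (deriv \<theta> (2 ^ j * t)) \<le> (2 / C) ^ j * inverse (deriv \<theta> t)"
  using t(2)
proof (induction j)
  case (Suc j)
  have eq: "2 ^ j * t + 2 ^ j * t = 2 ^ Suc j * t" by simp
  have lt: "2 ^ j * t + 2 ^ j * t < \<eta>" using Suc.prems unfolding eq .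
  have pos: "0 < 2 ^ j * t" using t by simp
  have "C * inverse (deriv \<theta> (2 ^ j * t + 2 ^ j * t)) \<le> 2 * inverse (deriv \<theta> (2 ^ j * t))"
    using qa[of "2 ^ j * t" "2 ^ j * t"] lt pos by simp
  also have "\<dots> \<le> 2 * ((2 / C) ^ j * inverse (deriv \<theta> t))" using Suc.IH lt pos by simp
  finally have "C * inverse (deriv \<theta> (2 ^ Suc j * t)) \<le> 2 * ((2 / C) ^ j * inverse (deriv \<theta> t))" unfolding eq .
  then show ?case using C by (simp add: pos_le_divide_eq mult.commute mult.left_commute)
qed simp

lemma summable_tail_tendsto_0:
  fixes a :: "nat \<Rightarrow> real"
  assumes "summable a"
  shows "(\<lambda>k. \<Sum>t. a (k + t)) \<longlonglongrightarrow> 0"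
  using suminf_exist_split2[OF assms] by (simp add: add.commute)

lemma suminf_tail_Suc:
  fixes a :: "nat \<Rightarrow> real"
  assumes "summable a"
  shows "(\<Sum>t. a (k + t)) = a k + (\<Sum>t. a (Suc k + t))"
proof -
  have "summable (\<lambda>t. a (k + t))" using summable_iff_shift[of a k] assms by (simp add: add.commute)
  from suminf_split_head[OF this] show ?thesis by simp
qed

text \<open>The abstract convergence argument for descent methods with summable errors. The value \<open>\<delta>\<close> itself
  need not decrease, but \<open>s = \<delta> + q * T\<close> does, where \<open>T\<close> is the tail sum of the errors and \<open>q \<ge> c\<close> a power of two.
  Concavity gives \<open>\<sigma> * \<Delta>\<^sup>2 \<le> (\<theta>(s k) - \<theta>(s (k + 1))) / \<theta>'(s k)\<close>, and quasi-additivity splits \<open>1 / \<theta>'(s k)\<close> into a part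
  bounded through the Kurdyka--Lojasiewicz inequality by the previous step length and a part
  \<open>1 / \<theta>'(T k)\<close> that is summable by assumption. The arithmetic-geometric mean inequality turns this into
  \<open>2 * \<Delta> (k + 1) \<le> \<Delta> k + \<close> (telescoping) \<open> + \<close> (summable). In terms of the potential \<open>\<Psi>\<close> the path length
  from \<open>k\<close> on is at most \<open>\<Psi> k\<close> as long as the iterates stay near \<open>xbar\<close>. As \<open>\<Psi>\<close> tends to 0, an iterate
  close enough to the accumulation point traps all later ones.\<close>

lemma KL_convergence:
  fixes X :: "nat \<Rightarrow> 'a::real_normed_vector" and \<delta> a :: "nat \<Rightarrow> real"
  assumes d: "desingularizing \<eta> \<theta>" and qa: "quasi_additive \<eta> \<theta>"
    and a: "\<And>k. 0 \<le> a k" "summable a"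
    and tail: "\<And>k. p \<le> k \<Longrightarrow> (\<Sum>t. a (k + t)) \<in> {0<..<\<eta>}"
    and summ: "summable (\<lambda>k. inverse (deriv \<theta> (\<Sum>t. a (p + k + t))))"
    and \<delta>: "\<And>k. p \<le> k \<Longrightarrow> 0 < \<delta> k" "\<delta> \<longlonglongrightarrow> 0"
    and desc: "\<And>k. p \<le> k \<Longrightarrow> \<delta> (Suc k) \<le> \<delta> k - \<sigma> * (norm (X (Suc k) - X k))\<^sup>2 + c * a k"
    and \<sigma>: "0 < \<sigma>" 
    and r: "0 < r" and B: "0 \<le> B"
    and rel: "\<And>k. p \<le> k \<Longrightarrow> X k \<in> ball xbar r \<Longrightarrow> X (Suc k) \<in> ball xbar r \<Longrightarrow> \<delta> (Suc k) < \<eta> \<Longrightarrow>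
        1 \<le> deriv \<theta> (\<delta> (Suc k)) * (B * (norm (X (Suc k) - X k) + a k))"
    and acc: "\<And>e m. 0 < e \<Longrightarrow> \<exists>k\<ge>m. dist (X k) xbar < e"
  shows "X \<longlonglongrightarrow> xbar"
proof -
  define inv where "inv t = inverse (deriv \<theta> t)" for t
  define T where "T k = (\<Sum>t. a (k + t))" for k
  define \<Delta> where "\<Delta> k = norm (X (Suc k) - X k)" for k
  have T: "T k \<in> {0<..<\<eta>}" if "p \<le> k" for k using tail[OF that] by (simp add: T_def)
  have T0: "T \<longlonglongrightarrow> 0" unfolding T_def[abs_def] by (rule summable_tail_tendsto_0[OF a(2)])
  have TS: "T k = a k + T (Suc k)" for k unfolding T_def by (rule suminf_tail_Suc[OF a(2)])
  have \<eta>: "0 < \<eta>" using T[of p] by auto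
  obtain C where C: "0 < C" "C \<le> 1" "\<And>t1 t2. t1 \<in> {0<..<\<eta>} \<Longrightarrow> t2 \<in> {0<..<\<eta>} \<Longrightarrow> t1 + t2 < \<eta> \<Longrightarrow>
        C * inv (t1 + t2) \<le> inv t1 + inv t2"
    using qa unfolding quasi_additive_def inv_def by blast
  obtain j :: nat where "c < 2 ^ j" using real_arch_pow[of 2 c] by auto
  define q :: real where "q = 2 ^ j"
  have q: "c \<le> q" "0 < q" using \<open>c < 2 ^ j\<close> by (auto simp: q_def)
  define s where "s k = \<delta> k + q * T k" for k
  have s0: "s \<longlonglongrightarrow> 0" using tendsto_add[OF \<delta>(2) tendsto_mult[OF tendsto_const[of q] T0]] by (simp add: s_def[abs_def])
  have spos: "0 < s k" if "p \<le> k" for k using \<delta>(1)[OF that] T[OF that] q by (simp add: s_def add_pos_pos)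
  have sdesc: "\<sigma> * (\<Delta> k)\<^sup>2 \<le> s k - s (Suc k)" if "p \<le> k" for k
    using desc[OF that] TS[of k] mult_right_mono[OF q(1) a(1)[of k]] by (simp add: s_def \<Delta>_def algebra_simps)
  have \<Delta>0: "\<Delta> \<longlonglongrightarrow> 0"
  proof -
    have "(\<lambda>k. (s k - s (Suc k)) / \<sigma>) \<longlonglongrightarrow> (0 - 0) / \<sigma>"
      by (intro tendsto_intros s0 LIMSEQ_Suc) (use \<sigma> in auto)
    then have "(\<lambda>k. (s k - s (Suc k)) / \<sigma>) \<longlonglongrightarrow> 0" by simp
    then have "(\<lambda>k. (\<Delta> k)\<^sup>2) \<longlonglongrightarrow> 0"
      by (rule tendsto_sandwich[OF _ _ tendsto_const, rotated 2])
         (use sdesc \<sigma> in \<open>auto simp: eventually_sequentially field_simps intro!: exI[of _ p]\<close>)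
    then have "(\<lambda>k. sqrt ((\<Delta> k)\<^sup>2)) \<longlonglongrightarrow> sqrt 0" by (rule tendsto_real_sqrt)
    then show ?thesis by (simp add: \<Delta>_def[abs_def])
  qed
  define K1 where "K1 = (1 / C) * (2 / C) ^ j"
  have K1: "1 / C \<le> K1" "0 < K1"
  proof -
    have "1 \<le> (2 / C) ^ j" using C by (intro one_le_power) (simp add: field_simps)
    then have "(1 / C) * 1 \<le> (1 / C) * (2 / C) ^ j" using C(1) by (intro mult_left_mono) auto
    then show "1 / C \<le> K1" by (simp add: K1_def)
    show "0 < K1" using C by (simp add: K1_def)
  qed
  \<comment> \<open>\<open>B + 1\<close> dominates both the factor \<open>B\<close> of the step length and the factor 1 of \<open>1 / \<theta>'(T)\<close>.\<close>
  define K2 where "K2 = K1 * (B + 1) / \<sigma>"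
  have K2: "0 < K2" using K1 B \<sigma> by (simp add: K2_def)
  have "\<forall>\<^sub>F k in sequentially. \<delta> k < \<eta> / 2 \<and> q * T k < \<eta> / 2"
    using order_tendstoD(2)[OF \<delta>(2), of "\<eta> / 2"] order_tendstoD(2)[OF T0, of "\<eta> / 2 / q"] \<eta> q
    by (auto intro: eventually_conj simp: field_simps)
  then obtain k1 where k1: "\<And>k. k1 \<le> k \<Longrightarrow> \<delta> k < \<eta> / 2 \<and> q * T k < \<eta> / 2"
    by (auto simp: eventually_sequentially)
  define p' where "p' = max p k1"
  have small: "\<delta> k \<in> {0<..<\<eta>}" "q * T k \<in> {0<..<\<eta>}" "s k \<in> {0<..<\<eta>}" if "p' \<le> k" for k
    using k1[of k] \<delta>(1)[of k] T[of k] q \<eta> spos[of k] that by (auto simp: p'_def s_def)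
  have inv_s: "inv (s k) \<le> K1 * (inv (\<delta> k) + inv (T k))" if "p' \<le> k" for k
  proof -
    have pk: "p \<le> k" using that by (simp add: p'_def)
    have "C * inv (s k) \<le> inv (\<delta> k) + inv (q * T k)"
      using C(3)[OF small(1,2)[OF that]] small(3)[OF that] by (auto simp: s_def)
    also have "inv (q * T k) \<le> (2 / C) ^ j * inv (T k)"
      unfolding inv_def q_def
      by (rule quasi_additive_power_of_two[OF d C(1) C(3)[unfolded inv_def]])
         (use T[OF pk] small(2)[OF that] in \<open>auto simp: q_def\<close>)
    finally have "inv (s k) \<le> (1 / C) * inv (\<delta> k) + K1 * inv (T k)"
      using C(1) by (simp add: K1_def field_simps)
    also have "(1 / C) * inv (\<delta> k) \<le> K1 * inv (\<delta> k)"
      using K1 desingularizing_inverse_deriv(1)[OF d small(1)[OF that]]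
      by (intro mult_right_mono) (auto simp: inv_def)
    finally show ?thesis by (simp add: distrib_left)
  qed
  define rr where "rr k = a k + inv (T (Suc k))" for k
  have invT: "0 < inv (T k)" if "p \<le> k" for k
    using desingularizing_inverse_deriv(1)[OF d T[OF that]] by (simp add: inv_def)
  define \<rho> where "\<rho> k = rr (p + k)" for k
  have \<rho>pos: "0 \<le> \<rho> k" for k using invT[of "Suc (p + k)"] a(1)[of "p + k"] by (simp add: \<rho>_def rr_def)
  have \<rho>sum: "summable \<rho>"
  proof -
    have "summable (\<lambda>k. a (p + k))" using summable_iff_shift[of a p] a(2) by (simp add: add.commute)
    moreover have "summable (\<lambda>k. inv (T (Suc (p + k))))"
      using summ summable_Suc_iff[of "\<lambda>k. inv (T (p + k))"] by (simp add: inv_def T_def)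
    ultimately show ?thesis unfolding \<rho>_def[abs_def] rr_def by (rule summable_add)
  qed
  define R where "R k = (\<Sum>t. \<rho> (k - p + t))" for k
  have RS: "R k = rr k + R (Suc k)" if "p \<le> k" for k
    using suminf_tail_Suc[OF \<rho>sum, of "k - p"] that by (simp add: R_def \<rho>_def Suc_diff_le)
  have R0: "R \<longlonglongrightarrow> 0"
    unfolding R_def[abs_def]
    by (rule filterlim_compose[OF summable_tail_tendsto_0[OF \<rho>sum] filterlim_minus_const_nat_at_top])
  have Rpos: "0 \<le> R k" for k unfolding R_def
    by (rule suminf_nonneg) (use \<rho>pos \<rho>sum summable_iff_shift[of \<rho> "k - p"] in \<open>auto simp: add.commute\<close>)
  define \<Psi> where "\<Psi> k = \<Delta> k + K2 * \<theta> (s (Suc k)) + R k" for k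
  have \<theta>pos: "0 \<le> \<theta> (s k)" if "p' \<le> k" for k using d small(3)[OF that] by (auto simp: desingularizing_def)
  have \<Psi>pos: "0 \<le> \<Psi> k" if "p' \<le> k" for k
    using \<theta>pos[of "Suc k"] that K2 Rpos[of k] by (simp add: \<Psi>_def \<Delta>_def)
  have \<Psi>0: "\<Psi> \<longlonglongrightarrow> 0"
  proof -
    have "continuous_on {0..\<eta>} \<theta>" "\<theta> 0 = 0" using d by (auto simp: desingularizing_def)
    moreover have "\<forall>\<^sub>F k in sequentially. s (Suc k) \<in> {0..\<eta>}"
      using small(3) by (auto simp: eventually_sequentially intro!: exI[of _ p'] less_imp_le)
    ultimately have "(\<lambda>k. \<theta> (s (Suc k))) \<longlonglongrightarrow> 0"
      using continuous_on_tendsto_compose[of "{0..\<eta>}" \<theta> "\<lambda>k. s (Suc k)" 0] LIMSEQ_Suc[OF s0] \<eta> by auto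
    then have "\<Psi> \<longlonglongrightarrow> 0 + K2 * 0 + 0" unfolding \<Psi>_def[abs_def] by (intro tendsto_intros \<Delta>0 R0)
    then show ?thesis by simp
  qed
  have step: "\<Psi> (Suc k) \<le> \<Psi> k - \<Delta> (Suc k)"
    if k: "p' \<le> k" and near: "X k \<in> ball xbar r" "X (Suc k) \<in> ball xbar r" for k
  proof -
    have k': "p' \<le> Suc k" "p \<le> k" "p \<le> Suc k" using k by (auto simp: p'_def)
    have "1 \<le> deriv \<theta> (\<delta> (Suc k)) * (B * (\<Delta> k + a k))"
      using rel[OF k'(2) near] small(1)[OF k'(1)] by (simp add: \<Delta>_def)
    then have "inv (\<delta> (Suc k)) \<le> B * (\<Delta> k + a k)"
      using desingularizing_inverse_deriv(1)[OF d small(1)[OF k'(1)]] by (simp add: inv_def field_simps)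
    then have "inv (\<delta> (Suc k)) + inv (T (Suc k)) \<le> B * (\<Delta> k + a k) + inv (T (Suc k))" by simp
    also have "\<dots> \<le> (B + 1) * (\<Delta> k + rr k)"
    proof -
      have "0 \<le> \<Delta> k + a k" "0 \<le> B * inv (T (Suc k))" using a(1) B invT[OF k'(3)] by (auto simp: \<Delta>_def)
      then show ?thesis by (simp add: rr_def algebra_simps)
    qed
    finally have "K1 * (inv (\<delta> (Suc k)) + inv (T (Suc k))) \<le> K1 * ((B + 1) * (\<Delta> k + rr k))"
      using K1 by (intro mult_left_mono) auto
    with inv_s[OF k'(1)] have i: "inv (s (Suc k)) \<le> K1 * ((B + 1) * (\<Delta> k + rr k))" by linarith
    define D where "D = \<theta> (s (Suc k)) - \<theta> (s (Suc (Suc k)))"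
    have "deriv \<theta> (s (Suc k)) * (s (Suc k) - s (Suc (Suc k))) \<le> D"
      using desingularizing_gradient_ineq[OF d small(3)[OF k'(1)], of "s (Suc (Suc k))"] small(3)[of "Suc (Suc k)"] k'(1)
      by (simp add: D_def algebra_simps)
    then have "s (Suc k) - s (Suc (Suc k)) \<le> D * inv (s (Suc k))"
      using desingularizing_inverse_deriv(1)[OF d small(3)[OF k'(1)]] by (simp add: inv_def field_simps)
    with sdesc[OF k'(3)] have sq: "\<sigma> * (\<Delta> (Suc k))\<^sup>2 \<le> D * inv (s (Suc k))" by linarith
    have isp: "0 < inv (s (Suc k))"
      using desingularizing_inverse_deriv(1)[OF d small(3)[OF k'(1)]] by (simp add: inv_def)
    have "0 \<le> D * inv (s (Suc k))" by (rule order_trans[OF _ sq]) (use \<sigma> in auto)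
    then have D0: "0 \<le> D" using isp by (simp add: zero_le_mult_iff)
    have "\<sigma> * (\<Delta> (Suc k))\<^sup>2 \<le> D * (K1 * ((B + 1) * (\<Delta> k + rr k)))"
      by (rule order_trans[OF sq mult_left_mono[OF i D0]])
    then have "(\<Delta> (Suc k))\<^sup>2 \<le> (K2 * D) * (\<Delta> k + rr k)"
      using \<sigma> by (simp add: K2_def field_simps)
    moreover have "4 * ((K2 * D) * (\<Delta> k + rr k)) \<le> (K2 * D + (\<Delta> k + rr k))\<^sup>2"
      using zero_le_power2[of "K2 * D - (\<Delta> k + rr k)"] by (simp add: power2_eq_square algebra_simps)
    ultimately have "(2 * \<Delta> (Suc k))\<^sup>2 \<le> (K2 * D + (\<Delta> k + rr k))\<^sup>2" by (simp add: power_mult_distrib)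
    moreover have "0 \<le> K2 * D + (\<Delta> k + rr k)"
      using K2 D0 a(1)[of k] invT[OF k'(3)] by (simp add: \<Delta>_def rr_def add_nonneg_nonneg)
    ultimately have "2 * \<Delta> (Suc k) \<le> K2 * D + (\<Delta> k + rr k)" by (rule power2_le_imp_le)
    then show ?thesis using RS[OF k'(2)] by (simp add: \<Psi>_def D_def algebra_simps)
  qed
  \<comment> \<open>The potential bounds the remaining path length, so by induction no iterate leaves the ball.\<close>
  show ?thesis
  proof (rule metric_LIMSEQ_I)
    fix e0 :: real assume e0: "0 < e0"
    define e where "e = min e0 r"
    have e: "0 < e" "e \<le> r" "e \<le> e0" using e0 r by (auto simp: e_def)
    have "\<forall>\<^sub>F k in sequentially. \<Delta> k < e / 3 \<and> \<Psi> k < e / 3"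
      using order_tendstoD(2)[OF \<Delta>0, of "e / 3"] order_tendstoD(2)[OF \<Psi>0, of "e / 3"] e by (auto intro: eventually_conj)
    then obtain m where m: "\<And>k. m \<le> k \<Longrightarrow> \<Delta> k < e / 3 \<and> \<Psi> k < e / 3" by (auto simp: eventually_sequentially)
    obtain k where k: "max m p' \<le> k" "dist (X k) xbar < e / 3" using acc[of "e / 3" "max m p'"] e by auto
    have ks: "\<Delta> k < e / 3" "\<Psi> k < e / 3" "p' \<le> k" using m[of k] k(1) by auto
    have near1: "dist (X (Suc k)) xbar < 2 * e / 3"
      using dist_triangle[of "X (Suc k)" xbar "X k"] ks(1) k(2) by (simp add: \<Delta>_def dist_norm)
    have ind: "dist (X (k + i)) xbar < e \<and> dist (X (Suc (k + i))) xbar < e \<and>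
        dist (X (Suc k)) (X (Suc (k + i))) \<le> \<Psi> k - \<Psi> (k + i)" for i
    proof (induction i)
      case 0
      then show ?case using k(2) near1 e by auto
    next
      case (Suc i)
      have "\<Psi> (Suc (k + i)) \<le> \<Psi> (k + i) - \<Delta> (Suc (k + i))"
        by (rule step) (use ks Suc e in \<open>auto simp: dist_commute\<close>)
      moreover have "dist (X (Suc (k + i))) (X (Suc (Suc (k + i)))) = \<Delta> (Suc (k + i))"
        by (simp add: \<Delta>_def dist_norm norm_minus_commute)
      ultimately have *: "dist (X (Suc k)) (X (Suc (Suc (k + i)))) \<le> \<Psi> k - \<Psi> (Suc (k + i))"
        using Suc dist_triangle[of "X (Suc k)" "X (Suc (Suc (k + i)))" "X (Suc (k + i))"] by linarith
      have "0 \<le> \<Psi> (Suc (k + i))" by (rule \<Psi>pos) (use ks in auto)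
      then have "dist (X (Suc (Suc (k + i)))) xbar < e"
        using * near1 ks(2) dist_triangle[of "X (Suc (Suc (k + i)))" xbar "X (Suc k)"] by (simp add: dist_commute)
      then show ?case using * Suc by simp
    qed
    show "\<exists>no. \<forall>n\<ge>no. dist (X n) xbar < e0"
    proof (intro exI[of _ k] allI impI)
      fix n assume "k \<le> n"
      then show "dist (X n) xbar < e0" using ind[of "n - k"] e(3) by auto
    qed
  qed
qed

section \<open>Proximal steps, backtracking and perturbed descent\<close>

text \<open>Completing the square: up to a constant the proximal subproblem minimises the linearised
  model \<open>\<psi> y + v \<bullet> (y - x) + (norm (y - x))\<^sup>2 / (2 * \<gamma>)\<close>.\<close>

lemma prox_iff:
  fixes \<psi> :: "'a::euclidean_space \<Rightarrow> ereal"
  assumes "0 < \<gamma>"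
  shows "u \<in> prox \<gamma> \<psi> (x - \<gamma> *\<^sub>R v) \<longleftrightarrow>
    (\<forall>y. \<psi> u + ereal (v \<bullet> (u - x) + (norm (u - x))\<^sup>2 / (2 * \<gamma>))
       \<le> \<psi> y + ereal (v \<bullet> (y - x) + (norm (y - x))\<^sup>2 / (2 * \<gamma>)))"
proof -
  have sq: "(norm (y - (x - \<gamma> *\<^sub>R v)))\<^sup>2 / (2 * \<gamma>)
      = (v \<bullet> (y - x) + (norm (y - x))\<^sup>2 / (2 * \<gamma>)) + \<gamma> * (norm v)\<^sup>2 / 2" for y
  proof -
    define w where "w = y - x"
    have "y - (x - \<gamma> *\<^sub>R v) = w + \<gamma> *\<^sub>R v" by (simp add: w_def)
    moreover have "(norm (w + \<gamma> *\<^sub>R v))\<^sup>2 = (norm w)\<^sup>2 + 2 * \<gamma> * (v \<bullet> w) + \<gamma>\<^sup>2 * (norm v)\<^sup>2"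
      unfolding power2_norm_eq_inner
      by (simp add: inner_add_left inner_add_right inner_commute power2_eq_square)
    ultimately have "(norm (y - (x - \<gamma> *\<^sub>R v)))\<^sup>2 = (norm (y - x))\<^sup>2 + 2 * \<gamma> * (v \<bullet> (y - x)) + \<gamma>\<^sup>2 * (norm v)\<^sup>2"
      by (simp only: w_def)
    then show ?thesis using assms by (simp add: field_simps power2_eq_square)
  qed
  have shift: "a + ereal (b + d) \<le> a' + ereal (b' + d) \<longleftrightarrow> a + ereal b \<le> a' + ereal b'" for a a' :: ereal and b b' d
    by (cases a; cases a') auto
  show ?thesis
    unfolding prox_def is_arg_min_def sq by (simp add: not_less shift)
qed

lemma prox_finite:
  fixes \<psi> :: "'a::euclidean_space \<Rightarrow> ereal"
  assumes "proper \<psi>" "0 < \<gamma>" "u \<in> prox \<gamma> \<psi> (x - \<gamma> *\<^sub>R v)"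
  shows "\<bar>\<psi> u\<bar> \<noteq> \<infinity>"
proof -
  obtain y where y: "\<psi> y < \<infinity>" using assms(1) by (auto simp: proper_def edom_def)
  have "\<psi> u + ereal (v \<bullet> (u - x) + (norm (u - x))\<^sup>2 / (2 * \<gamma>))
       \<le> \<psi> y + ereal (v \<bullet> (y - x) + (norm (y - x))\<^sup>2 / (2 * \<gamma>))"
    using assms(3) unfolding prox_iff[OF assms(2)] by blast
  then have "\<psi> u \<noteq> \<infinity>" using y by auto
  moreover have "\<psi> u \<noteq> -\<infinity>" using assms(1) by (auto simp: proper_def)
  ultimately show ?thesis by auto
qed

lemma prox_real_ineq:
  fixes \<psi> :: "'a::euclidean_space \<Rightarrow> ereal"
  assumes "proper \<psi>" "0 < \<gamma>" "u \<in> prox \<gamma> \<psi> (x - \<gamma> *\<^sub>R v)" "\<bar>\<psi> y\<bar> \<noteq> \<infinity>"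
  shows "real_of_ereal (\<psi> u) + v \<bullet> (u - x) + (norm (u - x))\<^sup>2 / (2 * \<gamma>)
       \<le> real_of_ereal (\<psi> y) + v \<bullet> (y - x) + (norm (y - x))\<^sup>2 / (2 * \<gamma>)"
proof -
  have "\<psi> u + ereal (v \<bullet> (u - x) + (norm (u - x))\<^sup>2 / (2 * \<gamma>))
       \<le> \<psi> y + ereal (v \<bullet> (y - x) + (norm (y - x))\<^sup>2 / (2 * \<gamma>))"
    using assms(3) unfolding prox_iff[OF assms(2)] by blast
  moreover have "\<psi> u = ereal (real_of_ereal (\<psi> u))" "\<psi> y = ereal (real_of_ereal (\<psi> y))"
    using prox_finite[OF assms(1-3)] assms(4) by (simp_all add: ereal_real)
  ultimately show ?thesis by (metis (no_types, lifting) add.assoc ereal_less_eq(3) plus_ereal.simps(1))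
qed

text \<open>The run of the loop matters only through its last rejected trial point: either the initial
  stepsize was accepted, or \<open>\<tau> / \<rho>\<close> failed the descent test.\<close>

lemma backtracking_final_stepsize:
  assumes "backtracking \<rho> \<sigma> \<psi> F x v \<gamma> u" "0 < \<gamma>" "0 < \<rho>"
  shows "\<exists>\<tau>>0. u \<in> prox \<tau> \<psi> (x - \<tau> *\<^sub>R v) \<and> \<not> F u > F x - ereal (\<sigma> * (norm (u - x))\<^sup>2) \<and>
    (\<tau> = \<gamma> \<or> (\<exists>u'. u' \<in> prox (\<tau> / \<rho>) \<psi> (x - (\<tau> / \<rho>) *\<^sub>R v) \<and> F u' > F x - ereal (\<sigma> * (norm (u' - x))\<^sup>2)))"
  using assms
proof (induction rule: backtracking.induct)
  case (accept u \<gamma>)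
  then show ?case by blast
next
  case (reject u \<gamma> u')
  then obtain \<tau> where \<tau>: "\<tau> > 0" "u' \<in> prox \<tau> \<psi> (x - \<tau> *\<^sub>R v)" "\<not> F u' > F x - ereal (\<sigma> * (norm (u' - x))\<^sup>2)"
    "\<tau> = \<rho> * \<gamma> \<or> (\<exists>u'. u' \<in> prox (\<tau> / \<rho>) \<psi> (x - (\<tau> / \<rho>) *\<^sub>R v) \<and> F u' > F x - ereal (\<sigma> * (norm (u' - x))\<^sup>2))"
    by auto
  then show ?case using reject.hyps(1,2) reject.prems by (intro exI[of _ \<tau>]) auto
qed

lemma lsc_sequential_bound:
  fixes f :: "'a::euclidean_space \<Rightarrow> ereal"
  assumes "lsc f" "Y \<longlonglongrightarrow> x" "\<forall>\<^sub>F i in sequentially. f (Y i) \<le> ereal (b i)" "b \<longlonglongrightarrow> b0"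
  shows "f x \<le> ereal b0"
proof (rule ccontr)
  assume "\<not> f x \<le> ereal b0"
  then obtain c where c: "ereal b0 < c" "c < f x" using dense[of "ereal b0" "f x"] by (auto simp: not_le)
  have "c < Liminf (at x) f" using assms(1) c(2) unfolding lsc_def by (meson less_le_trans)
  then have "\<forall>\<^sub>F y in at x. c < f y" by (rule less_LiminfD)
  then have "\<forall>\<^sub>F y in nhds x. c < f y" using c(2) by (auto simp: eventually_at_filter elim: eventually_mono)
  then have "\<forall>\<^sub>F i in sequentially. c < f (Y i)" using assms(2) by (rule eventually_compose_filterlim)
  then have "\<forall>\<^sub>F i in sequentially. c \<le> ereal (b i)" using assms(3)
    by eventually_elim auto
  moreover have "(\<lambda>i. ereal (b i)) \<longlonglongrightarrow> ereal b0" using assms(4) by simp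
  ultimately have "c \<le> ereal b0" by (intro tendsto_lowerbound) auto
  with c(1) show False by simp
qed

text \<open>Adding the tail sums of the errors to \<open>\<Phi>\<close> restores monotonicity.\<close>

lemma perturbed_descent_convergent:
  fixes \<Phi> D e :: "nat \<Rightarrow> real"
  assumes e: "\<And>k. 0 \<le> e k" "summable e" and D: "\<And>k. 0 \<le> D k"
    and desc: "\<And>k. k0 \<le> k \<Longrightarrow> \<Phi> (Suc k) \<le> \<Phi> k - D k + e k" and lower: "\<And>k. l \<le> \<Phi> k"
  shows "convergent \<Phi>" "D \<longlonglongrightarrow> 0"
proof -
  define T where "T k = (\<Sum>t. e (k + t))" for k
  have TS: "T k = e k + T (Suc k)" for k unfolding T_def by (rule suminf_tail_Suc[OF e(2)])
  have T0: "T \<longlonglongrightarrow> 0" unfolding T_def[abs_def] by (rule summable_tail_tendsto_0[OF e(2)])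
  have Tpos: "0 \<le> T k" for k unfolding T_def
    by (rule suminf_nonneg) (use e summable_iff_shift[of e k] in \<open>auto simp: add.commute\<close>)
  define s where "s k = \<Phi> k + T k" for k
  have dec: "s (Suc k) \<le> s k - D k" if "k0 \<le> k" for k
    using desc[OF that] TS[of k] by (simp add: s_def)
  have "decseq (\<lambda>k. s (k + k0))"
  proof (rule decseq_SucI)
    show "s (Suc k + k0) \<le> s (k + k0)" for k using dec[of "k + k0"] D[of "k + k0"] by simp
  qed
  moreover have "l \<le> s (k + k0)" for k using lower[of "k + k0"] Tpos[of "k + k0"] by (simp add: s_def)
  ultimately obtain L where "(\<lambda>k. s (k + k0)) \<longlonglongrightarrow> L" using decseq_convergent by blast
  then have L: "s \<longlonglongrightarrow> L" by (rule LIMSEQ_offset)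
  have "(\<lambda>k. s k - T k) \<longlonglongrightarrow> L - 0" by (intro tendsto_diff L T0)
  then show "convergent \<Phi>" by (auto simp: s_def convergent_def)
  have "(\<lambda>k. s k - s (Suc k)) \<longlonglongrightarrow> L - L" by (intro tendsto_diff L LIMSEQ_Suc)
  then have lim: "(\<lambda>k. s k - s (Suc k)) \<longlonglongrightarrow> 0" by simp
  show "D \<longlonglongrightarrow> 0"
  proof (rule tendsto_sandwich[OF _ _ tendsto_const lim])
    show "\<forall>\<^sub>F k in sequentially. 0 \<le> D k" using D by simp
    show "\<forall>\<^sub>F k in sequentially. D k \<le> s k - s (Suc k)"
      using eventually_ge_at_top[of k0] by eventually_elim (use dec in fastforce)
  qed
qed

section \<open>Trajectories of the algorithm\<close>

text \<open>A single trajectory of the algorithm, together with the facts about the sample averages \<open>EN N\<close>, the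
  averaged subgradients \<open>G N\<close> and the expectation \<open>E\<close> that hold for almost every outcome. All of them are local,
  with constants that may depend on the outcome; everything in this locale is deterministic.\<close>

locale pss_trajectory =
  fixes E :: "'a::euclidean_space \<Rightarrow> real" and EN :: "nat \<Rightarrow> 'a \<Rightarrow> real" and G :: "nat \<Rightarrow> 'a \<Rightarrow> 'a set"
    and \<psi> :: "'a \<Rightarrow> ereal" and n :: "nat \<Rightarrow> nat" and X :: "nat \<Rightarrow> 'a" and \<rho> \<sigma> \<gamma>min :: real
  assumes proper: "proper \<psi>" and lsc: "lsc \<psi>" and prox_bounded: "prox_bounded \<psi>"
    and local_rate: "\<And>x. \<exists>U C. open U \<and> x \<in> U \<and>
        (\<forall>y\<in>U. \<forall>N\<ge>2. \<bar>EN N y - E y\<bar> \<le> C * (ln (real N) / sqrt (real N)))"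
    and local_bound: "\<And>x. \<exists>U M. open U \<and> x \<in> U \<and> (\<forall>y\<in>U. \<forall>N\<ge>1. \<forall>v\<in>G N y. norm v \<le> M)"
    and local_upper: "\<And>x. \<exists>U L. open U \<and> x \<in> U \<and> (\<forall>N\<ge>1. \<forall>y\<in>U. \<forall>z\<in>U. \<forall>v\<in>G N y.
        EN N z \<le> EN N y + v \<bullet> (z - y) + L * (norm (z - y))\<^sup>2)"
    and local_lipschitz: "\<And>x. \<exists>U k. open U \<and> x \<in> U \<and> (\<forall>y\<in>U. \<forall>z\<in>U. \<bar>E y - E z\<bar> \<le> k * norm (y - z))"
    and local_smooth: "\<And>x v \<gamma>. v \<in> clarke_subdiff (\<lambda>y. ereal (E y)) x \<Longrightarrow> 0 < \<gamma> \<Longrightarrow> x \<in> prox \<gamma> \<psi> (x - \<gamma> *\<^sub>R v) \<Longrightarrow>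
        \<exists>U g L C. open U \<and> x \<in> U \<and>
          (\<forall>y\<in>U. \<forall>z\<in>U. \<bar>E z - E y - g y \<bullet> (z - y)\<bar> \<le> L * (norm (z - y))\<^sup>2 \<and> norm (g y - g z) \<le> L * norm (y - z)) \<and>
          (\<forall>y\<in>U. \<forall>N\<ge>2. \<forall>v\<in>G N y. norm (v - g y) \<le> C * (ln (real N) / sqrt (real N)))"
    and n_pos: "\<And>k. 0 < n k" and n_top: "filterlim n at_top sequentially"
    and rate_summable: "summable (sample_rate n)"
    and \<rho>: "0 < \<rho>" and \<sigma>: "0 < \<sigma>" and \<gamma>min: "0 < \<gamma>min"
    and start: "\<psi> (X 0) < \<infinity>"
    and iteration: "\<And>k. \<exists>v\<in>G (n k) (X k). \<exists>\<gamma>\<ge>\<gamma>min.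
        backtracking \<rho> \<sigma> \<psi> (\<lambda>y. ereal (EN (n k) y) + \<psi> y) (X k) v \<gamma> (X (Suc k))"
    and bounded: "bounded (range X)"
begin

text \<open>Iterations are described by relations, since subgradients and proximal points need not be unique. A
  choice therefore fixes one direction and one accepted stepsize for every iteration.\<close>

definition step_data :: "nat \<Rightarrow> 'a \<times> real \<Rightarrow> bool" where
  "step_data k d \<longleftrightarrow> (case d of (v, \<tau>) \<Rightarrow> v \<in> G (n k) (X k) \<and> 0 < \<tau> \<and> X (Suc k) \<in> prox \<tau> \<psi> (X k - \<tau> *\<^sub>R v) \<and>
     \<not> ereal (EN (n k) (X (Suc k))) + \<psi> (X (Suc k)) >
        ereal (EN (n k) (X k)) + \<psi> (X k) - ereal (\<sigma> * (norm (X (Suc k) - X k))\<^sup>2) \<and>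
     (\<gamma>min \<le> \<tau> \<or> (\<exists>u'. u' \<in> prox (\<tau> / \<rho>) \<psi> (X k - (\<tau> / \<rho>) *\<^sub>R v) \<and>
        ereal (EN (n k) u') + \<psi> u' > ereal (EN (n k) (X k)) + \<psi> (X k) - ereal (\<sigma> * (norm (u' - X k))\<^sup>2))))"

definition chosen_step :: "nat \<Rightarrow> 'a \<times> real" where "chosen_step k = (SOME d. step_data k d)"
definition v :: "nat \<Rightarrow> 'a" where "v k = fst (chosen_step k)"
definition \<tau> :: "nat \<Rightarrow> real" where "\<tau> k = snd (chosen_step k)"
definition \<psi>r :: "'a \<Rightarrow> real" where "\<psi>r y = real_of_ereal (\<psi> y)"
definition \<Phi> :: "nat \<Rightarrow> real" where "\<Phi> k = E (X k) + \<psi>r (X k)"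
definition \<Delta> :: "nat \<Rightarrow> real" where "\<Delta> k = norm (X (Suc k) - X k)"

lemma chosen_step_data: "step_data k (chosen_step k)"
proof -
  obtain v \<gamma> where v: "v \<in> G (n k) (X k)" "\<gamma>min \<le> \<gamma>"
      "backtracking \<rho> \<sigma> \<psi> (\<lambda>y. ereal (EN (n k) y) + \<psi> y) (X k) v \<gamma> (X (Suc k))"
    using iteration[of k] by blast
  have "0 < \<gamma>" using v(2) \<gamma>min by simp
  from backtracking_final_stepsize[OF v(3) this \<rho>] v(1,2) have "\<exists>\<tau>. step_data k (v, \<tau>)"
    unfolding step_data_def by auto
  then show ?thesis unfolding chosen_step_def by (auto intro: someI)
qed

lemma step:
  shows v_in: "v k \<in> G (n k) (X k)" and \<tau>_pos: "0 < \<tau> k"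
    and step_prox: "X (Suc k) \<in> prox (\<tau> k) \<psi> (X k - \<tau> k *\<^sub>R v k)"
    and step_accepted: "\<not> ereal (EN (n k) (X (Suc k))) + \<psi> (X (Suc k)) >
        ereal (EN (n k) (X k)) + \<psi> (X k) - ereal (\<sigma> * (\<Delta> k)\<^sup>2)"
    and step_rejected: "\<gamma>min \<le> \<tau> k \<or> (\<exists>u'. u' \<in> prox (\<tau> k / \<rho>) \<psi> (X k - (\<tau> k / \<rho>) *\<^sub>R v k) \<and>
        ereal (EN (n k) u') + \<psi> u' > ereal (EN (n k) (X k)) + \<psi> (X k) - ereal (\<sigma> * (norm (u' - X k))\<^sup>2))"
  using chosen_step_data[of k] unfolding step_data_def v_def \<tau>_def \<Delta>_def by (auto simp: case_prod_beta)

lemma \<psi>_not_minf: "\<psi> y \<noteq> -\<infinity>" using proper by (auto simp: proper_def)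

lemma \<psi>_finite: "\<bar>\<psi> (X k)\<bar> \<noteq> \<infinity>"
proof (cases k)
  case 0
  then show ?thesis using start \<psi>_not_minf[of "X 0"] by auto
next
  case (Suc k')
  then show ?thesis using prox_finite[OF proper \<tau>_pos step_prox] by simp
qed

lemma \<psi>_eq: "\<psi> (X k) = ereal (\<psi>r (X k))"
  unfolding \<psi>r_def using \<psi>_finite by (simp add: ereal_real)

lemma empirical_descent: "EN (n k) (X (Suc k)) + \<psi>r (X (Suc k)) \<le> EN (n k) (X k) + \<psi>r (X k) - \<sigma> * (\<Delta> k)\<^sup>2"
  using step_accepted[of k] by (simp add: \<psi>_eq)

lemma compact_closure_range: "compact (closure (range X))"
  using bounded by (simp add: compact_closure)

lemma X_in_closure: "X k \<in> closure (range X)" by (simp add: closure_subset[THEN subsetD])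

lemma uniform_rate_on_orbit:
  obtains C where "0 \<le> C" "\<And>y N. y \<in> closure (range X) \<Longrightarrow> 2 \<le> N \<Longrightarrow>
      \<bar>EN N y - E y\<bar> \<le> C * (ln (real N) / sqrt (real N))"
proof -
  obtain C where C: "\<And>y. y \<in> closure (range X) \<Longrightarrow> \<forall>N\<ge>2. \<bar>EN N y - E y\<bar> \<le> C * (ln (real N) / sqrt (real N))"
  proof (rule uniform_constant_on_compact[OF compact_closure_range, of
          "\<lambda>C y. \<forall>N\<ge>2. \<bar>EN N y - E y\<bar> \<le> C * (ln (real N) / sqrt (real N))"])
    fix C C' :: real and y
    assume C: "\<forall>N\<ge>2. \<bar>EN N y - E y\<bar> \<le> C * (ln (real N) / sqrt (real N))" "C \<le> C'"
    show "\<forall>N\<ge>2. \<bar>EN N y - E y\<bar> \<le> C' * (ln (real N) / sqrt (real N))"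
    proof (intro allI impI)
      fix N :: nat assume N: "2 \<le> N"
      have "\<bar>EN N y - E y\<bar> \<le> C * (ln (real N) / sqrt (real N))" using C(1) N by blast
      also have "\<dots> \<le> C' * (ln (real N) / sqrt (real N))" using C(2) N by (intro mult_right_mono) auto
      finally show "\<bar>EN N y - E y\<bar> \<le> C' * (ln (real N) / sqrt (real N))" .
    qed
  qed (rule local_rate, blast)
  show ?thesis
  proof (rule that[of "max C 0"])
    fix y N assume y: "y \<in> closure (range X)" and N: "(2::nat) \<le> N"
    then have "\<bar>EN N y - E y\<bar> \<le> C * (ln (real N) / sqrt (real N))" using C by blast
    also have "\<dots> \<le> max C 0 * (ln (real N) / sqrt (real N))" using N by (intro mult_right_mono) auto
    finally show "\<bar>EN N y - E y\<bar> \<le> max C 0 * (ln (real N) / sqrt (real N))" .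
  qed simp
qed

lemma v_bounded: obtains M where "0 \<le> M" "\<And>k. norm (v k) \<le> M"
proof -
  obtain M where M: "\<And>y. y \<in> closure (range X) \<Longrightarrow> \<forall>N\<ge>1. \<forall>v\<in>G N y. norm v \<le> M"
    by (rule uniform_constant_on_compact[OF compact_closure_range, of "\<lambda>M y. \<forall>N\<ge>1. \<forall>v\<in>G N y. norm v \<le> M"])
       (rule local_bound, meson order_trans, blast)
  have "norm (v k) \<le> M" for k
    using M[OF X_in_closure[of k]] v_in[of k] n_pos[of k] by (simp add: Suc_le_eq)
  moreover have "0 \<le> M" using calculation[of 0] norm_ge_zero order_trans by blast
  ultimately show ?thesis using that by blast
qed

lemma E_cont: "isCont E x"
proof -
  obtain U k where U: "open U" "x \<in> U" and lip: "\<And>y z. y \<in> U \<Longrightarrow> z \<in> U \<Longrightarrow> \<bar>E y - E z\<bar> \<le> k * norm (y - z)"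
    using local_lipschitz[of x] by blast
  have "((\<lambda>y. k * norm (y - x)) \<longlongrightarrow> k * norm (x - x)) (at x)" by (intro tendsto_intros)
  then have lim: "((\<lambda>y. k * norm (y - x)) \<longlongrightarrow> 0) (at x)" by simp
  have "\<forall>\<^sub>F y in at x. norm (E y - E x) \<le> k * norm (y - x)"
    using eventually_at_in_open'[OF U] by eventually_elim (use lip U in auto)
  then have "((\<lambda>y. E y - E x) \<longlongrightarrow> 0) (at x)" by (rule Lim_null_comparison) (rule lim)
  then show ?thesis by (simp add: isCont_def LIM_zero_iff)
qed

lemma \<psi>_quadratic_minorant:
  obtains c \<gamma>0 where "0 < \<gamma>0" "\<And>y. \<bar>\<psi> y\<bar> \<noteq> \<infinity> \<Longrightarrow> c - (norm y)\<^sup>2 / (2 * \<gamma>0) \<le> \<psi>r y"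
proof -
  obtain \<gamma>0 c where c: "0 < \<gamma>0" "\<And>y. ereal c \<le> \<psi> y + ereal ((norm y)\<^sup>2 / (2 * \<gamma>0))"
    using prox_bounded by (auto simp: prox_bounded_def prox_params_def)
  show ?thesis
  proof (rule that[OF c(1)])
    fix y assume "\<bar>\<psi> y\<bar> \<noteq> \<infinity>"
    then show "c - (norm y)\<^sup>2 / (2 * \<gamma>0) \<le> \<psi>r y" using c(2)[of y] by (cases "\<psi> y") (auto simp: \<psi>r_def)
  qed
qed

lemma X_bounded: obtains R where "0 \<le> R" "\<And>k. norm (X k) \<le> R"
  using bounded by (auto simp: bounded_iff) (meson norm_ge_zero order_trans)

lemma E_bounded: obtains B where "\<And>k. \<bar>E (X k)\<bar> \<le> B"
proof -
  have "compact (E ` closure (range X))"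
    by (rule compact_continuous_image[OF _ compact_closure_range])
       (use E_cont in \<open>auto intro: continuous_at_imp_continuous_on\<close>)
  from compact_imp_bounded[OF this] obtain B where B: "\<forall>z\<in>E ` closure (range X). norm z \<le> B"
    unfolding bounded_iff by (elim exE)
  have "\<bar>E (X k)\<bar> \<le> B" for k using B X_in_closure[of k] by auto
  then show ?thesis by (rule that)
qed

lemma rate_nonneg: "0 \<le> sample_rate n k"
  using n_pos[of k] by (simp add: sample_rate_def Suc_le_eq)

text \<open>The descent test holds for the sample average; replacing it by the expectation on the closure of
  the orbit costs twice the uniform error. Indices with sample size 1 must be skipped, since
  there the rate \<open>ln 1 / sqrt 1\<close> vanishes.\<close>

lemma expected_descent:
  obtains c k0 where "0 \<le> c" "\<And>k. k0 \<le> k \<Longrightarrow> 2 \<le> n k"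
    "\<And>k. k0 \<le> k \<Longrightarrow> \<Phi> (Suc k) \<le> \<Phi> k - \<sigma> * (\<Delta> k)\<^sup>2 + c * sample_rate n k"
proof -
  obtain C where C: "0 \<le> C" "\<And>y N. y \<in> closure (range X) \<Longrightarrow> 2 \<le> N \<Longrightarrow>
      \<bar>EN N y - E y\<bar> \<le> C * (ln (real N) / sqrt (real N))" by (rule uniform_rate_on_orbit) blast
  obtain k0 where k0: "\<And>k. k0 \<le> k \<Longrightarrow> 2 \<le> n k"
    using n_top by (auto simp: filterlim_at_top eventually_sequentially)
  show ?thesis
  proof (rule that[of "2 * C" k0])
    fix k assume k: "k0 \<le> k"
    have "\<bar>EN (n k) (X k) - E (X k)\<bar> \<le> C * sample_rate n k" "\<bar>EN (n k) (X (Suc k)) - E (X (Suc k))\<bar> \<le> C * sample_rate n k"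
      unfolding sample_rate_def by (rule C(2)[OF X_in_closure k0[OF k]])+
    then show "\<Phi> (Suc k) \<le> \<Phi> k - \<sigma> * (\<Delta> k)\<^sup>2 + (2 * C) * sample_rate n k"
      using empirical_descent[of k] by (simp add: \<Phi>_def)
  qed (use C k0 in auto)
qed

lemma \<Phi>_convergent: "convergent \<Phi>" and \<Delta>_tendsto_0: "\<Delta> \<longlonglongrightarrow> 0"
proof -
  obtain c k0 where ck: "0 \<le> c" "\<And>k. k0 \<le> k \<Longrightarrow> \<Phi> (Suc k) \<le> \<Phi> k - \<sigma> * (\<Delta> k)\<^sup>2 + c * sample_rate n k"
    by (rule expected_descent) blast
  obtain c' \<gamma>0 where m: "0 < \<gamma>0" "\<And>y. \<bar>\<psi> y\<bar> \<noteq> \<infinity> \<Longrightarrow> c' - (norm y)\<^sup>2 / (2 * \<gamma>0) \<le> \<psi>r y"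
    by (rule \<psi>_quadratic_minorant) blast
  obtain R where R: "0 \<le> R" "\<And>k. norm (X k) \<le> R" by (rule X_bounded) blast
  obtain B where B: "\<And>k. \<bar>E (X k)\<bar> \<le> B" by (rule E_bounded) blast
  have lower: "- B + c' - R\<^sup>2 / (2 * \<gamma>0) \<le> \<Phi> k" for k
  proof -
    have "(norm (X k))\<^sup>2 / (2 * \<gamma>0) \<le> R\<^sup>2 / (2 * \<gamma>0)" using R m(1) by (intro divide_right_mono power_mono) auto
    then show ?thesis using m(2)[OF \<psi>_finite[of k]] B[of k] unfolding \<Phi>_def by linarith
  qed
  note pd = perturbed_descent_convergent[where e = "\<lambda>k. c * sample_rate n k" and D = "\<lambda>k. \<sigma> * (\<Delta> k)\<^sup>2",
      OF _ summable_mult[OF rate_summable] _ ck(2) lower]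
  show "convergent \<Phi>" by (rule pd(1)) (use ck rate_nonneg \<sigma> in auto)
  have "(\<lambda>k. \<sigma> * (\<Delta> k)\<^sup>2) \<longlonglongrightarrow> 0" by (rule pd(2)) (use ck rate_nonneg \<sigma> in auto)
  then have "(\<lambda>k. sqrt ((\<sigma> * (\<Delta> k)\<^sup>2) / \<sigma>)) \<longlonglongrightarrow> sqrt (0 / \<sigma>)" by (intro tendsto_intros) (use \<sigma> in auto)
  then show "\<Delta> \<longlonglongrightarrow> 0" using \<sigma> by (simp add: \<Delta>_def[abs_def])
qed

lemma \<psi>_bounded_above: obtains B where "\<And>k. \<psi>r (X k) \<le> B"
proof -
  obtain B1 where B1: "\<And>k. \<bar>\<Phi> k\<bar> \<le> B1" using convergent_imp_Bseq[OF \<Phi>_convergent] by (auto simp: Bseq_def)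
  obtain B where B: "\<And>k. \<bar>E (X k)\<bar> \<le> B" by (rule E_bounded) blast
  have "\<psi>r (X k) \<le> B1 + B" for k using B1[of k] B[of k] unfolding \<Phi>_def by linarith
  then show ?thesis by (rule that)
qed

text \<open>A rejected stepsize cannot be too small. For a small \<open>\<gamma>\<close>, boundedness of \<open>\<psi>\<close> along the orbit and
  prox-boundedness keep the trial point \<open>u\<close> close to the iterate, hence inside the neighbourhood where the
  averaged quadratic upper bound with constant \<open>L\<close> holds; the proximal inequality then beats it as soon
  as \<open>1 / (2 * \<gamma>) \<ge> L + \<sigma>\<close>, so that \<open>u\<close> would have passed the test.\<close>

lemma stepsize_bounded_below:
  obtains r \<gamma>l where "0 < r" "0 < \<gamma>l" "\<And>k. X k \<in> ball x r \<Longrightarrow> \<gamma>l \<le> \<tau> k"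
proof -
  obtain U L0 where U: "open U" "x \<in> U" and up: "\<forall>N\<ge>1. \<forall>y\<in>U. \<forall>z\<in>U. \<forall>v\<in>G N y.
        EN N z \<le> EN N y + v \<bullet> (z - y) + L0 * (norm (z - y))\<^sup>2" using local_upper[of x] by (elim exE conjE) rule
  define L where "L = \<bar>L0\<bar>"
  obtain e where e: "0 < e" "ball x e \<subseteq> U" using U openE by blast
  define r where "r = e / 2"
  obtain M where M: "0 \<le> M" "\<And>k. norm (v k) \<le> M" by (rule v_bounded) blast
  obtain c \<gamma>0 where m: "0 < \<gamma>0" "\<And>y. \<bar>\<psi> y\<bar> \<noteq> \<infinity> \<Longrightarrow> c - (norm y)\<^sup>2 / (2 * \<gamma>0) \<le> \<psi>r y"
    by (rule \<psi>_quadratic_minorant) blast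
  obtain R where R: "0 \<le> R" "\<And>k. norm (X k) \<le> R" by (rule X_bounded) blast
  obtain B where B: "\<And>k. \<psi>r (X k) \<le> B" by (rule \<psi>_bounded_above) blast
  define B' where "B' = \<bar>B - c\<bar> + R\<^sup>2 / \<gamma>0"
  have B': "0 \<le> B'" using m(1) by (simp add: B'_def)
  have r: "0 < r" using e by (simp add: r_def)
  \<comment> \<open>\<open>Q\<close> dominates both values of \<open>1 / (2 * \<gamma>)\<close> needed: for \<open>u\<close> to be close and for \<open>u\<close> to pass the test.\<close>
  define Q where "Q = 1 / \<gamma>0 + B' / r\<^sup>2 + M / r + L + \<sigma>"
  have Qs: "1 / \<gamma>0 + B' / r\<^sup>2 + M / r \<le> Q" "L + \<sigma> \<le> Q" "0 < Q"
    using m(1) B' M(1) r \<sigma> by (auto simp: Q_def L_def add_pos_nonneg add_nonneg_pos)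
  show ?thesis
  proof (rule that[of r "min \<gamma>min (\<rho> / (2 * Q))"])
    show "0 < r" by (rule r)
    show "0 < min \<gamma>min (\<rho> / (2 * Q))" using \<gamma>min \<rho> Qs by simp
    fix k assume Xk: "X k \<in> ball x r"
    show "min \<gamma>min (\<rho> / (2 * Q)) \<le> \<tau> k"
    proof (rule ccontr)
      assume "\<not> min \<gamma>min (\<rho> / (2 * Q)) \<le> \<tau> k"
      then have small: "\<tau> k < \<gamma>min" "\<tau> k < \<rho> / (2 * Q)" by auto
      obtain u where u: "u \<in> prox (\<tau> k / \<rho>) \<psi> (X k - (\<tau> k / \<rho>) *\<^sub>R v k)"
        "ereal (EN (n k) u) + \<psi> u > ereal (EN (n k) (X k)) + \<psi> (X k) - ereal (\<sigma> * (norm (u - X k))\<^sup>2)"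
        using step_rejected[of k] small(1) by auto
      define \<gamma> where "\<gamma> = \<tau> k / \<rho>"
      define D where "D = norm (u - X k)"
      have D0: "0 \<le> D" by (simp add: D_def)
      have \<gamma>: "0 < \<gamma>" using \<tau>_pos \<rho> by (simp add: \<gamma>_def)
      have big: "Q < 1 / (2 * \<gamma>)" using small(2) \<rho> Qs(3) \<tau>_pos[of k] by (simp add: \<gamma>_def field_simps)
      have ufin: "\<bar>\<psi> u\<bar> \<noteq> \<infinity>" by (rule prox_finite[OF proper \<gamma>]) (use u in \<open>simp add: \<gamma>_def\<close>)
      have pi: "\<psi>r u + v k \<bullet> (u - X k) + D\<^sup>2 / (2 * \<gamma>) \<le> \<psi>r (X k)"
        using prox_real_ineq[OF proper \<gamma> _ \<psi>_finite[of k], of u "X k" "v k"] u(1)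
        by (simp add: \<gamma>_def D_def \<psi>r_def)
      \<comment> \<open>If \<open>D \<ge> r\<close>, then constants and linear terms in \<open>D\<close> are dominated by multiples of \<open>D\<^sup>2\<close>.\<close>
      have "D < r"
      proof (rule ccontr)
        assume "\<not> D < r"
        then have Dr: "r \<le> D" "0 < D" using r by auto
        have "- (M * D) \<le> v k \<bullet> (u - X k)"
          using Cauchy_Schwarz_ineq2[of "v k" "u - X k"] mult_right_mono[OF M(2)[of k] D0] by (simp add: D_def)
        moreover have "c - (2 * D\<^sup>2 + 2 * R\<^sup>2) / (2 * \<gamma>0) \<le> \<psi>r u"
        proof -
          have "norm u \<le> D + R" using norm_triangle_ineq[of "u - X k" "X k"] R(2)[of k] by (simp add: D_def)
          then have "(norm u)\<^sup>2 \<le> (D + R)\<^sup>2" by (intro power_mono) auto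
          also have "\<dots> \<le> 2 * D\<^sup>2 + 2 * R\<^sup>2"
            using zero_le_power2[of "D - R"] by (simp add: power2_eq_square algebra_simps)
          finally have "(norm u)\<^sup>2 / (2 * \<gamma>0) \<le> (2 * D\<^sup>2 + 2 * R\<^sup>2) / (2 * \<gamma>0)" using m(1) by (intro divide_right_mono) auto
          then show ?thesis using m(2)[OF ufin] by linarith
        qed
        moreover have "(2 * D\<^sup>2 + 2 * R\<^sup>2) / (2 * \<gamma>0) = D\<^sup>2 * (1 / \<gamma>0) + R\<^sup>2 / \<gamma>0" using m(1) by (simp add: field_simps)
        ultimately have "D\<^sup>2 / (2 * \<gamma>) \<le> B' + D\<^sup>2 * (1 / \<gamma>0) + M * D"
          using pi B[of k] unfolding B'_def by linarith
        also have "\<dots> \<le> D\<^sup>2 * (1 / \<gamma>0 + B' / r\<^sup>2 + M / r)"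
        proof -
          have "B' * 1 \<le> B' * (D\<^sup>2 / r\<^sup>2)" using B' Dr r by (intro mult_left_mono) (auto intro: power_mono)
          moreover have "M * D * 1 \<le> M * D * (D / r)" using M(1) Dr r by (intro mult_left_mono) auto
          ultimately show ?thesis by (simp add: distrib_left power2_eq_square mult_ac)
        qed
        also have "\<dots> \<le> D\<^sup>2 * Q" using Qs(1) by (intro mult_left_mono) auto
        also have "\<dots> < D\<^sup>2 * (1 / (2 * \<gamma>))" using big Dr by (intro mult_strict_left_mono) auto
        finally show False by simp
      qed
      then have uU: "u \<in> U" "X k \<in> U"
        using Xk e dist_triangle[of x u "X k"] by (auto simp: r_def D_def dist_norm norm_minus_commute subset_iff)
      have "EN (n k) u \<le> EN (n k) (X k) + v k \<bullet> (u - X k) + L0 * D\<^sup>2"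
        unfolding D_def by (rule up[rule_format, OF _ uU(2,1) v_in]) (use n_pos[of k] in auto)
      also have "L0 * D\<^sup>2 \<le> L * D\<^sup>2" unfolding L_def by (intro mult_right_mono) auto
      finally have "EN (n k) u + \<psi>r u \<le> EN (n k) (X k) + \<psi>r (X k) + (L * D\<^sup>2 - D\<^sup>2 / (2 * \<gamma>))"
        using pi by linarith
      moreover have "(L + \<sigma>) * D\<^sup>2 \<le> (1 / (2 * \<gamma>)) * D\<^sup>2" using Qs(2) big by (intro mult_right_mono) auto
      ultimately have "EN (n k) u + \<psi>r u \<le> EN (n k) (X k) + \<psi>r (X k) - \<sigma> * D\<^sup>2" by (simp add: distrib_right)
      moreover have "\<psi> u = ereal (\<psi>r u)" using ufin by (simp add: \<psi>r_def ereal_real)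
      ultimately show False using u(2) by (simp add: \<psi>_eq D_def)
    qed
  qed
qed


lemma sample_rate_tendsto_0: "sample_rate n \<longlonglongrightarrow> 0"
  by (rule summable_LIMSEQ_zero[OF rate_summable])

lemma EN_tendsto:
  assumes "strict_mono s"
  shows "(\<lambda>i. EN (n (s i)) y) \<longlonglongrightarrow> E y"
proof -
  obtain U C where UC: "open U" "y \<in> U" "\<forall>z\<in>U. \<forall>N\<ge>2. \<bar>EN N z - E z\<bar> \<le> C * (ln (real N) / sqrt (real N))"
    using local_rate[of y] by (elim exE conjE) rule
  have "(\<lambda>k. EN (n k) y - E y) \<longlonglongrightarrow> 0"
  proof (rule Lim_null_comparison)
    have "\<forall>\<^sub>F k in sequentially. 2 \<le> n k" using n_top by (simp add: filterlim_at_top)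
    then show "\<forall>\<^sub>F k in sequentially. norm (EN (n k) y - E y) \<le> C * sample_rate n k"
      by eventually_elim (use UC in \<open>auto simp: sample_rate_def\<close>)
    have "(\<lambda>k. C * sample_rate n k) \<longlonglongrightarrow> C * 0" by (intro tendsto_intros sample_rate_tendsto_0)
    then show "(\<lambda>k. C * sample_rate n k) \<longlonglongrightarrow> 0" by simp
  qed
  then have "(\<lambda>k. EN (n k) y) \<longlonglongrightarrow> E y" by (rule LIM_zero_cancel)
  from LIMSEQ_subseq_LIMSEQ[OF this assms] show ?thesis by (simp add: o_def)
qed

lemma EN_X_tendsto:
  assumes "strict_mono s" "(\<lambda>i. X (s i)) \<longlonglongrightarrow> x"
  shows "(\<lambda>i. EN (n (s i)) (X (s i))) \<longlonglongrightarrow> E x"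
proof -
  obtain C where C: "0 \<le> C" "\<And>y N. y \<in> closure (range X) \<Longrightarrow> 2 \<le> N \<Longrightarrow>
      \<bar>EN N y - E y\<bar> \<le> C * (ln (real N) / sqrt (real N))" by (rule uniform_rate_on_orbit) blast
  have "(\<lambda>k. EN (n k) (X k) - E (X k)) \<longlonglongrightarrow> 0"
  proof (rule Lim_null_comparison)
    have "\<forall>\<^sub>F k in sequentially. 2 \<le> n k" using n_top by (simp add: filterlim_at_top)
    then show "\<forall>\<^sub>F k in sequentially. norm (EN (n k) (X k) - E (X k)) \<le> C * sample_rate n k"
      by eventually_elim (use C(2) X_in_closure in \<open>auto simp: sample_rate_def\<close>)
    have "(\<lambda>k. C * sample_rate n k) \<longlonglongrightarrow> C * 0" by (intro tendsto_intros sample_rate_tendsto_0)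
    then show "(\<lambda>k. C * sample_rate n k) \<longlonglongrightarrow> 0" by simp
  qed
  from LIMSEQ_subseq_LIMSEQ[OF this assms(1)]
  have "(\<lambda>i. (EN (n (s i)) (X (s i)) - E (X (s i))) + E (X (s i))) \<longlonglongrightarrow> 0 + E x"
    by (intro tendsto_add isCont_tendsto_compose[OF E_cont assms(2)]) (simp add: o_def)
  then show ?thesis by simp
qed

text \<open>Since step lengths tend to 0, both \<open>X (s i)\<close> and its successor converge to \<open>xbar\<close> along a subsequence, on
  which the bounded directions may be assumed to converge to some \<open>w\<close>. Passing to the limit in the
  proximal inequality, with the stepsizes replaced by their lower bound \<open>\<gamma>l\<close>, yields the fixed-point
  relation for \<open>(w, \<gamma>l)\<close>; passing to the limit in the averaged quadratic upper bound makes \<open>w\<close> a Clarke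
  subgradient of \<open>E\<close>. Comparing with \<open>y = xbar\<close> in the same inequality gives convergence of the values.\<close>

lemma accumulation_point_properties:
  assumes "accumulation_point X xbar"
  shows "\<exists>w \<gamma>. w \<in> clarke_subdiff (\<lambda>y. ereal (E y)) xbar \<and> 0 < \<gamma> \<and> xbar \<in> prox \<gamma> \<psi> (xbar - \<gamma> *\<^sub>R w)"
    and "\<bar>\<psi> xbar\<bar> \<noteq> \<infinity>" and "\<Phi> \<longlonglongrightarrow> E xbar + \<psi>r xbar"
proof -
  obtain s0 where s0: "strict_mono s0" "(X \<circ> s0) \<longlonglongrightarrow> xbar"
    using assms by (auto simp: accumulation_point_def)
  obtain M where M: "0 \<le> M" "\<And>k. norm (v k) \<le> M" by (rule v_bounded) blast
  have "bounded (range (v \<circ> s0))" using M(2) by (auto simp: bounded_iff)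
  from bounded_imp_convergent_subsequence[OF this]
  obtain w s1 where s1: "strict_mono s1" "((v \<circ> s0) \<circ> s1) \<longlonglongrightarrow> w" by blast
  define s where "s = s0 \<circ> s1"
  have s: "strict_mono s" unfolding s_def using s0(1) s1(1) by (rule strict_mono_o)
  have X: "(\<lambda>i. X (s i)) \<longlonglongrightarrow> xbar"
    using LIMSEQ_subseq_LIMSEQ[OF s0(2) s1(1)] by (simp add: s_def o_def)
  have v: "(\<lambda>i. v (s i)) \<longlonglongrightarrow> w" using s1(2) by (simp add: s_def o_def)
  have \<Delta>: "(\<lambda>i. \<Delta> (s i)) \<longlonglongrightarrow> 0"
    using LIMSEQ_subseq_LIMSEQ[OF \<Delta>_tendsto_0 s] by (simp add: o_def)
  have X': "(\<lambda>i. X (Suc (s i))) \<longlonglongrightarrow> xbar"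
  proof -
    have "(\<lambda>i. X (Suc (s i)) - X (s i)) \<longlonglongrightarrow> 0"
      by (rule Lim_null_comparison[OF _ \<Delta>]) (simp add: \<Delta>_def)
    from tendsto_add[OF this X] show ?thesis by simp
  qed
  obtain r \<gamma>l where r: "0 < r" "0 < \<gamma>l" "\<And>k. X k \<in> ball xbar r \<Longrightarrow> \<gamma>l \<le> \<tau> k"
    by (rule stepsize_bounded_below[of xbar]) blast
  have near: "\<forall>\<^sub>F i in sequentially. X (s i) \<in> ball xbar r"
    using r(1) by (intro topological_tendstoD[OF X]) auto
  \<comment> \<open>Upper bound for \<open>\<psi>\<close> at the new iterate from the proximal inequality, without its quadratic term on the left.\<close>
  define b where "b y i = \<psi>r y + v (s i) \<bullet> (y - X (s i)) + (norm (y - X (s i)))\<^sup>2 / (2 * \<gamma>l) + M * \<Delta> (s i)" for y i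
  have prox_b: "\<forall>\<^sub>F i in sequentially. \<psi>r (X (Suc (s i))) \<le> b y i" if y: "\<bar>\<psi> y\<bar> \<noteq> \<infinity>" for y
    using near
  proof eventually_elim
    case (elim i)
    let ?x = "X (s i)" and ?u = "X (Suc (s i))"
    have "\<psi>r ?u + v (s i) \<bullet> (?u - ?x) + (norm (?u - ?x))\<^sup>2 / (2 * \<tau> (s i))
        \<le> \<psi>r y + v (s i) \<bullet> (y - ?x) + (norm (y - ?x))\<^sup>2 / (2 * \<tau> (s i))"
      unfolding \<psi>r_def by (rule prox_real_ineq[OF proper \<tau>_pos step_prox y])
    moreover have "0 \<le> (norm (?u - ?x))\<^sup>2 / (2 * \<tau> (s i))" using \<tau>_pos[of "s i"] by simp
    moreover have "(norm (y - ?x))\<^sup>2 / (2 * \<tau> (s i)) \<le> (norm (y - ?x))\<^sup>2 / (2 * \<gamma>l)"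
      using r(2) r(3)[OF elim] by (intro divide_left_mono) auto
    moreover have "- (M * \<Delta> (s i)) \<le> v (s i) \<bullet> (?u - ?x)"
      using Cauchy_Schwarz_ineq2[of "v (s i)" "?u - ?x"] mult_right_mono[OF M(2)[of "s i"], of "\<Delta> (s i)"]
      by (simp add: \<Delta>_def)
    ultimately show ?case unfolding b_def by linarith
  qed
  have b_lim: "b y \<longlonglongrightarrow> \<psi>r y + w \<bullet> (y - xbar) + (norm (y - xbar))\<^sup>2 / (2 * \<gamma>l)" for y
  proof -
    have "b y \<longlonglongrightarrow> \<psi>r y + w \<bullet> (y - xbar) + (norm (y - xbar))\<^sup>2 / (2 * \<gamma>l) + M * 0"
      unfolding b_def[abs_def] by (intro tendsto_intros v X \<Delta>) (use r in auto)
    then show ?thesis by simp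
  qed
  show fin: "\<bar>\<psi> xbar\<bar> \<noteq> \<infinity>"
  proof -
    obtain B where B: "\<And>k. \<psi>r (X k) \<le> B" by (rule \<psi>_bounded_above) blast
    have "\<psi> xbar \<le> ereal B"
      by (rule lsc_sequential_bound[OF lsc X, of "\<lambda>_. B"]) (use B in \<open>auto simp: \<psi>_eq\<close>)
    then show ?thesis using \<psi>_not_minf[of xbar] by auto
  qed
  have \<psi>bar: "\<psi> xbar = ereal (\<psi>r xbar)" using fin by (simp add: \<psi>r_def ereal_real)
  have "xbar \<in> prox \<gamma>l \<psi> (xbar - \<gamma>l *\<^sub>R w)"
    unfolding prox_iff[OF r(2)]
  proof
    fix y
    show "\<psi> xbar + ereal (w \<bullet> (xbar - xbar) + (norm (xbar - xbar))\<^sup>2 / (2 * \<gamma>l))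
       \<le> \<psi> y + ereal (w \<bullet> (y - xbar) + (norm (y - xbar))\<^sup>2 / (2 * \<gamma>l))"
    proof (cases "\<bar>\<psi> y\<bar> = \<infinity>")
      case True
      then show ?thesis using \<psi>_not_minf[of y] by auto
    next
      case False
      have "\<psi> xbar \<le> ereal (\<psi>r y + w \<bullet> (y - xbar) + (norm (y - xbar))\<^sup>2 / (2 * \<gamma>l))"
        by (rule lsc_sequential_bound[OF lsc X' _ b_lim]) (use prox_b[OF False] in \<open>simp add: \<psi>_eq\<close>)
      moreover have "\<psi> y = ereal (\<psi>r y)" using False by (simp add: \<psi>r_def ereal_real)
      ultimately show ?thesis by (simp add: \<psi>bar add.assoc)
    qed
  qed
  moreover have "w \<in> clarke_subdiff (\<lambda>y. ereal (E y)) xbar"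
  proof -
    obtain U L where U: "open U" "xbar \<in> U" and up: "\<forall>N\<ge>1. \<forall>y\<in>U. \<forall>z\<in>U. \<forall>v\<in>G N y.
        EN N z \<le> EN N y + v \<bullet> (z - y) + L * (norm (z - y))\<^sup>2" using local_upper[of xbar] by (elim exE conjE) rule
    obtain V k where V: "open V" "xbar \<in> V" and lip: "\<forall>y\<in>V. \<forall>z\<in>V. \<bar>E y - E z\<bar> \<le> k * norm (y - z)"
      using local_lipschitz[of xbar] by (elim exE conjE) rule
    show ?thesis
    proof (rule quadratic_supergradient_in_clarke_subdiff[of "U \<inter> V"])
      show "E y \<le> E xbar + w \<bullet> (y - xbar) + L * (norm (y - xbar))\<^sup>2" if y: "y \<in> U \<inter> V" for y
      proof (rule tendsto_le[OF _ _ EN_tendsto[OF s]])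
        show "(\<lambda>i. EN (n (s i)) (X (s i)) + v (s i) \<bullet> (y - X (s i)) + L * (norm (y - X (s i)))\<^sup>2)
          \<longlonglongrightarrow> E xbar + w \<bullet> (y - xbar) + L * (norm (y - xbar))\<^sup>2"
          by (intro tendsto_intros EN_X_tendsto[OF s X] v X)
        have "\<forall>\<^sub>F i in sequentially. X (s i) \<in> U" by (rule topological_tendstoD[OF X U])
        then show "\<forall>\<^sub>F i in sequentially. EN (n (s i)) y
          \<le> EN (n (s i)) (X (s i)) + v (s i) \<bullet> (y - X (s i)) + L * (norm (y - X (s i)))\<^sup>2"
          by eventually_elim (use up v_in n_pos y in \<open>simp add: Suc_le_eq\<close>)
      qed simp
      show "\<bar>E y - E z\<bar> \<le> k * norm (y - z)" if "y \<in> U \<inter> V" "z \<in> U \<inter> V" for y z using lip that by blast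
    qed (use U V in auto)
  qed
  ultimately show "\<exists>w \<gamma>. w \<in> clarke_subdiff (\<lambda>y. ereal (E y)) xbar \<and> 0 < \<gamma> \<and> xbar \<in> prox \<gamma> \<psi> (xbar - \<gamma> *\<^sub>R w)"
    using r(2) by blast
  obtain l where l: "\<Phi> \<longlonglongrightarrow> l" using \<Phi>_convergent by (auto simp: convergent_def)
  have "strict_mono (Suc \<circ> s)" using s by (auto simp: strict_mono_def)
  from LIMSEQ_subseq_LIMSEQ[OF l this] have l': "(\<lambda>i. \<Phi> (Suc (s i))) \<longlonglongrightarrow> l" by (simp add: o_def)
  have \<psi>lim: "(\<lambda>i. \<psi>r (X (Suc (s i)))) \<longlonglongrightarrow> l - E xbar"
    using tendsto_diff[OF l' isCont_tendsto_compose[OF E_cont X']] by (simp add: \<Phi>_def)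
  have "l - E xbar \<le> \<psi>r xbar"
    using tendsto_le[OF _ b_lim \<psi>lim prox_b[OF fin]] by simp
  moreover have "\<psi> xbar \<le> ereal (l - E xbar)"
    by (rule lsc_sequential_bound[OF lsc X' _ \<psi>lim]) (simp add: \<psi>_eq)
  ultimately have "l = E xbar + \<psi>r xbar" by (simp add: \<psi>bar)
  with l show "\<Phi> \<longlonglongrightarrow> E xbar + \<psi>r xbar" by simp
qed

text \<open>At a stationary point \<open>E\<close> is smooth with gradient \<open>g\<close>, so the optimality of the proximal step
  produces the proximal subgradient \<open>q = g u - v k - (u - x) / \<tau> k\<close> of the objective at the new iterate \<open>u\<close>.
  Its norm is bounded by the step length plus the sampling error of the gradient, which is the relative error
  condition of \<open>KL_convergence\<close>.\<close>

theorem KL_implies_convergence: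
  fixes xbar :: 'a and \<eta> :: real and \<theta> :: "real \<Rightarrow> real" and p0 :: nat
  defines "obj \<equiv> (\<lambda>y. ereal (E y) + \<psi> y)"
  assumes acc: "accumulation_point X xbar" and KL: "KL_condition obj xbar \<eta> \<theta>"
    and qa: "quasi_additive \<eta> \<theta>"
    and tail: "\<forall>k\<ge>p0. (\<Sum>t. sample_rate n (k + t)) \<in> {0<..<\<eta>}"
    and summ: "summable (\<lambda>k. inverse (deriv \<theta> (\<Sum>t. sample_rate n (p0 + k + t))))"
    and above: "\<forall>k\<ge>p0. obj (X k) > obj xbar"
  shows "X \<longlonglongrightarrow> xbar"
proof -
  note acc_props = accumulation_point_properties[OF acc]
  obtain w \<gamma> where w: "w \<in> clarke_subdiff (\<lambda>y. ereal (E y)) xbar" "0 < \<gamma>" "xbar \<in> prox \<gamma> \<psi> (xbar - \<gamma> *\<^sub>R w)"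
    using acc_props(1) by (elim exE conjE)
  obtain U g L C where U: "open U" "xbar \<in> U"
    and smooth: "\<forall>y\<in>U. \<forall>z\<in>U. \<bar>E z - E y - g y \<bullet> (z - y)\<bar> \<le> L * (norm (z - y))\<^sup>2 \<and> norm (g y - g z) \<le> L * norm (y - z)"
    and grad: "\<forall>y\<in>U. \<forall>N\<ge>2. \<forall>v\<in>G N y. norm (v - g y) \<le> C * (ln (real N) / sqrt (real N))"
    using local_smooth[OF w] by (elim exE conjE) rule
  obtain e where e: "0 < e" "ball xbar e \<subseteq> U" using U openE by blast
  obtain r0 \<gamma>l where r0: "0 < r0" "0 < \<gamma>l" "\<And>k. X k \<in> ball xbar r0 \<Longrightarrow> \<gamma>l \<le> \<tau> k"
    by (rule stepsize_bounded_below[of xbar]) blast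
  obtain c k0 where ck: "0 \<le> c" "\<And>k. k0 \<le> k \<Longrightarrow> 2 \<le> n k"
    "\<And>k. k0 \<le> k \<Longrightarrow> \<Phi> (Suc k) \<le> \<Phi> k - \<sigma> * (\<Delta> k)\<^sup>2 + c * sample_rate n k"
    by (rule expected_descent) blast
  have \<eta>: "0 < \<eta>" and d: "desingularizing \<eta> \<theta>"
    and KL': "\<And>y. y \<in> ball xbar \<eta> \<Longrightarrow> obj xbar < obj y \<Longrightarrow> obj y < obj xbar + ereal \<eta> \<Longrightarrow>
       1 \<le> ereal (deriv \<theta> (real_of_ereal (obj y - obj xbar))) * edist_set 0 (clarke_subdiff obj y)"
    using KL by (auto simp: KL_condition_def)
  define \<Phi>bar where "\<Phi>bar = E xbar + \<psi>r xbar"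
  have obj_bar: "obj xbar = ereal \<Phi>bar"
    using acc_props(2) by (simp add: obj_def \<Phi>bar_def \<psi>r_def ereal_real flip: plus_ereal.simps(1))
  have obj_X: "obj (X k) = ereal (\<Phi> k)" for k by (simp add: obj_def \<Phi>_def \<psi>_eq)
  define \<delta> where "\<delta> k = \<Phi> k - \<Phi>bar" for k
  define p where "p = max p0 k0"
  define r where "r = min (min e r0) \<eta>"
  define B where "B = \<bar>L\<bar> + \<bar>C\<bar> + 1 / \<gamma>l"
  have B: "0 \<le> B" using r0(2) by (simp add: B_def)
  have \<delta>pos: "0 < \<delta> k" if "p \<le> k" for k
    using above that by (simp add: p_def \<delta>_def obj_X obj_bar)
  show ?thesis
  proof (rule KL_convergence[OF d qa rate_nonneg rate_summable])
    show "(\<Sum>t. sample_rate n (k + t)) \<in> {0<..<\<eta>}" if "p \<le> k" for k using tail that by (simp add: p_def)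
    show "summable (\<lambda>k. inverse (deriv \<theta> (\<Sum>t. sample_rate n (p + k + t))))"
      using summable_ignore_initial_segment[OF summ, of "p - p0"] by (simp add: p_def algebra_simps)
    show "0 < \<delta> k" if "p \<le> k" for k by (rule \<delta>pos[OF that])
    show "\<delta> \<longlonglongrightarrow> 0"
      using tendsto_diff[OF acc_props(3) tendsto_const[of \<Phi>bar]] by (simp add: \<delta>_def[abs_def] \<Phi>bar_def)
    show "\<delta> (Suc k) \<le> \<delta> k - \<sigma> * (norm (X (Suc k) - X k))\<^sup>2 + c * sample_rate n k" if "p \<le> k" for k
      using ck(3)[of k] that by (simp add: \<delta>_def \<Delta>_def p_def)
    show "0 < \<sigma>" by (rule \<sigma>)
    show "0 < r" using e(1) r0(1) \<eta> by (simp add: r_def)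
    show "0 \<le> B" by (rule B)
    show "\<exists>k\<ge>m. dist (X k) xbar < e" if e': "0 < e" for e m
    proof -
      obtain s where s: "strict_mono s" "(X \<circ> s) \<longlonglongrightarrow> xbar" using acc by (auto simp: accumulation_point_def)
      obtain i0 where "\<And>i. i0 \<le> i \<Longrightarrow> dist (X (s i)) xbar < e"
        using metric_LIMSEQ_D[OF s(2) e'] by auto
      then have "dist (X (s (max m i0))) xbar < e" by simp
      moreover have "m \<le> s (max m i0)" using strict_mono_imp_increasing[OF s(1), of "max m i0"] by simp
      ultimately show ?thesis by blast
    qed
    fix k assume k: "p \<le> k" and near: "X k \<in> ball xbar r" "X (Suc k) \<in> ball xbar r" and \<delta>\<eta>: "\<delta> (Suc k) < \<eta>"
    define x where "x = X k"
    define u where "u = X (Suc k)"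
    have xu: "x \<in> U" "u \<in> U" using near e(2) by (auto simp: r_def x_def u_def)
    have \<tau>l: "\<gamma>l \<le> \<tau> k" by (rule r0(3)) (use near in \<open>auto simp: r_def\<close>)
    define q where "q = g u - v k - (1 / \<tau> k) *\<^sub>R (u - x)"
    have q_sub: "q \<in> clarke_subdiff obj u"
    proof (rule proximal_subgradient_in_clarke_subdiff[where L = "L + 1 / (2 * \<tau> k)", OF _ U(1) xu(2)])
      show "\<bar>obj u\<bar> \<noteq> \<infinity>" by (simp add: u_def obj_X)
      fix y assume y: "y \<in> U"
      show "ereal (real_of_ereal (obj u) + q \<bullet> (y - u) - (L + 1 / (2 * \<tau> k)) * (norm (y - u))\<^sup>2) \<le> obj y"
      proof (cases "\<bar>\<psi> y\<bar> = \<infinity>")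
        case True
        then show ?thesis using \<psi>_not_minf[of y] by (auto simp: obj_def)
      next
        case False
        then have \<psi>y: "\<psi> y = ereal (\<psi>r y)" by (simp add: \<psi>r_def ereal_real)
        have "\<psi>r u + v k \<bullet> (u - x) + (norm (u - x))\<^sup>2 / (2 * \<tau> k) \<le> \<psi>r y + v k \<bullet> (y - x) + (norm (y - x))\<^sup>2 / (2 * \<tau> k)"
          unfolding \<psi>r_def x_def u_def by (rule prox_real_ineq[OF proper \<tau>_pos step_prox False])
        moreover have "v k \<bullet> (y - x) = v k \<bullet> (u - x) + v k \<bullet> (y - u)" by (simp add: inner_diff_right)
        moreover have "(norm (y - x))\<^sup>2 / (2 * \<tau> k) = (norm (u - x))\<^sup>2 / (2 * \<tau> k) + ((1 / \<tau> k) *\<^sub>R (u - x)) \<bullet> (y - u)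
            + 1 / (2 * \<tau> k) * (norm (y - u))\<^sup>2"
        proof -
          have "y - x = (u - x) + (y - u)" by simp
          then have "(norm (y - x))\<^sup>2 = (norm ((u - x) + (y - u)))\<^sup>2" by (rule arg_cong)
          also have "\<dots> = (norm (u - x))\<^sup>2 + 2 * ((u - x) \<bullet> (y - u)) + (norm (y - u))\<^sup>2"
            unfolding power2_norm_eq_inner inner_add_left inner_add_right using inner_commute[of "u - x" "y - u"] by linarith
          finally have "(norm (y - x))\<^sup>2 / (2 * \<tau> k)
            = ((norm (u - x))\<^sup>2 + 2 * ((u - x) \<bullet> (y - u)) + (norm (y - u))\<^sup>2) / (2 * \<tau> k)" by (rule arg_cong)
          then show ?thesis unfolding inner_scaleR_left by (simp add: add_divide_distrib)
        qed
        moreover have "E u + g u \<bullet> (y - u) - L * (norm (y - u))\<^sup>2 \<le> E y"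
          using smooth[rule_format, OF xu(2) y] by (simp add: abs_le_iff)
        ultimately have "E u + \<psi>r u + (g u \<bullet> (y - u) - v k \<bullet> (y - u) - ((1 / \<tau> k) *\<^sub>R (u - x)) \<bullet> (y - u))
            - (L * (norm (y - u))\<^sup>2 + 1 / (2 * \<tau> k) * (norm (y - u))\<^sup>2) \<le> E y + \<psi>r y" by linarith
        moreover have "real_of_ereal (obj u) = E u + \<psi>r u" by (simp add: u_def obj_X \<Phi>_def)
        moreover have "obj y = ereal (E y + \<psi>r y)" by (simp add: obj_def \<psi>y)
        ultimately show ?thesis by (simp add: q_def inner_diff_left distrib_right)
      qed
    qed
    have q_norm: "norm q \<le> B * (\<Delta> k + sample_rate n k)"
    proof -
      have "q = (g u - g x) - (v k - g x) - (1 / \<tau> k) *\<^sub>R (u - x)" by (simp add: q_def)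
      then have "norm q \<le> norm (g u - g x) + norm (v k - g x) + norm ((1 / \<tau> k) *\<^sub>R (u - x))"
        using norm_triangle_ineq4[of "(g u - g x) - (v k - g x)" "(1 / \<tau> k) *\<^sub>R (u - x)"]
          norm_triangle_ineq4[of "g u - g x" "v k - g x"] by (simp only:)
      moreover have "norm (g u - g x) \<le> \<bar>L\<bar> * \<Delta> k"
      proof -
        have "norm (g u - g x) \<le> L * norm (u - x)" using smooth xu by blast
        also have "\<dots> \<le> \<bar>L\<bar> * norm (u - x)" by (intro mult_right_mono) auto
        finally show ?thesis by (simp add: \<Delta>_def u_def x_def)
      qed
      moreover have "norm (v k - g x) \<le> \<bar>C\<bar> * sample_rate n k"
      proof -
        have "norm (v k - g x) \<le> C * sample_rate n k"
          unfolding sample_rate_def using grad xu(1) ck(2)[of k] k v_in[of k] by (simp add: p_def x_def)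
        also have "\<dots> \<le> \<bar>C\<bar> * sample_rate n k" by (intro mult_right_mono rate_nonneg) auto
        finally show ?thesis .
      qed
      moreover have "norm ((1 / \<tau> k) *\<^sub>R (u - x)) \<le> 1 / \<gamma>l * \<Delta> k"
      proof -
        have "1 / \<tau> k \<le> 1 / \<gamma>l" using r0(2) \<tau>l by (intro divide_left_mono) auto
        then have "1 / \<tau> k * norm (u - x) \<le> 1 / \<gamma>l * norm (u - x)" by (intro mult_right_mono) auto
        then show ?thesis using \<tau>_pos[of k] by (simp add: \<Delta>_def u_def x_def)
      qed
      moreover have "0 \<le> \<bar>C\<bar> * \<Delta> k" "0 \<le> (\<bar>L\<bar> + 1 / \<gamma>l) * sample_rate n k"
        using rate_nonneg[of k] r0(2) by (auto simp: \<Delta>_def intro!: mult_nonneg_nonneg add_nonneg_nonneg)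
      ultimately show ?thesis unfolding B_def distrib_left distrib_right by linarith
    qed
    have "1 \<le> ereal (deriv \<theta> (\<delta> (Suc k))) * edist_set 0 (clarke_subdiff obj u)"
    proof -
      have "u \<in> ball xbar \<eta>" using near by (simp add: u_def r_def)
      moreover have "obj xbar < obj u" "obj u < obj xbar + ereal \<eta>"
        using \<delta>pos[of "Suc k"] \<delta>\<eta> k by (auto simp: u_def obj_X obj_bar \<delta>_def)
      moreover have "real_of_ereal (obj u - obj xbar) = \<delta> (Suc k)" by (simp add: u_def obj_X obj_bar \<delta>_def)
      ultimately show ?thesis using KL'[of u] by simp
    qed
    also have "\<dots> \<le> ereal (deriv \<theta> (\<delta> (Suc k))) * ereal (norm q)"
    proof (rule ereal_mult_left_mono)
      show "edist_set 0 (clarke_subdiff obj u) \<le> ereal (norm q)"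
        unfolding edist_set_def by (rule INF_lower2[OF q_sub]) (simp add: dist_norm)
      show "0 \<le> ereal (deriv \<theta> (\<delta> (Suc k)))"
        using d \<delta>pos[of "Suc k"] \<delta>\<eta> k by (auto simp: desingularizing_def intro: less_imp_le)
    qed
    finally have "1 \<le> deriv \<theta> (\<delta> (Suc k)) * norm q" by (simp add: one_ereal_def)
    also have "\<dots> \<le> deriv \<theta> (\<delta> (Suc k)) * (B * (\<Delta> k + sample_rate n k))"
      using d \<delta>pos[of "Suc k"] \<delta>\<eta> k by (intro mult_left_mono[OF q_norm]) (auto simp: desingularizing_def intro: less_imp_le)
    finally show "1 \<le> deriv \<theta> (\<delta> (Suc k)) * (B * (norm (X (Suc k) - X k) + sample_rate n k))"
      by (simp add: \<Delta>_def)
  qed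
qed

end

section \<open>Almost sure local estimates for the integrand\<close>

lemma square_integrable_add:
  fixes f g :: "'xi \<Rightarrow> real"
  assumes "square_integrable \<mu> f" "square_integrable \<mu> g"
  shows "square_integrable \<mu> (\<lambda>z. f z + g z)"
proof -
  have [measurable]: "f \<in> borel_measurable \<mu>" "g \<in> borel_measurable \<mu>"
    and int: "integrable \<mu> (\<lambda>z. (f z)\<^sup>2)" "integrable \<mu> (\<lambda>z. (g z)\<^sup>2)"
    using assms by (auto simp: square_integrable_def)
  have dom: "integrable \<mu> (\<lambda>z. 2 * (f z)\<^sup>2 + 2 * (g z)\<^sup>2)" using int by auto
  have le: "(f z + g z)\<^sup>2 \<le> 2 * (f z)\<^sup>2 + 2 * (g z)\<^sup>2" for z
    using zero_le_power2[of "f z - g z"] by (simp add: power2_eq_square algebra_simps)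
  have "integrable \<mu> (\<lambda>z. (f z + g z)\<^sup>2)"
  proof (rule Bochner_Integration.integrable_bound[OF dom])
    show "AE z in \<mu>. norm ((f z + g z)\<^sup>2) \<le> norm (2 * (f z)\<^sup>2 + 2 * (g z)\<^sup>2)"
      using le by simp
  qed simp
  then show ?thesis by (simp add: square_integrable_def)
qed

lemma square_integrable_cmult:
  fixes f :: "'xi \<Rightarrow> real"
  assumes "square_integrable \<mu> f"
  shows "square_integrable \<mu> (\<lambda>z. c * f z)"
  unfolding square_integrable_def
proof
  have [measurable]: "f \<in> borel_measurable \<mu>" using assms by (simp add: square_integrable_def)
  show "(\<lambda>z. c * f z) \<in> borel_measurable \<mu>" by measurable
  have "integrable \<mu> (\<lambda>z. c\<^sup>2 * (norm (f z))\<^sup>2)" using assms by (simp add: square_integrable_def)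
  then show "integrable \<mu> (\<lambda>z. (norm (c * f z))\<^sup>2)" by (simp add: power_mult_distrib)
qed

lemma square_integrable_norm:
  assumes "square_integrable \<mu> f"
  shows "square_integrable \<mu> (\<lambda>z. norm (f z))"
proof -
  have [measurable]: "f \<in> borel_measurable \<mu>" using assms by (simp add: square_integrable_def)
  have "(\<lambda>z. norm (f z)) \<in> borel_measurable \<mu>" by measurable
  with assms show ?thesis by (simp add: square_integrable_def)
qed

text \<open>The search directions among which the algorithm chooses; they form a set because each integrand may have
  several Clarke subgradients at a point.\<close>

definition sampled_subgradients ::
    "('xi \<Rightarrow> 'a::euclidean_space \<Rightarrow> real) \<Rightarrow> (nat \<Rightarrow> 'xi) \<Rightarrow> nat \<Rightarrow> 'a \<Rightarrow> 'a set"
  where "sampled_subgradients \<phi> s N y =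
    {(1 / real N) *\<^sub>R (\<Sum>i=1..N. v i) | v. \<forall>i\<in>{1..N}. v i \<in> clarke_subdiff (\<lambda>y. ereal (\<phi> (s i) y)) y}"

lemma sampled_subgradientsE:
  assumes "v \<in> sampled_subgradients \<phi> s N y"
  obtains V where "v = (1 / real N) *\<^sub>R (\<Sum>i=1..N. V i)"
    "\<And>i. i \<in> {1..N} \<Longrightarrow> V i \<in> clarke_subdiff (\<lambda>y. ereal (\<phi> (s i) y)) y"
proof -
  from assms obtain V where "v = (1 / real N) *\<^sub>R (\<Sum>i=1..N. V i)"
    "\<forall>i\<in>{1..N}. V i \<in> clarke_subdiff (\<lambda>y. ereal (\<phi> (s i) y)) y"
    unfolding sampled_subgradients_def mem_Collect_eq by (elim exE conjE) rule
  then show ?thesis by (intro that[of V]) simp_all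
qed

context iid_sampling
begin

lemma square_integrable_imp_integrable:
  fixes g :: "'xi \<Rightarrow> real"
  assumes "square_integrable \<mu> g"
  shows "integrable \<mu> g"
  by (rule integrable_of_square) (use assms in \<open>simp_all add: square_integrable_def\<close>)

lemma expected_lipschitz:
  fixes \<phi> :: "'xi \<Rightarrow> 'a::euclidean_space \<Rightarrow> real"
  assumes "\<And>y. loc_lipschitz_L2 \<mu> \<phi> y"
  shows "\<exists>U k. open U \<and> x \<in> U \<and> (\<forall>y\<in>U. \<forall>z\<in>U. \<bar>expected \<mu> \<phi> y - expected \<mu> \<phi> z\<bar> \<le> k * norm (y - z))"
proof -
  have sq: "square_integrable \<mu> (\<lambda>z. \<phi> z y)" for y using assms[of y] by (auto simp: loc_lipschitz_L2_def)
  have int: "integrable \<mu> (\<lambda>z. \<phi> z y)" for y by (rule square_integrable_imp_integrable[OF sq])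
  obtain \<kappa> V where \<kappa>: "square_integrable \<mu> (\<kappa> :: 'xi \<Rightarrow> real)" and V: "open V" "x \<in> V"
    and lip: "\<forall>z\<in>space \<mu>. \<forall>y\<in>V. \<forall>y'\<in>V. \<bar>\<phi> z y - \<phi> z y'\<bar> \<le> \<kappa> z * norm (y - y')"
    using assms[of x] unfolding loc_lipschitz_L2_def by (elim exE conjE) rule
  have i\<kappa>: "integrable \<mu> \<kappa>" by (rule square_integrable_imp_integrable[OF \<kappa>])
  have "\<bar>expected \<mu> \<phi> y - expected \<mu> \<phi> y'\<bar> \<le> integral\<^sup>L \<mu> \<kappa> * norm (y - y')" if "y \<in> V" "y' \<in> V" for y y'
  proof -
    have "\<bar>\<integral>z. \<phi> z y - \<phi> z y' \<partial>\<mu>\<bar> \<le> (\<integral>z. \<kappa> z * norm (y - y') \<partial>\<mu>)"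
      by (rule order_trans[OF integral_abs_bound integral_mono]) (use int i\<kappa> lip that in auto)
    then show ?thesis using int i\<kappa> by (simp add: expected_def)
  qed
  with V show ?thesis by blast
qed

text \<open>On a small ball both the values and the Lipschitz modulus of the integrand are dominated by one
  square integrable function \<open>h\<close>, as \<open>uniform_rate\<close> requires.\<close>

lemma local_value_rate:
  fixes \<phi> :: "'xi \<Rightarrow> 'a::euclidean_space \<Rightarrow> real"
  assumes lip2: "\<And>y. loc_lipschitz_L2 \<mu> \<phi> y"
  shows "AE \<omega> in P. \<forall>x. \<exists>U C. open U \<and> x \<in> U \<and> (\<forall>y\<in>U. \<forall>N\<ge>2.
    \<bar>empirical \<phi> (\<lambda>i. \<xi> i \<omega>) N y - expected \<mu> \<phi> y\<bar> \<le> C * (ln (real N) / sqrt (real N)))"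
proof -
  have sq: "square_integrable \<mu> (\<lambda>z. \<phi> z y)" for y using lip2[of y] by (auto simp: loc_lipschitz_L2_def)
  have "AE \<omega> in P. \<forall>x\<in>UNIV. \<exists>U C. open U \<and> x \<in> U \<and> (\<forall>y\<in>U. \<forall>N\<ge>2.
    \<bar>empirical \<phi> (\<lambda>i. \<xi> i \<omega>) N y - expected \<mu> \<phi> y\<bar> \<le> C * (ln (real N) / sqrt (real N)))"
  proof (rule AE_local_constant[where Q = "\<lambda>U C \<omega>. \<forall>y\<in>U. \<forall>N\<ge>2.
    \<bar>empirical \<phi> (\<lambda>i. \<xi> i \<omega>) N y - expected \<mu> \<phi> y\<bar> \<le> C * (ln (real N) / sqrt (real N))"])
    fix x :: 'a
    obtain \<kappa> V where \<kappa>: "square_integrable \<mu> (\<kappa> :: 'xi \<Rightarrow> real)" and V: "open V" "x \<in> V"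
      and lip: "\<forall>z\<in>space \<mu>. \<forall>y\<in>V. \<forall>y'\<in>V. \<bar>\<phi> z y - \<phi> z y'\<bar> \<le> \<kappa> z * norm (y - y')"
      using lip2[of x] unfolding loc_lipschitz_L2_def by (elim exE conjE) rule
    obtain e where e: "0 < e" "ball x e \<subseteq> V" using V openE by blast
    define h where "h z = norm (\<phi> z x) + (e + 1) * norm (\<kappa> z)" for z
    have h: "square_integrable \<mu> h" unfolding h_def
      by (intro square_integrable_add square_integrable_cmult square_integrable_norm sq \<kappa>)
    have "AE \<omega> in P. \<exists>C. \<forall>y\<in>ball x e. \<forall>N\<ge>2.
      \<bar>(\<Sum>j=1..N. \<phi> (\<xi> j \<omega>) y) / real N - (\<integral>z. \<phi> z y \<partial>\<mu>)\<bar> \<le> C * (ln (real N) / sqrt (real N))"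
    proof (rule uniform_rate)
      show "h \<in> borel_measurable \<mu>" "integrable \<mu> (\<lambda>z. (h z)\<^sup>2)" using h by (auto simp: square_integrable_def)
      show "(\<lambda>z. \<phi> z y) \<in> borel_measurable \<mu>" for y using sq by (auto simp: square_integrable_def)
      have \<kappa>le: "\<kappa> z * d \<le> h z * d" if "0 \<le> d" for z d
      proof (rule mult_right_mono[OF _ that])
        have "\<kappa> z \<le> 1 * norm (\<kappa> z)" by simp
        also have "\<dots> \<le> (e + 1) * norm (\<kappa> z)" using e by (intro mult_right_mono) auto
        finally show "\<kappa> z \<le> h z" by (simp add: h_def)
      qed
      show "\<bar>\<phi> z y - \<phi> z y'\<bar> \<le> h z * norm (y - y')"
        if "z \<in> space \<mu>" "y \<in> ball x e" "y' \<in> ball x e" for z y y'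
      proof (rule order_trans[OF _ \<kappa>le])
        show "\<bar>\<phi> z y - \<phi> z y'\<bar> \<le> \<kappa> z * norm (y - y')"
          by (rule lip[rule_format]) (use that e in auto)
      qed simp
      show "\<bar>\<phi> z y\<bar> \<le> h z" if "z \<in> space \<mu>" "y \<in> ball x e" for z y
      proof -
        have "\<bar>\<phi> z y - \<phi> z x\<bar> \<le> \<kappa> z * norm (y - x)" 
          by (rule lip[rule_format]) (use that e V in auto)
        also have "\<dots> \<le> norm (\<kappa> z) * (e + 1)"
          using that by (intro mult_mono) (auto simp: dist_norm norm_minus_commute)
        finally show ?thesis by (simp add: h_def mult.commute)
      qed
    qed auto
    then show "\<exists>U. open U \<and> x \<in> U \<and> (AE \<omega> in P. \<exists>C. \<forall>y\<in>U. \<forall>N\<ge>2.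
      \<bar>empirical \<phi> (\<lambda>i. \<xi> i \<omega>) N y - expected \<mu> \<phi> y\<bar> \<le> C * (ln (real N) / sqrt (real N)))"
      using e(1) by (intro exI[of _ "ball x e"]) (simp add: empirical_def expected_def)
  qed
  then show ?thesis unfolding ball_UNIV .
qed

lemma local_subgradient_bound:
  fixes \<phi> :: "'xi \<Rightarrow> 'a::euclidean_space \<Rightarrow> real"
  assumes lip2: "\<And>y. loc_lipschitz_L2 \<mu> \<phi> y"
  shows "AE \<omega> in P. \<forall>x. \<exists>U M. open U \<and> x \<in> U \<and>
    (\<forall>y\<in>U. \<forall>N\<ge>1. \<forall>v\<in>sampled_subgradients \<phi> (\<lambda>i. \<xi> i \<omega>) N y. norm v \<le> M)"
proof -
  have "AE \<omega> in P. \<forall>x\<in>UNIV. \<exists>U M. open U \<and> x \<in> U \<and> (\<forall>y\<in>U. \<forall>N\<ge>1.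
    \<forall>v\<in>sampled_subgradients \<phi> (\<lambda>i. \<xi> i \<omega>) N y. norm v \<le> M)"
  proof (rule AE_local_constant[where Q = "\<lambda>U M \<omega>. \<forall>y\<in>U. \<forall>N\<ge>1. \<forall>v\<in>sampled_subgradients \<phi> (\<lambda>i. \<xi> i \<omega>) N y. norm v \<le> M"])
    fix x :: 'a
    obtain \<kappa> V where \<kappa>: "square_integrable \<mu> (\<kappa> :: 'xi \<Rightarrow> real)" and V: "open V" "x \<in> V"
      and lip: "\<forall>z\<in>space \<mu>. \<forall>y\<in>V. \<forall>y'\<in>V. \<bar>\<phi> z y - \<phi> z y'\<bar> \<le> \<kappa> z * norm (y - y')"
      using lip2[of x] unfolding loc_lipschitz_L2_def by (elim exE conjE) rule
    have "AE \<omega> in P. \<exists>M. \<forall>N. (\<Sum>j=1..N. \<bar>\<kappa> (\<xi> j \<omega>)\<bar>) \<le> M * real N"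
      by (rule bounded_averages) (use square_integrable_imp_integrable[OF \<kappa>] in auto)
    with AE_space have "AE \<omega> in P. \<exists>M. \<forall>y\<in>V. \<forall>N\<ge>1.
      \<forall>v\<in>sampled_subgradients \<phi> (\<lambda>i. \<xi> i \<omega>) N y. norm v \<le> M"
    proof eventually_elim
      case (elim \<omega>)
      then obtain M where M: "\<And>N. (\<Sum>j=1..N. \<bar>\<kappa> (\<xi> j \<omega>)\<bar>) \<le> M * real N" by blast
      have *: "norm v \<le> M" if y: "y \<in> V" and N: "1 \<le> N" and v: "v \<in> sampled_subgradients \<phi> (\<lambda>i. \<xi> i \<omega>) N y" for y N v
      proof -
        obtain V' where V': "v = (1 / real N) *\<^sub>R (\<Sum>i=1..N. V' i)"
          "\<And>i. i \<in> {1..N} \<Longrightarrow> V' i \<in> clarke_subdiff (\<lambda>y. ereal (\<phi> (\<xi> i \<omega>) y)) y"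
          by (rule sampled_subgradientsE[OF v]) blast
        have "norm (V' i) \<le> \<bar>\<kappa> (\<xi> i \<omega>)\<bar>" if i: "i \<in> {1..N}" for i
          by (rule clarke_subdiff_lipschitz_bound[OF V(1) y V'(2)[OF i]])
             (use lip sample_in_space elim i in auto)
        then have "norm (\<Sum>i=1..N. V' i) \<le> (\<Sum>i=1..N. \<bar>\<kappa> (\<xi> i \<omega>)\<bar>)" by (rule sum_norm_le)
        also have "\<dots> \<le> M * real N" by (rule M)
        finally show ?thesis using N by (simp add: V'(1) field_simps)
      qed
      show ?case by (intro exI[of _ M] allI ballI impI) (rule *)
    qed
    then show "\<exists>U. open U \<and> x \<in> U \<and> (AE \<omega> in P. \<exists>M. \<forall>y\<in>U. \<forall>N\<ge>1.
      \<forall>v\<in>sampled_subgradients \<phi> (\<lambda>i. \<xi> i \<omega>) N y. norm v \<le> M)" 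
      using V by (intro exI[of _ V] conjI)
  qed
  then show ?thesis unfolding ball_UNIV .
qed

lemma local_quadratic_upper_bound:
  fixes \<phi> :: "'xi \<Rightarrow> 'a::euclidean_space \<Rightarrow> real"
  assumes upper: "\<And>y. upper_C2_around \<mu> \<phi> y"
  shows "AE \<omega> in P. \<forall>x. \<exists>U L. open U \<and> x \<in> U \<and>
    (\<forall>N\<ge>1. \<forall>y\<in>U. \<forall>z\<in>U. \<forall>v\<in>sampled_subgradients \<phi> (\<lambda>i. \<xi> i \<omega>) N y.
      empirical \<phi> (\<lambda>i. \<xi> i \<omega>) N z \<le> empirical \<phi> (\<lambda>i. \<xi> i \<omega>) N y + v \<bullet> (z - y) + L * (norm (z - y))\<^sup>2)"
proof -
  have "AE \<omega> in P. \<forall>x\<in>UNIV. \<exists>U L. open U \<and> x \<in> U \<and> (\<forall>N\<ge>1. \<forall>y\<in>U. \<forall>z\<in>U.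
    \<forall>v\<in>sampled_subgradients \<phi> (\<lambda>i. \<xi> i \<omega>) N y.
      empirical \<phi> (\<lambda>i. \<xi> i \<omega>) N z \<le> empirical \<phi> (\<lambda>i. \<xi> i \<omega>) N y + v \<bullet> (z - y) + L * (norm (z - y))\<^sup>2)"
  proof (rule AE_local_constant[where Q = "\<lambda>U L \<omega>. \<forall>N\<ge>1. \<forall>y\<in>U. \<forall>z\<in>U. \<forall>v\<in>sampled_subgradients \<phi> (\<lambda>i. \<xi> i \<omega>) N y.
      empirical \<phi> (\<lambda>i. \<xi> i \<omega>) N z \<le> empirical \<phi> (\<lambda>i. \<xi> i \<omega>) N y + v \<bullet> (z - y) + L * (norm (z - y))\<^sup>2"])
    fix x :: 'a
    obtain V l where V: "open V" "x \<in> V" and l: "integrable \<mu> l" "\<forall>z\<in>space \<mu>. (0::real) \<le> l z"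
      and up: "\<forall>\<xi>\<in>space \<mu>. \<forall>x\<in>V. \<forall>v\<in>clarke_subdiff (\<lambda>y. ereal (\<phi> \<xi> y)) x. \<forall>y\<in>V.
          \<phi> \<xi> y \<le> \<phi> \<xi> x + v \<bullet> (y - x) + l \<xi> * (norm (y - x))\<^sup>2"
      using upper[of x] unfolding upper_C2_around_def by (elim exE conjE) rule
    have "AE \<omega> in P. \<exists>L. \<forall>N. (\<Sum>j=1..N. l (\<xi> j \<omega>)) \<le> L * real N"
      by (rule bounded_averages) (use l in auto)
    with AE_space have "AE \<omega> in P. \<exists>L. \<forall>N\<ge>1. \<forall>y\<in>V. \<forall>z\<in>V. \<forall>v\<in>sampled_subgradients \<phi> (\<lambda>i. \<xi> i \<omega>) N y.
      empirical \<phi> (\<lambda>i. \<xi> i \<omega>) N z \<le> empirical \<phi> (\<lambda>i. \<xi> i \<omega>) N y + v \<bullet> (z - y) + L * (norm (z - y))\<^sup>2"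
    proof eventually_elim
      case (elim \<omega>)
      then obtain L where L: "\<And>N. (\<Sum>j=1..N. l (\<xi> j \<omega>)) \<le> L * real N" by blast
      have *: "empirical \<phi> (\<lambda>i. \<xi> i \<omega>) N z \<le> empirical \<phi> (\<lambda>i. \<xi> i \<omega>) N y + v \<bullet> (z - y) + L * (norm (z - y))\<^sup>2"
        if N: "1 \<le> N" and y: "y \<in> V" and z: "z \<in> V" and v: "v \<in> sampled_subgradients \<phi> (\<lambda>i. \<xi> i \<omega>) N y" for N y z v
      proof -
        obtain V' where V': "v = (1 / real N) *\<^sub>R (\<Sum>i=1..N. V' i)"
          "\<And>i. i \<in> {1..N} \<Longrightarrow> V' i \<in> clarke_subdiff (\<lambda>y. ereal (\<phi> (\<xi> i \<omega>) y)) y"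
          by (rule sampled_subgradientsE[OF v]) blast
        have "(\<Sum>i=1..N. \<phi> (\<xi> i \<omega>) z)
            \<le> (\<Sum>i=1..N. \<phi> (\<xi> i \<omega>) y + V' i \<bullet> (z - y) + l (\<xi> i \<omega>) * (norm (z - y))\<^sup>2)"
        proof (rule sum_mono)
          fix i assume i: "i \<in> {1..N}"
          have "\<xi> i \<omega> \<in> space \<mu>" using sample_in_space elim i by auto
          then show "\<phi> (\<xi> i \<omega>) z \<le> \<phi> (\<xi> i \<omega>) y + V' i \<bullet> (z - y) + l (\<xi> i \<omega>) * (norm (z - y))\<^sup>2"
            using up[rule_format, OF _ y V'(2)[OF i] z] by simp
        qed
        also have "\<dots> = (\<Sum>i=1..N. \<phi> (\<xi> i \<omega>) y) + (\<Sum>i=1..N. V' i) \<bullet> (z - y)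
            + (\<Sum>i=1..N. l (\<xi> i \<omega>)) * (norm (z - y))\<^sup>2"
          by (simp add: sum.distrib inner_sum_left sum_distrib_right)
        also have "(\<Sum>i=1..N. l (\<xi> i \<omega>)) * (norm (z - y))\<^sup>2 \<le> L * real N * (norm (z - y))\<^sup>2"
          by (rule mult_right_mono[OF L]) simp
        finally have "(\<Sum>i=1..N. \<phi> (\<xi> i \<omega>) z) / real N \<le> ((\<Sum>i=1..N. \<phi> (\<xi> i \<omega>) y) + (\<Sum>i=1..N. V' i) \<bullet> (z - y)
            + L * real N * (norm (z - y))\<^sup>2) / real N" by (intro divide_right_mono) auto
        then show ?thesis using N by (simp add: empirical_def V'(1) add_divide_distrib)
      qed
      show ?case by (intro exI[of _ L] allI ballI impI) (rule *)
    qed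
    then show "\<exists>U. open U \<and> x \<in> U \<and> (AE \<omega> in P. \<exists>L. \<forall>N\<ge>1. \<forall>y\<in>U. \<forall>z\<in>U.
      \<forall>v\<in>sampled_subgradients \<phi> (\<lambda>i. \<xi> i \<omega>) N y.
      empirical \<phi> (\<lambda>i. \<xi> i \<omega>) N z \<le> empirical \<phi> (\<lambda>i. \<xi> i \<omega>) N y + v \<bullet> (z - y) + L * (norm (z - y))\<^sup>2)"
      using V by (intro exI[of _ V] conjI)
  qed
  then show ?thesis unfolding ball_UNIV .
qed

text \<open>The gradients of an integrand with Lipschitz gradient form, coordinate by coordinate, a family to which \<open>uniform_rate\<close>
  applies; by \<open>clarke_subdiff_smooth\<close> they are the only Clarke subgradients, hence sampled subgradients are
  averages of gradients. Integrating the pointwise quadratic expansions shows that the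
  expected gradient serves as gradient of the expectation.\<close>

lemma local_gradient_rate:
  fixes \<phi> :: "'xi \<Rightarrow> 'a::euclidean_space \<Rightarrow> real"
  assumes int: "\<And>y. integrable \<mu> (\<lambda>z. \<phi> z y)" and C11: "\<forall>x\<in>S. C11_around \<mu> \<phi> x"
  shows "AE \<omega> in P. \<forall>x\<in>S. \<exists>U g L C. open U \<and> x \<in> U \<and>
      (\<forall>y\<in>U. \<forall>z\<in>U. \<bar>expected \<mu> \<phi> z - expected \<mu> \<phi> y - g y \<bullet> (z - y)\<bar> \<le> L * (norm (z - y))\<^sup>2 \<and>
          norm (g y - g z) \<le> L * norm (y - z)) \<and>
      (\<forall>y\<in>U. \<forall>N\<ge>2. \<forall>v\<in>sampled_subgradients \<phi> (\<lambda>i. \<xi> i \<omega>) N y.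
          norm (v - g y) \<le> C * (ln (real N) / sqrt (real N)))"
proof -
  let ?Q = "\<lambda>U \<omega>. \<exists>g L C.
      (\<forall>y\<in>U. \<forall>z\<in>U. \<bar>expected \<mu> \<phi> z - expected \<mu> \<phi> y - g y \<bullet> (z - y)\<bar> \<le> L * (norm (z - y))\<^sup>2 \<and>
          norm (g y - g z) \<le> L * norm (y - z)) \<and>
      (\<forall>y\<in>U. \<forall>N\<ge>2. \<forall>v\<in>sampled_subgradients \<phi> (\<lambda>i. \<xi> i \<omega>) N y.
          norm (v - g y) \<le> C * (ln (real N) / sqrt (real N)))"
  have "AE \<omega> in P. \<forall>x\<in>S. \<exists>U. open U \<and> x \<in> U \<and> ?Q U \<omega>"
  proof (rule AE_local_property)
    fix x :: 'a assume "x \<in> S"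
    from bspec[OF C11 this] obtain \<kappa>0 e G where \<kappa>0: "square_integrable \<mu> (\<kappa>0 :: 'xi \<Rightarrow> real)" and e: "0 < e"
      and der: "\<forall>z\<in>space \<mu>. \<forall>y\<in>cball x e. GDERIV (\<phi> z) y :> G z y"
      and lip0: "\<forall>z\<in>space \<mu>. \<forall>y\<in>cball x e. \<forall>y'\<in>cball x e. norm (G z y - G z y') \<le> \<kappa>0 z * norm (y - y')"
      and Gx: "square_integrable \<mu> (\<lambda>z. G z x)"
      unfolding C11_around_def by (elim exE conjE) rule
    define U where "U = ball x e"
    have U: "open U" "x \<in> U" "convex U" using e by (auto simp: U_def)
    define \<kappa> where "\<kappa> z = norm (\<kappa>0 z)" for z
    have \<kappa>: "square_integrable \<mu> \<kappa>" "\<And>z. 0 \<le> \<kappa> z"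
      using square_integrable_norm[OF \<kappa>0] by (auto simp: \<kappa>_def[abs_def])
    have lip: "norm (G z y - G z y') \<le> \<kappa> z * norm (y - y')" if "z \<in> space \<mu>" "y \<in> U" "y' \<in> U" for z y y'
    proof -
      have "norm (G z y - G z y') \<le> \<kappa>0 z * norm (y - y')"
        
        by (rule lip0[rule_format]) (use that in \<open>auto simp: U_def\<close>)
      also have "\<dots> \<le> \<kappa> z * norm (y - y')" unfolding \<kappa>_def by (intro mult_right_mono) auto
      finally show ?thesis .
    qed
    have quad: "\<bar>\<phi> z y' - \<phi> z y - G z y \<bullet> (y' - y)\<bar> \<le> \<kappa> z * (norm (y' - y))\<^sup>2"
      if z: "z \<in> space \<mu>" and "y \<in> U" "y' \<in> U" for z y y'
    proof (rule quadratic_expansion[OF U(3) _ lip[OF z] \<kappa>(2) that(2,3)])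
      show "GDERIV (\<phi> z) y :> G z y" if "y \<in> U" for y
        by (rule der[rule_format, OF z]) (use that in \<open>auto simp: U_def\<close>)
    qed auto
    define h where "h z = norm (G z x) + (e + 1) * \<kappa> z" for z
    have h: "square_integrable \<mu> h" unfolding h_def
      by (intro square_integrable_add square_integrable_cmult square_integrable_norm Gx \<kappa>)
    have \<kappa>h: "\<kappa> z \<le> h z" for z
    proof -
      have "1 * \<kappa> z \<le> (e + 1) * \<kappa> z" using e \<kappa>(2) by (intro mult_right_mono) auto
      then show ?thesis by (simp add: h_def add_increasing)
    qed
    have Gh: "norm (G z y) \<le> h z" if "z \<in> space \<mu>" "y \<in> U" for z y
    proof -
      have "norm (G z y) \<le> norm (G z x) + norm (G z y - G z x)" by (rule norm_triangle_sub)
      moreover have "norm (G z y - G z x) \<le> \<kappa> z * norm (y - x)" by (rule lip[OF that U(2)])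
      moreover have "\<kappa> z * norm (y - x) \<le> \<kappa> z * (e + 1)"
        using that \<kappa>(2) by (intro mult_left_mono) (auto simp: U_def dist_norm norm_minus_commute)
      ultimately show ?thesis by (simp add: h_def mult.commute)
    qed
    have \<phi>m [measurable]: "(\<lambda>z. \<phi> z y) \<in> borel_measurable \<mu>" for y using int[of y] by auto
    \<comment> \<open>Coordinates of the gradient are limits of difference quotients, which are measurable.\<close>
    have Gm: "(\<lambda>z. G z y \<bullet> b) \<in> borel_measurable \<mu>" if y: "y \<in> U" and b: "b \<in> Basis" for y b
    proof -
      define t where "t m = 1 / real (Suc m)" for m
      have t: "t m > 0" "t \<longlonglongrightarrow> 0" for m
        unfolding t_def using LIMSEQ_inverse_real_of_nat by (auto simp: inverse_eq_divide)
      have "(\<lambda>m. y + t m *\<^sub>R b) \<longlonglongrightarrow> y + 0 *\<^sub>R b" by (intro tendsto_intros t)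
      then have ev: "\<forall>\<^sub>F m in sequentially. y + t m *\<^sub>R b \<in> U"
        using U(1) y by (auto intro: topological_tendstoD)
      show ?thesis
      proof (rule borel_measurable_LIMSEQ_real)
        show "(\<lambda>z. (\<phi> z (y + t m *\<^sub>R b) - \<phi> z y) / t m) \<in> borel_measurable \<mu>" for m by measurable
        show "(\<lambda>m. (\<phi> z (y + t m *\<^sub>R b) - \<phi> z y) / t m) \<longlonglongrightarrow> G z y \<bullet> b" if z: "z \<in> space \<mu>" for z
        proof (rule LIM_zero_cancel, rule Lim_null_comparison)
          show "\<forall>\<^sub>F m in sequentially. norm ((\<phi> z (y + t m *\<^sub>R b) - \<phi> z y) / t m - G z y \<bullet> b) \<le> \<kappa> z * t m"
            using ev
          proof eventually_elim
            case (elim m)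
            have "\<bar>\<phi> z (y + t m *\<^sub>R b) - \<phi> z y - t m * (G z y \<bullet> b)\<bar> \<le> \<kappa> z * (t m)\<^sup>2"
              using quad[OF z y elim] b t(1)[of m] by simp
            then have "\<bar>\<phi> z (y + t m *\<^sub>R b) - \<phi> z y - t m * (G z y \<bullet> b)\<bar> / t m \<le> \<kappa> z * t m"
              using t(1)[of m] by (simp add: divide_le_eq power2_eq_square mult.assoc)
            moreover have "(\<phi> z (y + t m *\<^sub>R b) - \<phi> z y) / t m - G z y \<bullet> b
                = (\<phi> z (y + t m *\<^sub>R b) - \<phi> z y - t m * (G z y \<bullet> b)) / t m"
              using t(1)[of m] by (simp add: diff_divide_distrib)
            ultimately show ?case using t(1)[of m] by (simp add: abs_divide)
          qed
          have "(\<lambda>m. \<kappa> z * t m) \<longlonglongrightarrow> \<kappa> z * 0" by (intro tendsto_intros t)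
          then show "(\<lambda>m. \<kappa> z * t m) \<longlonglongrightarrow> 0" by simp
        qed
      qed
    qed
    have i\<kappa>: "integrable \<mu> \<kappa>" by (rule square_integrable_imp_integrable[OF \<kappa>(1)])
    have ih: "integrable \<mu> h" by (rule square_integrable_imp_integrable[OF h])
    have iG: "integrable \<mu> (\<lambda>z. G z y)" if "y \<in> U" for y
    proof (rule Bochner_Integration.integrable_bound[OF ih])
      show "(\<lambda>z. G z y) \<in> borel_measurable \<mu>"
        using Gm[OF that] by (subst borel_measurable_euclidean_space) simp
      show "AE z in \<mu>. norm (G z y) \<le> norm (h z)"
      proof (rule AE_I2)
        fix z assume "z \<in> space \<mu>"
        from Gh[OF this that] show "norm (G z y) \<le> norm (h z)" by simp
      qed
    qed
    define g where "g y = (\<integral>z. G z y \<partial>\<mu>)" for y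
    define L where "L = integral\<^sup>L \<mu> \<kappa>"
    have det: "\<bar>expected \<mu> \<phi> y' - expected \<mu> \<phi> y - g y \<bullet> (y' - y)\<bar> \<le> L * (norm (y' - y))\<^sup>2 \<and>
        norm (g y - g y') \<le> L * norm (y - y')" if yy: "y \<in> U" "y' \<in> U" for y y'
    proof
      have "\<bar>\<integral>z. \<phi> z y' - \<phi> z y - G z y \<bullet> (y' - y) \<partial>\<mu>\<bar> \<le> (\<integral>z. \<kappa> z * (norm (y' - y))\<^sup>2 \<partial>\<mu>)"
        by (rule order_trans[OF integral_abs_bound integral_mono]) (use int i\<kappa> iG quad yy in auto)
      moreover have "(\<integral>z. \<phi> z y' - \<phi> z y - G z y \<bullet> (y' - y) \<partial>\<mu>)
          = expected \<mu> \<phi> y' - expected \<mu> \<phi> y - g y \<bullet> (y' - y)"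
        using int iG[OF yy(1)] by (simp add: expected_def g_def)
      ultimately show "\<bar>expected \<mu> \<phi> y' - expected \<mu> \<phi> y - g y \<bullet> (y' - y)\<bar> \<le> L * (norm (y' - y))\<^sup>2"
        by (simp add: L_def)
      have "norm (\<integral>z. G z y - G z y' \<partial>\<mu>) \<le> (\<integral>z. \<kappa> z * norm (y - y') \<partial>\<mu>)"
        by (rule order_trans[OF integral_norm_bound integral_mono]) (use i\<kappa> iG lip yy in auto)
      then show "norm (g y - g y') \<le> L * norm (y - y')" using iG yy by (simp add: g_def L_def)
    qed
    have "AE \<omega> in P. \<forall>b\<in>Basis. \<exists>C. \<forall>y\<in>U. \<forall>N\<ge>2.
      \<bar>(\<Sum>j=1..N. G (\<xi> j \<omega>) y \<bullet> b) / real N - (\<integral>z. G z y \<bullet> b \<partial>\<mu>)\<bar> \<le> C * (ln (real N) / sqrt (real N))"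
    proof (rule AE_finite_allI[OF finite_Basis])
      fix b :: 'a assume b: "b \<in> Basis"
      show "AE \<omega> in P. \<exists>C. \<forall>y\<in>U. \<forall>N\<ge>2.
        \<bar>(\<Sum>j=1..N. G (\<xi> j \<omega>) y \<bullet> b) / real N - (\<integral>z. G z y \<bullet> b \<partial>\<mu>)\<bar> \<le> C * (ln (real N) / sqrt (real N))"
      proof (rule uniform_rate)
        show "bounded U" by (simp add: U_def)
        show "h \<in> borel_measurable \<mu>" "integrable \<mu> (\<lambda>z. (h z)\<^sup>2)" using h by (auto simp: square_integrable_def)
        show "(\<lambda>z. G z y \<bullet> b) \<in> borel_measurable \<mu>" if "y \<in> U" for y by (rule Gm[OF that b])
        show "\<bar>G z y \<bullet> b\<bar> \<le> h z" if "z \<in> space \<mu>" "y \<in> U" for z y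
          using Basis_le_norm[OF b] Gh[OF that] by (rule order_trans)
        show "\<bar>G z y \<bullet> b - G z y' \<bullet> b\<bar> \<le> h z * norm (y - y')"
          if "z \<in> space \<mu>" "y \<in> U" "y' \<in> U" for z y y'
        proof -
          have "\<bar>G z y \<bullet> b - G z y' \<bullet> b\<bar> \<le> norm (G z y - G z y')"
            using Basis_le_norm[OF b, of "G z y - G z y'"] by (simp add: inner_diff_left)
          also have "\<dots> \<le> \<kappa> z * norm (y - y')" by (rule lip[OF that])
          also have "\<dots> \<le> h z * norm (y - y')" by (rule mult_right_mono[OF \<kappa>h]) simp
          finally show ?thesis .
        qed
      qed
    qed
    with AE_space have "AE \<omega> in P. \<exists>C. \<forall>y\<in>U. \<forall>N\<ge>2. \<forall>v\<in>sampled_subgradients \<phi> (\<lambda>i. \<xi> i \<omega>) N y.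
          norm (v - g y) \<le> C * (ln (real N) / sqrt (real N))"
    proof eventually_elim
      case (elim \<omega>)
      from bchoice[OF elim(2)] obtain C where C: "\<forall>b\<in>Basis. \<forall>y\<in>U. \<forall>N\<ge>2.
        \<bar>(\<Sum>j=1..N. G (\<xi> j \<omega>) y \<bullet> b) / real N - (\<integral>z. G z y \<bullet> b \<partial>\<mu>)\<bar> \<le> C b * (ln (real N) / sqrt (real N))"
        by (elim exE)
      have *: "norm (v - g y) \<le> (\<Sum>b\<in>Basis. C b) * (ln (real N) / sqrt (real N))"
        if y: "y \<in> U" and N: "2 \<le> N" and v: "v \<in> sampled_subgradients \<phi> (\<lambda>i. \<xi> i \<omega>) N y" for y N v
      proof -
        obtain V' where V': "v = (1 / real N) *\<^sub>R (\<Sum>i=1..N. V' i)"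
          "\<And>i. i \<in> {1..N} \<Longrightarrow> V' i \<in> clarke_subdiff (\<lambda>y. ereal (\<phi> (\<xi> i \<omega>) y)) y"
          by (rule sampled_subgradientsE[OF v]) blast
        have V'G: "V' i = G (\<xi> i \<omega>) y" if i: "i \<in> {1..N}" for i
        proof (rule clarke_subdiff_smooth[OF U(1) y V'(2)[OF i]])
          have sp: "\<xi> i \<omega> \<in> space \<mu>" using sample_in_space elim i by auto
          show "\<phi> (\<xi> i \<omega>) z \<le> \<phi> (\<xi> i \<omega>) y + G (\<xi> i \<omega>) y \<bullet> (z - y) + \<kappa> (\<xi> i \<omega>) * (norm (z - y))\<^sup>2"
            if "y \<in> U" "z \<in> U" for y z using quad[OF sp that] by linarith
          show "isCont (G (\<xi> i \<omega>)) y"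
          proof -
            have "((\<lambda>z. \<kappa> (\<xi> i \<omega>) * norm (z - y)) \<longlongrightarrow> \<kappa> (\<xi> i \<omega>) * norm (y - y)) (at y)" by (intro tendsto_intros)
            then have lim: "((\<lambda>z. \<kappa> (\<xi> i \<omega>) * norm (z - y)) \<longlongrightarrow> 0) (at y)" by simp
            have "\<forall>\<^sub>F z in at y. norm (G (\<xi> i \<omega>) z - G (\<xi> i \<omega>) y) \<le> \<kappa> (\<xi> i \<omega>) * norm (z - y)"
              using eventually_at_in_open'[OF U(1) y] by eventually_elim (use lip[OF sp] y in auto)
            from Lim_null_comparison[OF this lim] show ?thesis by (simp add: isCont_def LIM_zero_iff)
          qed
        qed
        have "\<bar>(v - g y) \<bullet> b\<bar> \<le> C b * (ln (real N) / sqrt (real N))" if b: "b \<in> Basis" for b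
        proof -
          have "v \<bullet> b = (\<Sum>j=1..N. G (\<xi> j \<omega>) y \<bullet> b) / real N"
            by (simp add: V'(1) V'G inner_sum_left)
          moreover have "g y \<bullet> b = (\<integral>z. G z y \<bullet> b \<partial>\<mu>)" using iG[OF y] by (simp add: g_def)
          ultimately show ?thesis using C[rule_format, OF b y N] by (simp add: inner_diff_left)
        qed
        then show ?thesis unfolding sum_distrib_right by (intro order_trans[OF norm_le_l1 sum_mono])
      qed
      show ?case by (intro exI[of _ "\<Sum>b\<in>Basis. C b"] allI ballI impI) (rule *)
    qed
    then have "AE \<omega> in P. ?Q U \<omega>"
    proof eventually_elim
      case (elim \<omega>)
      then obtain C where C: "\<forall>y\<in>U. \<forall>N\<ge>2. \<forall>v\<in>sampled_subgradients \<phi> (\<lambda>i. \<xi> i \<omega>) N y.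
          norm (v - g y) \<le> C * (ln (real N) / sqrt (real N))" by (elim exE)
      show ?case by (rule exI[of _ g], rule exI[of _ L], rule exI[of _ C]) (use det C in \<open>intro conjI ballI; simp\<close>)
    qed
    with U(1,2) show "\<exists>U. open U \<and> x \<in> U \<and> (AE \<omega> in P. ?Q U \<omega>)" by (intro exI[of _ U] conjI)
  qed
  then show ?thesis
    by eventually_elim (simp only: ex_simps)
qed

end

section \<open>Almost sure convergence\<close>

lemma pss_iteration_sampled:
  assumes "pss_iteration \<rho> \<sigma> \<gamma>min \<phi> \<psi> s N x x'"
  shows "\<exists>v\<in>sampled_subgradients \<phi> s N x. \<exists>\<gamma>\<ge>\<gamma>min.
    backtracking \<rho> \<sigma> \<psi> (\<lambda>y. ereal (empirical \<phi> s N y) + \<psi> y) x v \<gamma> x'"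
proof -
  obtain v \<gamma> where "\<forall>i\<in>{1..N}. v i \<in> clarke_subdiff (\<lambda>y. ereal (\<phi> (s i) y)) x" "\<gamma>min \<le> \<gamma>"
    "backtracking \<rho> \<sigma> \<psi> (empirical_objective \<phi> \<psi> s N) x ((1 / real N) *\<^sub>R (\<Sum>i=1..N. v i)) \<gamma> x'"
    using assms unfolding pss_iteration_def by (elim exE conjE) rule
  moreover have "empirical_objective \<phi> \<psi> s N = (\<lambda>y. ereal (empirical \<phi> s N y) + \<psi> y)"
    by (rule ext) (simp add: empirical_objective_def)
  ultimately show ?thesis unfolding sampled_subgradients_def
    by (intro bexI[of _ "(1 / real N) *\<^sub>R (\<Sum>i=1..N. v i)"] exI[of _ \<gamma>] conjI CollectI exI[of _ v]) simp_all
qed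

theorem theorem4p2:
  fixes \<mu> :: "'xi measure" and P :: "'w measure"
    and \<phi> :: "'xi \<Rightarrow> real ^ 'd \<Rightarrow> real" and \<psi> :: "real ^ 'd \<Rightarrow> ereal"
    and \<xi> :: "nat \<Rightarrow> 'w \<Rightarrow> 'xi" and n :: "nat \<Rightarrow> nat"
    and F :: "nat \<Rightarrow> 'w measure"
    and x0 :: "real ^ 'd" and x :: "nat \<Rightarrow> 'w \<Rightarrow> real ^ 'd"
    and \<rho> \<sigma> \<gamma>min :: real
  assumes "prob_space \<mu>" and "prob_space P"
    and "proper \<psi>" and "lsc \<psi>" and "prox_bounded \<psi>"
    and "upper_C2_normal_integrand \<mu> \<phi>"
    and "ereal_integrable \<mu> (\<lambda>z. INF y. ereal (\<phi> z y) + \<psi> y)"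
    and "C11_around_set \<mu> \<phi> (stationary_points \<mu> \<phi> \<psi>)"
    and "iid_samples P \<mu> \<xi>"
    and "mono n" and "\<And>k. 0 < n k" and "filterlim n at_top sequentially"
    and "summable (\<lambda>k. sample_rate n (Suc k))"
    and "0 < \<rho>" and "\<rho> < 1" and "0 < \<sigma>" and "0 < \<gamma>min"
    and "x0 \<in> edom (objective \<mu> \<phi> \<psi>)"
    and "\<And>\<omega>. \<omega> \<in> space P \<Longrightarrow>
           pss_sequence \<rho> \<sigma> \<gamma>min \<phi> \<psi> n x0 (\<lambda>i. \<xi> i \<omega>) (\<lambda>k. x k \<omega>)"
    and "sampling_filtration P \<mu> \<xi> n x F"
  shows "\<exists>\<Omega>hat\<in>sets P. measure P (space P - \<Omega>hat) = 0 \<and>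
    (\<forall>\<omega>\<in>\<Omega>hat. \<forall>xbar \<eta> \<theta> p0.
        bounded (range (\<lambda>k. x k \<omega>)) \<and>
        accumulation_point (\<lambda>k. x k \<omega>) xbar \<and>
        KL_condition (objective \<mu> \<phi> \<psi>) xbar \<eta> \<theta> \<and>
        quasi_additive \<eta> \<theta> \<and>
        (\<forall>k\<ge>p0. (\<Sum>t. sample_rate n (k + t)) \<in> {0<..<\<eta>}) \<and>
        summable (\<lambda>k. inverse (deriv \<theta> (\<Sum>t. sample_rate n (p0 + k + t)))) \<and>
        (\<forall>k\<ge>p0. objective \<mu> \<phi> \<psi> (x k \<omega>) > objective \<mu> \<phi> \<psi> xbar)
        \<longrightarrow> (\<lambda>k. x k \<omega>) \<longlonglongrightarrow> xbar)"
proof -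
  interpret iid_sampling P \<mu> \<xi>
    by (rule iid_sampling.intro[OF assms(2)], rule iid_sampling_axioms.intro[OF assms(9)])
  have upper: "upper_C2_around \<mu> \<phi> y" for y using assms(6) by (simp add: upper_C2_normal_integrand_def)
  have lip2: "loc_lipschitz_L2 \<mu> \<phi> y" for y using upper[of y] by (simp add: upper_C2_around_def)
  have int: "integrable \<mu> (\<lambda>z. \<phi> z y)" for y
    using lip2[of y] by (intro square_integrable_imp_integrable) (simp add: loc_lipschitz_L2_def)
  have C11: "\<forall>y\<in>stationary_points \<mu> \<phi> \<psi>. C11_around \<mu> \<phi> y"
    using assms(8) by (simp add: C11_around_set_def)
  have obj: "objective \<mu> \<phi> \<psi> = (\<lambda>y. ereal (expected \<mu> \<phi> y) + \<psi> y)"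
    by (rule ext) (simp add: objective_def)
  define conv where "conv \<omega> \<longleftrightarrow> (\<forall>xbar \<eta> \<theta> p0.
        bounded (range (\<lambda>k. x k \<omega>)) \<and>
        accumulation_point (\<lambda>k. x k \<omega>) xbar \<and>
        KL_condition (objective \<mu> \<phi> \<psi>) xbar \<eta> \<theta> \<and>
        quasi_additive \<eta> \<theta> \<and>
        (\<forall>k\<ge>p0. (\<Sum>t. sample_rate n (k + t)) \<in> {0<..<\<eta>}) \<and>
        summable (\<lambda>k. inverse (deriv \<theta> (\<Sum>t. sample_rate n (p0 + k + t)))) \<and>
        (\<forall>k\<ge>p0. objective \<mu> \<phi> \<psi> (x k \<omega>) > objective \<mu> \<phi> \<psi> xbar)
        \<longrightarrow> (\<lambda>k. x k \<omega>) \<longlonglongrightarrow> xbar)" for \<omega>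
  have "AE \<omega> in P. conv \<omega>"
    using AE_space local_value_rate[OF lip2] local_subgradient_bound[OF lip2]
      local_quadratic_upper_bound[OF upper] local_gradient_rate[OF int C11]
  proof eventually_elim
    case (elim \<omega>)
    have seq: "pss_sequence \<rho> \<sigma> \<gamma>min \<phi> \<psi> n x0 (\<lambda>i. \<xi> i \<omega>) (\<lambda>k. x k \<omega>)" by (rule assms(19)[OF elim(1)])
    show ?case unfolding conv_def
    proof (intro allI impI, elim conjE)
      fix xbar \<eta> \<theta> p0
      assume bdd: "bounded (range (\<lambda>k. x k \<omega>))" and hyps: "accumulation_point (\<lambda>k. x k \<omega>) xbar"
        "KL_condition (objective \<mu> \<phi> \<psi>) xbar \<eta> \<theta>" "quasi_additive \<eta> \<theta>"
        "\<forall>k\<ge>p0. (\<Sum>t. sample_rate n (k + t)) \<in> {0<..<\<eta>}"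
        "summable (\<lambda>k. inverse (deriv \<theta> (\<Sum>t. sample_rate n (p0 + k + t))))"
        "\<forall>k\<ge>p0. objective \<mu> \<phi> \<psi> (x k \<omega>) > objective \<mu> \<phi> \<psi> xbar"
      interpret run: pss_trajectory "expected \<mu> \<phi>" "empirical \<phi> (\<lambda>i. \<xi> i \<omega>)"
        "sampled_subgradients \<phi> (\<lambda>i. \<xi> i \<omega>)" \<psi> n "\<lambda>k. x k \<omega>" \<rho> \<sigma> \<gamma>min
      proof (rule pss_trajectory.intro)
        show "proper \<psi>" "lsc \<psi>" "prox_bounded \<psi>" "\<And>k. 0 < n k" "filterlim n at_top sequentially"
          "0 < \<rho>" "0 < \<sigma>" "0 < \<gamma>min" "bounded (range (\<lambda>k. x k \<omega>))"
          by (fact assms bdd)+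
        show "summable (sample_rate n)" using assms(13) by (simp only: summable_Suc_iff)
        show "\<psi> (x 0 \<omega>) < \<infinity>"
          using assms(18) seq by (auto simp: edom_def objective_def pss_sequence_def)
        show "\<exists>v\<in>sampled_subgradients \<phi> (\<lambda>i. \<xi> i \<omega>) (n k) (x k \<omega>). \<exists>\<gamma>\<ge>\<gamma>min.
          backtracking \<rho> \<sigma> \<psi> (\<lambda>y. ereal (empirical \<phi> (\<lambda>i. \<xi> i \<omega>) (n k) y) + \<psi> y) (x k \<omega>) v \<gamma> (x (Suc k) \<omega>)" for k
          by (rule pss_iteration_sampled) (use seq in \<open>simp add: pss_sequence_def\<close>)
        show "\<exists>U k. open U \<and> y \<in> U \<and> (\<forall>z\<in>U. \<forall>z'\<in>U. \<bar>expected \<mu> \<phi> z - expected \<mu> \<phi> z'\<bar> \<le> k * norm (z - z'))" for y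
          by (rule expected_lipschitz[OF lip2])
        show "\<exists>U C. open U \<and> y \<in> U \<and> (\<forall>z\<in>U. \<forall>N\<ge>2.
            \<bar>empirical \<phi> (\<lambda>i. \<xi> i \<omega>) N z - expected \<mu> \<phi> z\<bar> \<le> C * (ln (real N) / sqrt (real N)))" for y
          using elim(2) by (rule spec)
        show "\<exists>U M. open U \<and> y \<in> U \<and>
            (\<forall>z\<in>U. \<forall>N\<ge>1. \<forall>v\<in>sampled_subgradients \<phi> (\<lambda>i. \<xi> i \<omega>) N z. norm v \<le> M)" for y
          using elim(3) by (rule spec)
        show "\<exists>U L. open U \<and> y \<in> U \<and> (\<forall>N\<ge>1. \<forall>z\<in>U. \<forall>z'\<in>U. \<forall>v\<in>sampled_subgradients \<phi> (\<lambda>i. \<xi> i \<omega>) N z.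
            empirical \<phi> (\<lambda>i. \<xi> i \<omega>) N z' \<le> empirical \<phi> (\<lambda>i. \<xi> i \<omega>) N z + v \<bullet> (z' - z) + L * (norm (z' - z))\<^sup>2)" for y
          using elim(4) by (rule spec)
        show "\<exists>U g L C. open U \<and> y \<in> U \<and>
          (\<forall>z\<in>U. \<forall>z'\<in>U. \<bar>expected \<mu> \<phi> z' - expected \<mu> \<phi> z - g z \<bullet> (z' - z)\<bar> \<le> L * (norm (z' - z))\<^sup>2 \<and>
              norm (g z - g z') \<le> L * norm (z - z')) \<and>
          (\<forall>z\<in>U. \<forall>N\<ge>2. \<forall>v\<in>sampled_subgradients \<phi> (\<lambda>i. \<xi> i \<omega>) N z.
              norm (v - g z) \<le> C * (ln (real N) / sqrt (real N)))"
          if "v \<in> clarke_subdiff (\<lambda>y. ereal (expected \<mu> \<phi> y)) y" "0 < \<gamma>" "y \<in> prox \<gamma> \<psi> (y - \<gamma> *\<^sub>R v)" for y v \<gamma>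
        proof (rule bspec[OF elim(5)])
          show "y \<in> stationary_points \<mu> \<phi> \<psi>"
            unfolding stationary_points_def mem_Collect_eq
            by (rule bexI[OF _ that(1)], rule exI[of _ \<gamma>], rule conjI) (fact that)+
        qed
      qed
      show "(\<lambda>k. x k \<omega>) \<longlonglongrightarrow> xbar"
        by (rule run.KL_implies_convergence[OF hyps[unfolded obj]])
    qed
  qed
  then obtain N where N: "{\<omega> \<in> space P. \<not> conv \<omega>} \<subseteq> N" "emeasure P N = 0" "N \<in> sets P" by (rule AE_E)
  show ?thesis
    unfolding conv_def[symmetric]
  proof (rule bexI[of _ "space P - N"], rule conjI)
    have "space P - (space P - N) = N" using sets.sets_into_space[OF N(3)] by auto
    then show "measure P (space P - (space P - N)) = 0" using N(2) by (simp add: measure_def)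
    show "space P - N \<in> sets P" using N(3) by simp
    have "conv \<omega>" if "\<omega> \<in> space P - N" for \<omega> using N(1) that by blast
    then show "\<forall>\<omega>\<in>space P - N. conv \<omega>" by (rule ballI)
  qed
qed

end
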